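(* Let $\mathcal{B}=\bigoplus_{j=0}^{r-1}M_{m_j}(\mathbb{C})\subset\mathcal{A}=\bigoplus_{i=0}^{s-1}M_{n_i}(\mathbb{C})$ be a unital inclusion of finite-dimensional von Neumann algebras with inclusion matrix $A$, and let $E:\mathcal{A}\to\mathcal{B}$ be the unique conditional expectation preserving the tracial state $$\varphi\Big(\bigoplus_{i}X_i\Big)=\frac{1}{\sum_{i=0}^{s-1}n_i^2}\sum_{i=0}^{s-1}n_i\,\mathrm{trace}(X_i),\qquad X_i\in M_{n_i}(\mathbb{C}).$$ Then the following are equivalent: (i) there exists a unitary orthonormal basis of $\mathcal{A}$ over $\mathcal{B}$ (with respect to $E$) contained in the normalizer $\mathcal{N}_{\mathcal{A}}(\mathcal{B})$; (ii) the inclusion $\mathcal{B}\subset\mathcal{A}$ is regular and the inclusion matrix satisfies the spectral condition. Moreover, if either $\mathcal{B}$ or $\mathcal{A}$ is a (full) matrix algebra, then the inclusion is regular if and only if it admits a unitary orthonormal basis contained in $\mathcal{N}_{\mathcal{A}}(\mathcal{B})$.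
   Context: All inclusions are unital. The inclusion matrix $A=[a_{ij}]_{0\le i\le s-1,\,0\le j\le r-1}$ has $a_{ij}$ equal to the number of times the summand $M_{m_j}$ of $\mathcal{B}$ appears in the summand $M_{n_i}$ of $\mathcal{A}$; up to isomorphism the inclusion is $\bigoplus_j X_j\mapsto\bigoplus_i\text{block-diag}(X_0\otimes\mathbf{1}_{a_{i0}},\ldots,X_{r-1}\otimes\mathbf{1}_{a_{i,r-1}})$. The dimension vectors are the column vectors $m'=(m_0,\ldots,m_{r-1})^t$ and $n'=(n_0,\ldots,n_{s-1})^t$, and $n'=Am'$. Here $\mathrm{trace}$ is the unnormalized matrix trace. Normalizer: $\mathcal{N}_{\mathcal{A}}(\mathcal{B})=\{U\in\mathcal{A}\text{ unitary}:U\mathcal{B}U^*=\mathcal{B}\}$. The inclusion is regular if $\mathcal{A}=\mathrm{span}\,\mathcal{N}_{\mathcal{A}}(\mathcal{B})$. Unitary orthonormal basis for $(\mathcal{B}\subset\mathcal{A},E)$: a finite family $\{W_j:0\le j\le d-1\}$ of unitaries in $\mathcal{A}$ such that $X=\sum_{j=0}^{d-1}W_jE(W_j^*X)$ for all $X\in\mathcal{A}$ and $E(W_j^*W_k)=\delta_{jk}\mathbf{1}$ for all $j,k$. Spectral condition: there is a natural number $d$ such that $A^tn'=d\,m'$. *)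

theory Defs
  imports
    "HOL-Library.FuncSet"
    "HOL-Algebra.Module"
    "Jordan_Normal_Form.VS_Connect"
    "Jordan_Normal_Form.Schur_Decomposition"
begin

hide_const (open) Multiset.mult Polynomial.smult

record ('a, 'b) star_algebra = "('a, 'b) module" +
  star :: "'b \<Rightarrow> 'b"  (\<open>(_\<^sup>\<star>\<index>)\<close> [1000] 999)

definition unitary_elements :: "('a, 'b, 'c) star_algebra_scheme \<Rightarrow> 'b set" where
  "unitary_elements A =
     {U \<in> carrier A. U\<^sup>\<star>\<^bsub>A\<^esub> \<otimes>\<^bsub>A\<^esub> U = \<one>\<^bsub>A\<^esub> \<and> U \<otimes>\<^bsub>A\<^esub> U\<^sup>\<star>\<^bsub>A\<^esub> = \<one>\<^bsub>A\<^esub>}"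

definition unital_star_embedding ::
    "('a, 'b, 'c) star_algebra_scheme \<Rightarrow> ('a, 'd, 'e) star_algebra_scheme \<Rightarrow> ('b \<Rightarrow> 'd) \<Rightarrow> bool" where
  "unital_star_embedding B A f \<longleftrightarrow>
     f \<in> Ring.ring_hom B A \<and> inj_on f (carrier B) \<and>
     (\<forall>c. \<forall>X \<in> carrier B. f (c \<odot>\<^bsub>B\<^esub> X) = c \<odot>\<^bsub>A\<^esub> f X) \<and>
     (\<forall>X \<in> carrier B. f (X\<^sup>\<star>\<^bsub>B\<^esub>) = (f X)\<^sup>\<star>\<^bsub>A\<^esub>)"

text \<open>From here on, a subalgebra of \<open>A\<close> is given as a subset \<open>B\<close> of \<open>carrier A\<close>.\<close>

definition normalizer :: "('a, 'b, 'c) star_algebra_scheme \<Rightarrow> 'b set \<Rightarrow> 'b set" where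
  "normalizer A B =
     {U \<in> unitary_elements A. (\<lambda>X. U \<otimes>\<^bsub>A\<^esub> X \<otimes>\<^bsub>A\<^esub> U\<^sup>\<star>\<^bsub>A\<^esub>) ` B = B}"

definition regular_inclusion ::
    "('a::field, 'b, 'c) star_algebra_scheme \<Rightarrow> 'b set \<Rightarrow> bool" where
  "regular_inclusion A B \<longleftrightarrow>
     carrier A = LinearCombinations.module.span class_ring A (normalizer A B)"

text \<open>An element of \<open>A\<close> is positive if it has the form \<open>Y\<^sup>\<star> Y\<close>.\<close>

definition conditional_expectation ::
    "('a, 'b, 'c) star_algebra_scheme \<Rightarrow> 'b set \<Rightarrow> ('b \<Rightarrow> 'b) \<Rightarrow> bool" where
  "conditional_expectation A B E \<longleftrightarrow>
     (\<forall>X \<in> carrier A. E X \<in> B) \<and>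
     (\<forall>X \<in> carrier A. \<forall>Y \<in> carrier A. E (X \<oplus>\<^bsub>A\<^esub> Y) = E X \<oplus>\<^bsub>A\<^esub> E Y) \<and>
     (\<forall>c. \<forall>X \<in> carrier A. E (c \<odot>\<^bsub>A\<^esub> X) = c \<odot>\<^bsub>A\<^esub> E X) \<and>
     (\<forall>X \<in> B. E X = X) \<and>
     (\<forall>X \<in> carrier A. \<forall>Y \<in> B. \<forall>Z \<in> B.
        E (Y \<otimes>\<^bsub>A\<^esub> X \<otimes>\<^bsub>A\<^esub> Z) = Y \<otimes>\<^bsub>A\<^esub> E X \<otimes>\<^bsub>A\<^esub> Z) \<and>
     (\<forall>X \<in> carrier A. \<exists>Y \<in> carrier A. E (X\<^sup>\<star>\<^bsub>A\<^esub> \<otimes>\<^bsub>A\<^esub> X) = Y\<^sup>\<star>\<^bsub>A\<^esub> \<otimes>\<^bsub>A\<^esub> Y)"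

definition unitary_orthonormal_basis ::
    "('a, 'b, 'c) star_algebra_scheme \<Rightarrow> ('b \<Rightarrow> 'b) \<Rightarrow> nat \<Rightarrow> (nat \<Rightarrow> 'b) \<Rightarrow> bool" where
  "unitary_orthonormal_basis A E d W \<longleftrightarrow>
     (\<forall>j<d. W j \<in> unitary_elements A) \<and>
     (\<forall>X \<in> carrier A.
        X = (\<Oplus>\<^bsub>A\<^esub> j \<in> {..<d}. W j \<otimes>\<^bsub>A\<^esub> E ((W j)\<^sup>\<star>\<^bsub>A\<^esub> \<otimes>\<^bsub>A\<^esub> X))) \<and>
     (\<forall>j<d. \<forall>k<d. E ((W j)\<^sup>\<star>\<^bsub>A\<^esub> \<otimes>\<^bsub>A\<^esub> W k) = (if j = k then \<one>\<^bsub>A\<^esub> else \<zero>\<^bsub>A\<^esub>))"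

definition has_unitary_orthonormal_basis_in_normalizer ::
    "('a, 'b, 'c) star_algebra_scheme \<Rightarrow> 'b set \<Rightarrow> ('b \<Rightarrow> 'b) \<Rightarrow> bool" where
  "has_unitary_orthonormal_basis_in_normalizer A B E \<longleftrightarrow>
     (\<exists>d W. unitary_orthonormal_basis A E d W \<and> (\<forall>j<d. W j \<in> normalizer A B))"

text \<open>\<open>multimatrix_algebra k d\<close> is the direct sum of the algebras of complex \<open>d i \<times> d i\<close>
  matrices, \<open>i < k\<close>, with componentwise operations. Its elements are extensional functions, so
  that HOL equality is equality in the algebra.\<close>

definition multimatrix_algebra ::
    "nat \<Rightarrow> (nat \<Rightarrow> nat) \<Rightarrow> (complex, nat \<Rightarrow> complex mat) star_algebra" where
  "multimatrix_algebra k d =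
     \<lparr> carrier = (\<Pi>\<^sub>E i \<in> {..<k}. carrier_mat (d i) (d i)),
       mult = (\<lambda>X Y. \<lambda>i \<in> {..<k}. X i * Y i),
       one = (\<lambda>i \<in> {..<k}. 1\<^sub>m (d i)),
       zero = (\<lambda>i \<in> {..<k}. 0\<^sub>m (d i) (d i)),
       add = (\<lambda>X Y. \<lambda>i \<in> {..<k}. X i + Y i),
       smult = (\<lambda>c X. \<lambda>i \<in> {..<k}. c \<cdot>\<^sub>m X i),
       star = (\<lambda>X. \<lambda>i \<in> {..<k}. mat_adjoint (X i)) \<rparr>"

definition mat_trace :: "complex mat \<Rightarrow> complex" where
  "mat_trace X = (\<Sum>p<dim_row X. X $$ (p, p))"

definition tracial_state :: "nat \<Rightarrow> (nat \<Rightarrow> nat) \<Rightarrow> (nat \<Rightarrow> complex mat) \<Rightarrow> complex" where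
  "tracial_state s n X =
     1 / of_nat (\<Sum>i<s. (n i)\<^sup>2) * (\<Sum>i<s. of_nat (n i) * mat_trace (X i))"

definition kronecker_product :: "complex mat \<Rightarrow> complex mat \<Rightarrow> complex mat"
    (infixl \<open>\<otimes>\<^sub>K\<close> 70) where
  "X \<otimes>\<^sub>K Y = mat (dim_row X * dim_row Y) (dim_col X * dim_col Y)
     (\<lambda>(p, q). X $$ (p div dim_row Y, q div dim_col Y) * Y $$ (p mod dim_row Y, q mod dim_col Y))"

definition standard_inclusion ::
    "nat \<Rightarrow> nat \<Rightarrow> nat mat \<Rightarrow> (nat \<Rightarrow> complex mat) \<Rightarrow> (nat \<Rightarrow> complex mat)" where
  "standard_inclusion r s \<Lambda> X =
     (\<lambda>i \<in> {..<s}. diag_block_mat (map (\<lambda>j. X j \<otimes>\<^sub>K 1\<^sub>m (\<Lambda> $$ (i, j))) [0..<r]))"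

text \<open>\<open>\<Lambda>\<close> is the inclusion matrix of \<open>\<iota>\<close> if \<open>\<iota>\<close> is the standard inclusion with multiplicities
  \<open>\<Lambda>\<close>, up to a unitary change of basis in each summand of the larger algebra.\<close>

definition is_inclusion_matrix ::
    "nat \<Rightarrow> (nat \<Rightarrow> nat) \<Rightarrow> nat \<Rightarrow> (nat \<Rightarrow> nat) \<Rightarrow> ((nat \<Rightarrow> complex mat) \<Rightarrow> (nat \<Rightarrow> complex mat)) \<Rightarrow>
      nat mat \<Rightarrow> bool" where
  "is_inclusion_matrix r m s n \<iota> \<Lambda> \<longleftrightarrow>
     \<Lambda> \<in> carrier_mat s r \<and> vec s n = \<Lambda> *\<^sub>v vec r m \<and>
     (let A = multimatrix_algebra s n; B = multimatrix_algebra r m in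
      \<exists>U \<in> unitary_elements A. \<forall>X \<in> carrier B.
        \<iota> X = U \<otimes>\<^bsub>A\<^esub> standard_inclusion r s \<Lambda> X \<otimes>\<^bsub>A\<^esub> U\<^sup>\<star>\<^bsub>A\<^esub>)"

definition spectral_condition ::
    "nat \<Rightarrow> (nat \<Rightarrow> nat) \<Rightarrow> nat \<Rightarrow> (nat \<Rightarrow> nat) \<Rightarrow> nat mat \<Rightarrow> bool" where
  "spectral_condition r m s n \<Lambda> \<longleftrightarrow>
     (\<exists>d::nat. transpose_mat \<Lambda> *\<^sub>v vec s n = d \<cdot>\<^sub>v vec r m)"

end

theory Submission
  imports Defs "HOL-Combinatorics.Transposition" "HOL-Number_Theory.Cong"
begin

text \<open>
  \<open>(i) \<Longrightarrow> (ii)\<close>. A basis \<open>W\<close> writes every element of \<open>\<A>\<close> as a sum of products \<open>W w \<otimes> b\<close> with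
  \<open>b \<in> \<B>\<close>, and \<open>\<B>\<close> is spanned by its unitaries, which normalize \<open>\<B>\<close>; this gives regularity.
  Expanding matrix units of \<open>\<A>\<close> in the basis and using unitarity of the \<open>W w\<close> gives the spectral
  condition with \<open>d\<close> the size of the basis.

  \<open>(ii) \<Longrightarrow> (i)\<close>. If two summands \<open>j\<close>, \<open>k\<close> of \<open>\<B>\<close> meet a common summand of \<open>\<A>\<close>, regularity yields a
  normalizing unitary with a nonzero corner between them. It carries rank one projections of the
  first to rank one projections of the second and one central unit onto the other, so \<open>m j = m k\<close>
  and the columns \<open>j\<close>, \<open>k\<close> of \<open>\<Lambda>\<close> agree. Hence the inclusion splits into pieces of the form
  \<open>M\<^sub>m \<otimes> D\<^sub>R \<otimes> 1 \<subset> M\<^sub>m \<otimes> M\<^sub>R \<otimes> (\<Oplus>\<^sub>i M\<^bsub>v i\<^esub>)\<close> with \<open>D\<^sub>R\<close> the diagonal matrices, and the spectral condition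
  says that \<open>R * (\<Sum>i. (v i)\<^sup>2)\<close> is the same number \<open>d\<close> for all pieces. Permutation matrices form a
  basis of \<open>M\<^sub>R\<close> over \<open>D\<^sub>R\<close>, and \<open>\<Oplus>\<^sub>i M\<^bsub>v i\<^esub>\<close> has an orthonormal basis of unitaries
  \<open>D(g) F D'(g)\<close>, where \<open>F\<close> is a Fourier matrix and the diagonal entries of \<open>D(g)\<close>, \<open>D'(g)\<close> are
  roots of unity of order \<open>\<Sum>i. (v i)\<^sup>2\<close>.
\<close>

section \<open>Multimatrix algebras\<close>

text \<open>The obstacle in the converse is that one family of unitaries must serve all pieces at
  once, although \<open>R\<close> and the numbers \<open>v i\<close> vary from piece to piece. Every
  index \<open>w < d\<close> is therefore read in each piece separately: \<open>w mod R\<close>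
  chooses a permutation and \<open>w div R\<close> a Fourier unitary. The common value
  \<open>d\<close> is exactly what makes this a bijective numbering in every piece. The choice of
  trace explains the Fourier matrices. On a summand of \<A> that meets the piece,
  \<open>n i = R * m * v i\<close>, so after cancelling \<open>R * m\<close> the expectation weights
  it by \<open>v i\<close>, while each entry of a unitary Fourier matrix of size \<open>v i\<close>
  has squared modulus \<open>1 / v i\<close>. All matrix positions thus count equally, and
  orthonormality becomes orthogonality of the characters of one cyclic group. Two diagonal factors
  suffice to realize these characters because the number of a position is a sum of a row part and a
  column part. Both directions compute in coordinates where the inclusion is standard; there the
  invariance of the trace forces the expectation to be an explicit weighted average over
  copies.\<close>

lemma class_ring_cring: "cring (class_ring :: 'a::field ring)"
  using class_field[where 'a='a] by (rule field.axioms(1)[THEN domain.axioms(1)])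

lemma dim_mat_adjoint [simp]:
  "dim_row (mat_adjoint X) = dim_col X" "dim_col (mat_adjoint X) = dim_row X"
  by (simp_all add: mat_adjoint_def)

lemma index_mat_adjoint [simp]:
  "p < dim_col X \<Longrightarrow> q < dim_row X \<Longrightarrow> mat_adjoint X $$ (p, q) = conjugate (X $$ (q, p))"
  by (simp add: mat_adjoint_def mat_of_rows_index)

lemma multimatrix_simps:
  "carrier (multimatrix_algebra k d) = (\<Pi>\<^sub>E i \<in> {..<k}. carrier_mat (d i) (d i))"
  "X \<otimes>\<^bsub>multimatrix_algebra k d\<^esub> Y = (\<lambda>i \<in> {..<k}. X i * Y i)"
  "\<one>\<^bsub>multimatrix_algebra k d\<^esub> = (\<lambda>i \<in> {..<k}. 1\<^sub>m (d i))"
  "\<zero>\<^bsub>multimatrix_algebra k d\<^esub> = (\<lambda>i \<in> {..<k}. 0\<^sub>m (d i) (d i))"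
  "X \<oplus>\<^bsub>multimatrix_algebra k d\<^esub> Y = (\<lambda>i \<in> {..<k}. X i + Y i)"
  "c \<odot>\<^bsub>multimatrix_algebra k d\<^esub> X = (\<lambda>i \<in> {..<k}. c \<cdot>\<^sub>m X i)"
  "X\<^sup>\<star>\<^bsub>multimatrix_algebra k d\<^esub> = (\<lambda>i \<in> {..<k}. mat_adjoint (X i))"
  by (simp_all add: multimatrix_algebra_def)

lemma multimatrix_apply:
  assumes "i < k"
  shows "(X \<otimes>\<^bsub>multimatrix_algebra k d\<^esub> Y) i = X i * Y i"
    and "\<one>\<^bsub>multimatrix_algebra k d\<^esub> i = 1\<^sub>m (d i)"
    and "\<zero>\<^bsub>multimatrix_algebra k d\<^esub> i = 0\<^sub>m (d i) (d i)"
    and "(X \<oplus>\<^bsub>multimatrix_algebra k d\<^esub> Y) i = X i + Y i"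
    and "(c \<odot>\<^bsub>multimatrix_algebra k d\<^esub> X) i = c \<cdot>\<^sub>m X i"
    and "(X\<^sup>\<star>\<^bsub>multimatrix_algebra k d\<^esub>) i = mat_adjoint (X i)"
  using assms by (simp_all add: multimatrix_simps)

lemma multimatrix_eqI:
  assumes "X \<in> carrier (multimatrix_algebra k d)" "Y \<in> carrier (multimatrix_algebra k d)"
    and "\<And>i p q. \<lbrakk>i < k; p < d i; q < d i\<rbrakk> \<Longrightarrow> X i $$ (p, q) = Y i $$ (p, q)"
  shows "X = Y"
proof (rule PiE_ext)
  show "X \<in> (\<Pi>\<^sub>E i \<in> {..<k}. carrier_mat (d i) (d i))" "Y \<in> (\<Pi>\<^sub>E i \<in> {..<k}. carrier_mat (d i) (d i))"
    using assms by (simp_all add: multimatrix_simps)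
  fix i assume i: "i \<in> {..<k}"
  then have "X i \<in> carrier_mat (d i) (d i)" "Y i \<in> carrier_mat (d i) (d i)"
    using assms by (auto simp: multimatrix_simps)
  then show "X i = Y i"
    using assms(3) i by (intro eq_matI) auto
qed

lemma multimatrix_dims:
  assumes "X \<in> carrier (multimatrix_algebra k d)" "i < k"
  shows "X i \<in> carrier_mat (d i) (d i)" "dim_row (X i) = d i" "dim_col (X i) = d i"
  using assms by (auto simp: multimatrix_simps)

lemma multimatrix_closed:
  assumes X: "X \<in> carrier (multimatrix_algebra k d)"
  shows "Y \<in> carrier (multimatrix_algebra k d)
      \<Longrightarrow> X \<oplus>\<^bsub>multimatrix_algebra k d\<^esub> Y \<in> carrier (multimatrix_algebra k d)"
    and "Y \<in> carrier (multimatrix_algebra k d)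
      \<Longrightarrow> X \<otimes>\<^bsub>multimatrix_algebra k d\<^esub> Y \<in> carrier (multimatrix_algebra k d)"
    and "c \<odot>\<^bsub>multimatrix_algebra k d\<^esub> X \<in> carrier (multimatrix_algebra k d)"
    and "X\<^sup>\<star>\<^bsub>multimatrix_algebra k d\<^esub> \<in> carrier (multimatrix_algebra k d)"
proof -
  note dims = multimatrix_dims(1)[OF X]
  show "X \<oplus>\<^bsub>multimatrix_algebra k d\<^esub> Y \<in> carrier (multimatrix_algebra k d)"
    "X \<otimes>\<^bsub>multimatrix_algebra k d\<^esub> Y \<in> carrier (multimatrix_algebra k d)"
    if "Y \<in> carrier (multimatrix_algebra k d)"
    using dims multimatrix_dims(1)[OF that]
    unfolding multimatrix_simps restrict_PiE_iff carrier_mat_def by simp_all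
  show "c \<odot>\<^bsub>multimatrix_algebra k d\<^esub> X \<in> carrier (multimatrix_algebra k d)"
    "X\<^sup>\<star>\<^bsub>multimatrix_algebra k d\<^esub> \<in> carrier (multimatrix_algebra k d)"
    using dims unfolding multimatrix_simps restrict_PiE_iff carrier_mat_def by simp_all
qed

lemma multimatrix_ext:
  assumes "X \<in> carrier (multimatrix_algebra k d)" "Y \<in> carrier (multimatrix_algebra k d)"
    and "\<And>i. i < k \<Longrightarrow> X i = Y i"
  shows "X = Y"
  using assms by (intro multimatrix_eqI[of X k d Y]) auto

lemma multimatrix_one_zero_closed:
  "\<one>\<^bsub>multimatrix_algebra k d\<^esub> \<in> carrier (multimatrix_algebra k d)"
  "\<zero>\<^bsub>multimatrix_algebra k d\<^esub> \<in> carrier (multimatrix_algebra k d)"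
  unfolding multimatrix_simps by simp_all

lemma multimatrix_ring: "ring (multimatrix_algebra k d)"
proof (rule ringI)
  let ?A = "multimatrix_algebra k d"
  note closed = multimatrix_closed[of _ k d] multimatrix_one_zero_closed[of k d]
  note dims = multimatrix_dims[of _ k d]
  show "abelian_group ?A"
  proof (rule abelian_groupI)
    fix X assume X: "X \<in> carrier ?A"
    let ?Y = "(-1) \<odot>\<^bsub>?A\<^esub> X"
    have "?Y \<oplus>\<^bsub>?A\<^esub> X = \<zero>\<^bsub>?A\<^esub>"
      by (rule multimatrix_eqI[of _ k d]) (use X in \<open>simp_all add: closed multimatrix_apply dims\<close>)
    then show "\<exists>Y \<in> carrier ?A. Y \<oplus>\<^bsub>?A\<^esub> X = \<zero>\<^bsub>?A\<^esub>"
      using X closed by blast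
    show "\<zero>\<^bsub>?A\<^esub> \<oplus>\<^bsub>?A\<^esub> X = X"
      by (rule multimatrix_eqI[of _ k d]) (use X in \<open>simp_all add: closed multimatrix_apply dims\<close>)
  next
    fix X Y assume X: "X \<in> carrier ?A" "Y \<in> carrier ?A"
    show "X \<oplus>\<^bsub>?A\<^esub> Y = Y \<oplus>\<^bsub>?A\<^esub> X"
      by (rule multimatrix_eqI[of _ k d]) (use X in \<open>simp_all add: closed multimatrix_apply dims\<close>)
    fix Z assume Z: "Z \<in> carrier ?A"
    show "X \<oplus>\<^bsub>?A\<^esub> Y \<oplus>\<^bsub>?A\<^esub> Z = X \<oplus>\<^bsub>?A\<^esub> (Y \<oplus>\<^bsub>?A\<^esub> Z)"
      by (rule multimatrix_eqI[of _ k d]) (use X Z in \<open>simp_all add: closed multimatrix_apply dims\<close>)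
  qed (auto simp: closed)
  show "Group.monoid ?A"
  proof (rule monoidI)
    fix X assume X: "X \<in> carrier ?A"
    show "\<one>\<^bsub>?A\<^esub> \<otimes>\<^bsub>?A\<^esub> X = X" "X \<otimes>\<^bsub>?A\<^esub> \<one>\<^bsub>?A\<^esub> = X"
      by (rule multimatrix_ext[of _ k d]; use X in \<open>simp add: closed multimatrix_apply dims(1)[OF X]
        left_mult_one_mat[OF dims(1)[OF X]] right_mult_one_mat[OF dims(1)[OF X]]\<close>)+
    fix Y Z assume Y: "Y \<in> carrier ?A" "Z \<in> carrier ?A"
    show "X \<otimes>\<^bsub>?A\<^esub> Y \<otimes>\<^bsub>?A\<^esub> Z = X \<otimes>\<^bsub>?A\<^esub> (Y \<otimes>\<^bsub>?A\<^esub> Z)"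
      by (rule multimatrix_ext[of _ k d]; use X Y in \<open>simp add: closed multimatrix_apply
        assoc_mult_mat[OF dims(1)[OF X] dims(1)[OF Y(1)] dims(1)[OF Y(2)]]\<close>)
  qed (auto simp: closed)
  fix X Y Z assume XYZ: "X \<in> carrier ?A" "Y \<in> carrier ?A" "Z \<in> carrier ?A"
  note D = XYZ[THEN dims(1)]
  show "(X \<oplus>\<^bsub>?A\<^esub> Y) \<otimes>\<^bsub>?A\<^esub> Z = X \<otimes>\<^bsub>?A\<^esub> Z \<oplus>\<^bsub>?A\<^esub> Y \<otimes>\<^bsub>?A\<^esub> Z"
    by (rule multimatrix_ext[of _ k d]; use XYZ in \<open>simp add: closed multimatrix_apply
      add_mult_distrib_mat[OF D(1,2,3)]\<close>)
  show "Z \<otimes>\<^bsub>?A\<^esub> (X \<oplus>\<^bsub>?A\<^esub> Y) = Z \<otimes>\<^bsub>?A\<^esub> X \<oplus>\<^bsub>?A\<^esub> Z \<otimes>\<^bsub>?A\<^esub> Y"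
    by (rule multimatrix_ext[of _ k d]; use XYZ in \<open>simp add: closed multimatrix_apply
      mult_add_distrib_mat[OF D(3,1,2)]\<close>)
qed

lemma multimatrix_module: "Module.module class_ring (multimatrix_algebra k d)"
proof (rule moduleI)
  let ?A = "multimatrix_algebra k d"
  note closed = multimatrix_closed[of _ k d] multimatrix_one_zero_closed[of k d]
  note dims = multimatrix_dims[of _ k d]
  show "abelian_group ?A"
    using multimatrix_ring ring.is_abelian_group by blast
  fix a b :: complex and X Y assume XY: "X \<in> carrier ?A" "Y \<in> carrier ?A"
  show "(a \<oplus>\<^bsub>class_ring\<^esub> b) \<odot>\<^bsub>?A\<^esub> X = a \<odot>\<^bsub>?A\<^esub> X \<oplus>\<^bsub>?A\<^esub> b \<odot>\<^bsub>?A\<^esub> X"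
    "a \<odot>\<^bsub>?A\<^esub> (X \<oplus>\<^bsub>?A\<^esub> Y) = a \<odot>\<^bsub>?A\<^esub> X \<oplus>\<^bsub>?A\<^esub> a \<odot>\<^bsub>?A\<^esub> Y"
    "(a \<otimes>\<^bsub>class_ring\<^esub> b) \<odot>\<^bsub>?A\<^esub> X = a \<odot>\<^bsub>?A\<^esub> (b \<odot>\<^bsub>?A\<^esub> X)"
    "\<one>\<^bsub>class_ring\<^esub> \<odot>\<^bsub>?A\<^esub> X = X"
    by (rule multimatrix_eqI[of _ k d];
        use XY in \<open>simp add: closed multimatrix_apply class_ring_simps dims algebra_simps\<close>)+
qed (auto simp: class_ring_cring multimatrix_closed)

lemma multimatrix_star:
  assumes X: "X \<in> carrier (multimatrix_algebra k d)"
  shows "(X\<^sup>\<star>\<^bsub>multimatrix_algebra k d\<^esub>)\<^sup>\<star>\<^bsub>multimatrix_algebra k d\<^esub> = X"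
    and "Y \<in> carrier (multimatrix_algebra k d)
      \<Longrightarrow> (X \<otimes>\<^bsub>multimatrix_algebra k d\<^esub> Y)\<^sup>\<star>\<^bsub>multimatrix_algebra k d\<^esub>
        = Y\<^sup>\<star>\<^bsub>multimatrix_algebra k d\<^esub> \<otimes>\<^bsub>multimatrix_algebra k d\<^esub> X\<^sup>\<star>\<^bsub>multimatrix_algebra k d\<^esub>"
  by (rule multimatrix_eqI[of _ k d];
      use X in \<open>simp add: multimatrix_closed[of _ k d] multimatrix_apply multimatrix_dims[of _ k d]
        scalar_prod_def mult.commute\<close>)+

text \<open>A one-sided inverse of a square matrix is two-sided, so one of the two unitarity
  equations suffices.\<close>

lemma multimatrix_unitaryI:
  assumes "X \<in> carrier (multimatrix_algebra k d)"
    and "X \<otimes>\<^bsub>multimatrix_algebra k d\<^esub> X\<^sup>\<star>\<^bsub>multimatrix_algebra k d\<^esub> = \<one>\<^bsub>multimatrix_algebra k d\<^esub>"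
  shows "X \<in> unitary_elements (multimatrix_algebra k d)"
proof -
  have "mat_adjoint (X i) * X i = 1\<^sub>m (d i)" if "i < k" for i
  proof (rule mat_mult_left_right_inverse)
    show "X i \<in> carrier_mat (d i) (d i)" "mat_adjoint (X i) \<in> carrier_mat (d i) (d i)"
      using multimatrix_dims[OF assms(1) that] by (auto intro!: carrier_matI)
    show "X i * mat_adjoint (X i) = 1\<^sub>m (d i)"
      using fun_cong[OF assms(2), of i] that by (simp add: multimatrix_apply)
  qed
  then show ?thesis
    using assms unfolding unitary_elements_def by (auto intro!: multimatrix_ext[of _ k d]
      simp: multimatrix_closed[of _ k d] multimatrix_one_zero_closed multimatrix_apply)
qed

lemma index_multimatrix_finsum:
  assumes "finite J" "\<And>l. l \<in> J \<Longrightarrow> f l \<in> carrier (multimatrix_algebra k d)"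
    and "i < k" "p < d i" "q < d i"
  shows "finsum (multimatrix_algebra k d) f J i $$ (p, q) = (\<Sum>l\<in>J. f l i $$ (p, q))"
proof -
  interpret ring "multimatrix_algebra k d" by (rule multimatrix_ring)
  show ?thesis
    using assms(1,2)
  proof (induction J rule: finite_induct)
    case empty
    then show ?case using assms by (simp add: multimatrix_apply)
  next
    case (insert l J)
    then have "finsum (multimatrix_algebra k d) f J \<in> carrier (multimatrix_algebra k d)"
      by (auto intro: finsum_closed)
    with insert show ?case
      using assms multimatrix_dims[of "finsum (multimatrix_algebra k d) f J" k d i]
      by (simp add: Pi_def) (simp add: multimatrix_apply)
  qed
qed

section \<open>Numbering the positions of block matrices\<close>

lemma bij_betw_sum_offset:
  fixes v :: "nat \<Rightarrow> nat"
  shows "bij_betw (\<lambda>(j, y). (\<Sum>k<j. v k) + y) (SIGMA j:{..<r}. {..<v j}) {..<\<Sum>k<r. v k}"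
proof (induction r)
  case (Suc r)
  have "bij_betw (\<lambda>(j, y). (\<Sum>k<j. v k) + y) ({r} \<times> {..<v r}) {(\<Sum>k<r. v k)..<(\<Sum>k<r. v k) + v r}"
    by (rule bij_betw_byWitness[of _ "\<lambda>p. (r, p - (\<Sum>k<r. v k))"]) auto
  then have "bij_betw (\<lambda>(j, y). (\<Sum>k<j. v k) + y)
      ((SIGMA j:{..<r}. {..<v j}) \<union> {r} \<times> {..<v r})
      ({..<\<Sum>k<r. v k} \<union> {(\<Sum>k<r. v k)..<(\<Sum>k<r. v k) + v r})"
    using Suc by (intro bij_betw_combine) auto
  moreover have "(SIGMA j:{..<r}. {..<v j}) \<union> {r} \<times> {..<v r} = (SIGMA j:{..<Suc r}. {..<v j})"
    by (auto simp: less_Suc_eq)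
  moreover have "{..<\<Sum>k<r. v k} \<union> {(\<Sum>k<r. v k)..<(\<Sum>k<r. v k) + v r} = {..<\<Sum>k<Suc r. v k}"
    by auto
  ultimately show ?case by simp
qed (simp add: bij_betw_def)

lemma bij_betw_Sigma_fibre:
  assumes "\<And>j. j \<in> A \<Longrightarrow> bij_betw (g j) (B j) (C j)"
  shows "bij_betw (\<lambda>(j, p). (j, g j p)) (Sigma A B) (Sigma A C)"
  unfolding bij_betw_def
proof
  have inj: "inj_on (g j) (B j)" and image: "g j ` B j = C j" if "j \<in> A" for j
    using assms[OF that] by (auto simp: bij_betw_def)
  show "inj_on (\<lambda>(j, p). (j, g j p)) (Sigma A B)"
    using inj by (auto simp: inj_on_def)
  have "(\<lambda>(j, p). (j, g j p)) ` Sigma A B = (SIGMA j:A. g j ` B j)"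
    by force
  also have "\<dots> = Sigma A C"
    using image by (intro Sigma_cong) auto
  finally show "(\<lambda>(j, p). (j, g j p)) ` Sigma A B = Sigma A C" .
qed

text \<open>Consecutive blocks of size \<open>u j * v j\<close>, each filled row by row. It serves
  twice: with the sizes \<open>m\<close> and the multiplicities it numbers the rows of a summand of
  \<A>, and with \<open>u = v\<close> it numbers all matrix positions of a direct sum of full matrix
  algebras.\<close>

lemma bij_betw_offset3:
  fixes u v :: "nat \<Rightarrow> nat"
  shows "bij_betw (\<lambda>(j, x, y). (\<Sum>k<j. u k * v k) + (x * v j + y))
    (SIGMA j:{..<r}. {..<u j} \<times> {..<v j}) {..<\<Sum>k<r. u k * v k}"
proof -
  have inner: "bij_betw (\<lambda>(x, y). x * v j + y) ({..<u j} \<times> {..<v j}) {..<u j * v j}" for j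
    using bij_betw_sum_offset[of "\<lambda>_. v j" "u j"] by simp
  have "bij_betw (\<lambda>(j, p). (j, (\<lambda>(x, y). x * v j + y) p))
      (SIGMA j:{..<r}. {..<u j} \<times> {..<v j}) (SIGMA j:{..<r}. {..<u j * v j})"
    by (rule bij_betw_Sigma_fibre) (use inner in auto)
  from bij_betw_trans[OF this bij_betw_sum_offset] show ?thesis
    by (rule bij_betw_cong[THEN iffD1, rotated]) auto
qed

lemma index_diag_block_mat:
  assumes "\<And>A. A \<in> set As \<Longrightarrow> dim_col A = dim_row A"
    and "j < length As" "j' < length As" "p < dim_row (As ! j)" "q < dim_row (As ! j')"
  shows "diag_block_mat As $$ ((\<Sum>k<j. dim_row (As ! k)) + p, (\<Sum>k<j'. dim_row (As ! k)) + q)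
    = (if j = j' then (As ! j) $$ (p, q) else 0)"
  using assms
proof (induction As arbitrary: j j')
  case (Cons A As)
  have offset: "(\<Sum>k<i. dim_row (As ! k)) + p < dim_row (diag_block_mat As)"
    if "i < length As" "p < dim_row (As ! i)" for i p
  proof -
    have "(\<Sum>k<i. dim_row (As ! k)) + dim_row (As ! i) \<le> (\<Sum>k<length As. dim_row (As ! k))"
      using sum_mono2[of "{..<length As}" "{..<Suc i}" "\<lambda>k. dim_row (As ! k)"] that by auto
    then show ?thesis
      using that by (simp add: dim_diag_block_mat sum_list_sum_nth atLeast0LessThan)
  qed
  have square: "dim_col (diag_block_mat As) = dim_row (diag_block_mat As)" "dim_col A = dim_row A"
    using Cons.prems(1) by (auto simp: dim_diag_block_mat intro!: arg_cong[of _ _ sum_list])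
  show ?case
  proof (cases j; cases j')
    fix i i' assume "j = Suc i" "j' = Suc i'"
    then show ?thesis
      using Cons offset[of i p] offset[of i' q] square
      by (simp add: Let_def sum.lessThan_Suc_shift ac_simps del: sum.lessThan_Suc)
  qed (use Cons.prems square offset in \<open>auto simp: Let_def sum.lessThan_Suc_shift ac_simps
    simp del: sum.lessThan_Suc\<close>)
qed auto

section \<open>Monomial unitaries and matrix units\<close>

lemma unitary_monomial:
  assumes "\<And>l. l < k \<Longrightarrow> \<tau> l permutes {..<d l}" "\<And>l p. norm (f l p) = 1"
  shows "(\<lambda>l\<in>{..<k}. mat (d l) (d l) (\<lambda>(p, q). if q = \<tau> l p then f l p else 0))
    \<in> unitary_elements (multimatrix_algebra k d)" (is "?V \<in> _")
proof (rule multimatrix_unitaryI)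
  show V: "?V \<in> carrier (multimatrix_algebra k d)"
    unfolding multimatrix_simps by auto
  show "?V \<otimes>\<^bsub>multimatrix_algebra k d\<^esub> ?V\<^sup>\<star>\<^bsub>multimatrix_algebra k d\<^esub> = \<one>\<^bsub>multimatrix_algebra k d\<^esub>"
  proof (rule multimatrix_eqI[of _ k d])
    fix l p q assume l: "l < k" "p < d l" "q < d l"
    have \<tau>: "\<tau> l p < d l" "\<tau> l p = \<tau> l q \<longleftrightarrow> p = q"
      using assms(1)[OF l(1)] l permutes_in_image[of "\<tau> l"] permutes_inj[of "\<tau> l"]
      by (auto simp: inj_eq)
    have "(?V \<otimes>\<^bsub>multimatrix_algebra k d\<^esub> ?V\<^sup>\<star>\<^bsub>multimatrix_algebra k d\<^esub>) l $$ (p, q)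
      = (\<Sum>x<d l. if x = \<tau> l p then (if x = \<tau> l q then f l p * cnj (f l q) else 0) else 0)"
      using l by (auto simp: multimatrix_apply scalar_prod_def atLeast0LessThan simp del: sum.delta intro!: sum.cong)
    also have "\<dots> = \<one>\<^bsub>multimatrix_algebra k d\<^esub> l $$ (p, q)"
      using l \<tau> assms(2) by (simp add: multimatrix_apply complex_norm_square[symmetric])
    finally show "(?V \<otimes>\<^bsub>multimatrix_algebra k d\<^esub> ?V\<^sup>\<star>\<^bsub>multimatrix_algebra k d\<^esub>) l $$ (p, q)
      = \<one>\<^bsub>multimatrix_algebra k d\<^esub> l $$ (p, q)" .
  qed (use V multimatrix_closed multimatrix_one_zero_closed in auto)
qed

definition matrix_unit :: "nat \<Rightarrow> (nat \<Rightarrow> nat) \<Rightarrow> nat \<Rightarrow> nat \<Rightarrow> nat \<Rightarrow> nat \<Rightarrow> complex mat" where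
  "matrix_unit k d j x y = (\<lambda>l\<in>{..<k}. mat (d l) (d l)
     (\<lambda>(p, q). if l = j \<and> p = x \<and> q = y then 1 else 0))"

lemma matrix_unit_closed: "matrix_unit k d j x y \<in> carrier (multimatrix_algebra k d)"
  unfolding multimatrix_simps matrix_unit_def by auto

lemma index_matrix_unit:
  "\<lbrakk>l < k; p < d l; q < d l\<rbrakk> \<Longrightarrow>
    matrix_unit k d j x y l $$ (p, q) = (if l = j \<and> p = x \<and> q = y then 1 else 0)"
  by (simp add: matrix_unit_def)

text \<open>A matrix unit is half the difference of two monomial unitaries that differ in one sign.\<close>

lemma multimatrix_unitary_induct:
  assumes "X \<in> carrier (multimatrix_algebra k d)"
    and "\<And>u. u \<in> unitary_elements (multimatrix_algebra k d) \<Longrightarrow> P u"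
    and "\<And>X Y. \<lbrakk>X \<in> carrier (multimatrix_algebra k d); Y \<in> carrier (multimatrix_algebra k d); P X; P Y\<rbrakk>
      \<Longrightarrow> P (X \<oplus>\<^bsub>multimatrix_algebra k d\<^esub> Y)"
    and "\<And>c X. \<lbrakk>X \<in> carrier (multimatrix_algebra k d); P X\<rbrakk> \<Longrightarrow> P (c \<odot>\<^bsub>multimatrix_algebra k d\<^esub> X)"
  shows "P X"
proof -
  let ?B = "multimatrix_algebra k d"
  interpret ring ?B by (rule multimatrix_ring)
  note closed = multimatrix_closed[of _ k d] multimatrix_one_zero_closed[of k d] matrix_unit_closed
  have unit: "P (matrix_unit k d j x y)" if "j < k" "x < d j" "y < d j" for j x y
  proof -
    define V where "V \<epsilon> = (\<lambda>l\<in>{..<k}. mat (d l) (d l) (\<lambda>(p, q).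
      if q = (if l = j then transpose x y else id) p
      then (if l = j \<and> p = x then \<epsilon> else 1) else 0))" for \<epsilon> :: complex
    have V: "V 1 \<in> unitary_elements ?B" "V (-1) \<in> unitary_elements ?B"
      unfolding V_def using that
      by (intro unitary_monomial; auto intro: permutes_swap_id permutes_id simp: id_def[symmetric])+
    have carr: "V \<epsilon> \<in> carrier ?B" for \<epsilon>
      unfolding V_def multimatrix_simps by auto
    have ent: "V \<epsilon> l $$ (p, q) = (if q = (if l = j then transpose x y else id) p
      then (if l = j \<and> p = x then \<epsilon> else 1) else 0)" if "l < k" "p < d l" "q < d l" for \<epsilon> l p q
      using that by (simp add: V_def)
    have "matrix_unit k d j x y = (1/2) \<odot>\<^bsub>?B\<^esub> V 1 \<oplus>\<^bsub>?B\<^esub> (-1/2) \<odot>\<^bsub>?B\<^esub> V (-1)"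
      by (rule multimatrix_eqI[of _ k d])
        (simp_all add: closed carr multimatrix_apply multimatrix_dims[OF carr] index_matrix_unit ent)
    then show ?thesis
      using V assms(2-) carr closed by simp
  qed
  \<comment> \<open>The rule has no case for zero, yet the empty sum below requires it; it arises as
    \<open>0\<close> times the unitary unit element.\<close>
  have zero: "P \<zero>\<^bsub>?B\<^esub>"
  proof -
    have "\<zero>\<^bsub>?B\<^esub> = 0 \<odot>\<^bsub>?B\<^esub> \<one>\<^bsub>?B\<^esub>"
      by (rule multimatrix_eqI[of _ k d]) (simp_all add: closed multimatrix_apply)
    moreover have "\<one>\<^bsub>?B\<^esub> \<in> unitary_elements ?B"
      by (rule multimatrix_unitaryI) (auto simp: closed intro!: multimatrix_eqI[of _ k d] simp: multimatrix_apply)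
    ultimately show ?thesis
      using assms(2)[of "\<one>\<^bsub>?B\<^esub>"] assms(4)[of "\<one>\<^bsub>?B\<^esub>" 0] closed(6) by simp
  qed
  define J where "J = (SIGMA j:{..<k}. {..<d j} \<times> {..<d j})"
  define f where "f = (\<lambda>(j, x, y). X j $$ (x, y) \<odot>\<^bsub>?B\<^esub> matrix_unit k d j x y)"
  have f: "f l \<in> carrier ?B" "l \<in> J \<Longrightarrow> P (f l)" for l
    using unit assms(4) closed by (auto simp: f_def J_def split: prod.splits)
  have "finite J" by (auto simp: J_def)
  have sum: "finsum ?B f K \<in> carrier ?B \<and> P (finsum ?B f K)" if "finite K" "K \<subseteq> J" for K
    using that
  proof (induction K)
    case (insert l K)
    then show ?case
      using f assms(3) by (simp add: Pi_def)
  qed (simp add: zero)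
  have "X = finsum ?B f J"
  proof (rule multimatrix_eqI[of _ k d])
    fix i p q assume i: "i < k" "p < d i" "q < d i"
    have "finsum ?B f J i $$ (p, q) = (\<Sum>l\<in>J. f l i $$ (p, q))"
      by (rule index_multimatrix_finsum) (use i f \<open>finite J\<close> in auto)
    also have "\<dots> = (\<Sum>l\<in>J. if l = (i, p, q) then X i $$ (p, q) else 0)"
      by (rule sum.cong) (use i closed in \<open>auto simp: f_def multimatrix_apply index_matrix_unit
        multimatrix_dims[OF matrix_unit_closed] split: prod.splits\<close>)
    also have "\<dots> = X i $$ (p, q)"
      using \<open>finite J\<close> i by (simp add: J_def)
    finally show "X i $$ (p, q) = finsum ?B f J i $$ (p, q)" ..
  qed (use assms f in auto)
  then show ?thesis
    using sum[OF \<open>finite J\<close> order.refl] by (simp only:)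
qed

section \<open>Coordinates adapted to the inclusion\<close>

lemma unitary_elements_multimatrix:
  assumes U: "U \<in> unitary_elements (multimatrix_algebra k d)"
  shows "U \<in> carrier (multimatrix_algebra k d)"
    and "U\<^sup>\<star>\<^bsub>multimatrix_algebra k d\<^esub> \<otimes>\<^bsub>multimatrix_algebra k d\<^esub> U = \<one>\<^bsub>multimatrix_algebra k d\<^esub>"
    and "U \<otimes>\<^bsub>multimatrix_algebra k d\<^esub> U\<^sup>\<star>\<^bsub>multimatrix_algebra k d\<^esub> = \<one>\<^bsub>multimatrix_algebra k d\<^esub>"
    and "U\<^sup>\<star>\<^bsub>multimatrix_algebra k d\<^esub> \<in> unitary_elements (multimatrix_algebra k d)"
  using U multimatrix_star(1)[of U k d] multimatrix_closed(4)[of U k d]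
  by (simp_all add: unitary_elements_def)

lemma unitary_mult:
  assumes U: "U \<in> unitary_elements (multimatrix_algebra k d)"
    and V: "V \<in> unitary_elements (multimatrix_algebra k d)"
  shows "U \<otimes>\<^bsub>multimatrix_algebra k d\<^esub> V \<in> unitary_elements (multimatrix_algebra k d)"
proof -
  interpret ring "multimatrix_algebra k d" by (rule multimatrix_ring)
  let ?A = "multimatrix_algebra k d"
  note u = unitary_elements_multimatrix(1-3)[OF U] unitary_elements_multimatrix(1-3)[OF V]
  note closed = multimatrix_closed(2,4)[OF u(1)] multimatrix_closed(2,4)[OF u(4)]
  have "(U \<otimes>\<^bsub>?A\<^esub> V) \<otimes>\<^bsub>?A\<^esub> (V\<^sup>\<star>\<^bsub>?A\<^esub> \<otimes>\<^bsub>?A\<^esub> U\<^sup>\<star>\<^bsub>?A\<^esub>) = U \<otimes>\<^bsub>?A\<^esub> (V \<otimes>\<^bsub>?A\<^esub> V\<^sup>\<star>\<^bsub>?A\<^esub>) \<otimes>\<^bsub>?A\<^esub> U\<^sup>\<star>\<^bsub>?A\<^esub>"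
    using u(1,4) closed by (simp add: m_assoc del: u)
  then show ?thesis
    using u closed by (intro multimatrix_unitaryI) (simp_all add: multimatrix_star(2))
qed

lemma mat_trace_mult_comm:
  assumes "X \<in> carrier_mat a b" "Y \<in> carrier_mat b a"
  shows "mat_trace (X * Y) = mat_trace (Y * X)"
proof -
  have "mat_trace (X * Y) = (\<Sum>p<a. \<Sum>q<b. X $$ (p, q) * Y $$ (q, p))"
    using assms by (auto simp: mat_trace_def scalar_prod_def atLeast0LessThan intro!: sum.cong)
  also have "\<dots> = (\<Sum>q<b. \<Sum>p<a. Y $$ (q, p) * X $$ (p, q))"
    by (subst sum.swap) (simp add: mult.commute)
  also have "\<dots> = mat_trace (Y * X)"
    using assms by (auto simp: mat_trace_def scalar_prod_def atLeast0LessThan intro!: sum.cong)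
  finally show ?thesis .
qed

text \<open>The unitary whose existence defines an inclusion matrix becomes a parameter, because the
  coordinates used throughout depend on its choice.\<close>

locale multimatrix_inclusion =
  fixes r s :: nat and m n :: "nat \<Rightarrow> nat" and \<iota> :: "(nat \<Rightarrow> complex mat) \<Rightarrow> (nat \<Rightarrow> complex mat)"
    and \<Lambda> :: "nat mat" and U :: "nat \<Rightarrow> complex mat"
    and \<A> \<B> :: "(complex, nat \<Rightarrow> complex mat) star_algebra"
  defines "\<B> \<equiv> multimatrix_algebra r m" and "\<A> \<equiv> multimatrix_algebra s n"
  assumes m_pos: "\<And>j. j < r \<Longrightarrow> 0 < m j"
    and n_pos: "\<And>i. i < s \<Longrightarrow> 0 < n i"
    and embedding: "unital_star_embedding \<B> \<A> \<iota>"
    and \<Lambda>_carrier: "\<Lambda> \<in> carrier_mat s r"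
    and dimension_vector: "vec s n = \<Lambda> *\<^sub>v vec r m"
    and U: "U \<in> unitary_elements \<A>"
    and \<iota>_eq: "\<And>X. X \<in> carrier \<B> \<Longrightarrow>
      \<iota> X = U \<otimes>\<^bsub>\<A>\<^esub> standard_inclusion r s \<Lambda> X \<otimes>\<^bsub>\<A>\<^esub> U\<^sup>\<star>\<^bsub>\<A>\<^esub>"
begin

sublocale A: ring \<A>
  unfolding \<A>_def by (rule multimatrix_ring)

sublocale B: ring \<B>
  unfolding \<B>_def by (rule multimatrix_ring)

abbreviation a :: "nat \<Rightarrow> nat \<Rightarrow> nat" where
  "a i j \<equiv> \<Lambda> $$ (i, j)"

lemmas A_star [simp] = multimatrix_star[where k = s and d = n, folded \<A>_def]
  and A_closed [simp] = multimatrix_closed(3,4)[where k = s and d = n, folded \<A>_def]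
  and A_unitary = unitary_elements_multimatrix[where k = s and d = n, folded \<A>_def]
  and A_apply = multimatrix_apply[where k = s and d = n, folded \<A>_def]
  and B_closed = multimatrix_closed(3,4)[where k = r and d = m, folded \<B>_def]
  and B_dims = multimatrix_dims[where k = r and d = m, folded \<B>_def]

lemma n_eq: "i < s \<Longrightarrow> n i = (\<Sum>j<r. m j * a i j)"
proof -
  assume "i < s"
  then have "n i = (\<Lambda> *\<^sub>v vec r m) $ i"
    by (simp flip: dimension_vector)
  also have "\<dots> = (\<Sum>j<r. a i j * m j)"
    using \<open>i < s\<close> \<Lambda>_carrier by (auto simp: scalar_prod_def atLeast0LessThan intro!: sum.cong)
  finally show ?thesis
    by (simp add: mult.commute)
qed

text \<open>A row or column of the \<open>i\<close>-th summand of \<open>\<A>\<close> is indexed by a triple \<open>(j, x, c)\<close>: the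
  summand \<open>j\<close> of \<open>\<B>\<close>, a row or column \<open>x\<close> of it, and one of its \<open>a i j\<close> copies \<open>c\<close>.\<close>

definition idx :: "nat \<Rightarrow> (nat \<times> nat \<times> nat) set" where
  "idx i = (SIGMA j:{..<r}. {..<m j} \<times> {..<a i j})"

text \<open>The copy \<open>c\<close> varies fastest because the identity is the right factor of the
  Kronecker product in \<open>standard_inclusion\<close>.\<close>

definition enc :: "nat \<Rightarrow> nat \<times> nat \<times> nat \<Rightarrow> nat" where
  "enc i = (\<lambda>(j, x, c). (\<Sum>k<j. m k * a i k) + (x * a i j + c))"

lemma idx_iff [simp]: "(j, x, c) \<in> idx i \<longleftrightarrow> j < r \<and> x < m j \<and> c < a i j"
  by (simp add: idx_def)

lemma finite_idx [simp]: "finite (idx i)"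
  by (simp add: idx_def)

lemma sum_idx: "(\<Sum>P\<in>idx i. f P) = (\<Sum>j<r. \<Sum>x<m j. \<Sum>c<a i j. f (j, x, c))"
  unfolding idx_def sum.cartesian_product by (subst sum.Sigma) (auto simp: split_def)

lemma enc_bij: "i < s \<Longrightarrow> bij_betw (enc i) (idx i) {..<n i}"
  unfolding enc_def idx_def n_eq by (rule bij_betw_offset3)

lemma enc_less: "i < s \<Longrightarrow> P \<in> idx i \<Longrightarrow> enc i P < n i"
  using enc_bij bij_betwE by blast

lemma sum_enc: "i < s \<Longrightarrow> (\<Sum>p<n i. f p) = (\<Sum>P\<in>idx i. f (enc i P))"
  using sum.reindex_bij_betw[OF enc_bij, of i f] by simp

text \<open>The matrix entries after undoing the change of basis \<open>U\<close>; in these coordinates \<open>\<iota>\<close> is the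
  standard inclusion.\<close>

definition ent :: "(nat \<Rightarrow> complex mat) \<Rightarrow> nat \<Rightarrow> nat \<times> nat \<times> nat \<Rightarrow> nat \<times> nat \<times> nat \<Rightarrow> complex" where
  "ent Y i P Q = (U\<^sup>\<star>\<^bsub>\<A>\<^esub> \<otimes>\<^bsub>\<A>\<^esub> Y \<otimes>\<^bsub>\<A>\<^esub> U) i $$ (enc i P, enc i Q)"

text \<open>The inverse of \<open>ent\<close>: by \<open>ent_mk\<close> and \<open>ent_eqI\<close>,
  elements of \<A> can be prescribed and compared through their adapted entries.\<close>

definition mk :: "(nat \<Rightarrow> nat \<times> nat \<times> nat \<Rightarrow> nat \<times> nat \<times> nat \<Rightarrow> complex) \<Rightarrow> nat \<Rightarrow> complex mat" where
  "mk f = U \<otimes>\<^bsub>\<A>\<^esub> (\<lambda>i\<in>{..<s}. mat (n i) (n i)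
     (\<lambda>(p, q). f i (inv_into (idx i) (enc i) p) (inv_into (idx i) (enc i) q))) \<otimes>\<^bsub>\<A>\<^esub> U\<^sup>\<star>\<^bsub>\<A>\<^esub>"

lemma U_closed [simp]: "U \<in> carrier \<A>"
  using A_unitary U by blast

lemma unconj:
  assumes "Y \<in> carrier \<A>"
  shows "U \<otimes>\<^bsub>\<A>\<^esub> (U\<^sup>\<star>\<^bsub>\<A>\<^esub> \<otimes>\<^bsub>\<A>\<^esub> Y) = Y" "U\<^sup>\<star>\<^bsub>\<A>\<^esub> \<otimes>\<^bsub>\<A>\<^esub> (U \<otimes>\<^bsub>\<A>\<^esub> Y) = Y"
  using assms A_unitary[OF U] by (simp_all flip: A.m_assoc)

lemma mk_closed [simp]: "mk f \<in> carrier \<A>"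
proof -
  have "(\<lambda>i\<in>{..<s}. mat (n i) (n i) (\<lambda>(p, q). f i (inv_into (idx i) (enc i) p) (inv_into (idx i) (enc i) q)))
    \<in> carrier \<A>"
    unfolding \<A>_def multimatrix_simps by auto
  then show ?thesis
    by (simp add: mk_def)
qed

lemma ent_mk: "\<lbrakk>i < s; P \<in> idx i; Q \<in> idx i\<rbrakk> \<Longrightarrow> ent (mk f) i P Q = f i P Q"
proof -
  assume i: "i < s" "P \<in> idx i" "Q \<in> idx i"
  let ?M = "\<lambda>i\<in>{..<s}. mat (n i) (n i) (\<lambda>(p, q). f i (inv_into (idx i) (enc i) p) (inv_into (idx i) (enc i) q))"
  have "?M \<in> carrier \<A>"
    unfolding \<A>_def multimatrix_simps by auto
  then have "U\<^sup>\<star>\<^bsub>\<A>\<^esub> \<otimes>\<^bsub>\<A>\<^esub> mk f \<otimes>\<^bsub>\<A>\<^esub> U = ?M"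
    using A_unitary[OF U] by (simp add: mk_def A.m_assoc unconj)
  then show ?thesis
    using i enc_less[OF i(1)] inv_into_f_f[OF bij_betw_imp_inj_on[OF enc_bij[OF i(1)]]]
    by (simp add: ent_def)
qed

lemma ent_eqI:
  assumes "X \<in> carrier \<A>" "Y \<in> carrier \<A>"
    and "\<And>i P Q. \<lbrakk>i < s; P \<in> idx i; Q \<in> idx i\<rbrakk> \<Longrightarrow> ent X i P Q = ent Y i P Q"
  shows "X = Y"
proof -
  have "U\<^sup>\<star>\<^bsub>\<A>\<^esub> \<otimes>\<^bsub>\<A>\<^esub> X \<otimes>\<^bsub>\<A>\<^esub> U = U\<^sup>\<star>\<^bsub>\<A>\<^esub> \<otimes>\<^bsub>\<A>\<^esub> Y \<otimes>\<^bsub>\<A>\<^esub> U"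
  proof (rule multimatrix_eqI[of _ s n])
    fix i p q assume i: "i < s" "p < n i" "q < n i"
    then have "p \<in> enc i ` idx i" "q \<in> enc i ` idx i"
      using bij_betw_imp_surj_on[OF enc_bij[OF i(1)]] by simp_all
    then obtain P Q where "P \<in> idx i" "Q \<in> idx i" "p = enc i P" "q = enc i Q"
      by blast
    then show "(U\<^sup>\<star>\<^bsub>\<A>\<^esub> \<otimes>\<^bsub>\<A>\<^esub> X \<otimes>\<^bsub>\<A>\<^esub> U) i $$ (p, q) = (U\<^sup>\<star>\<^bsub>\<A>\<^esub> \<otimes>\<^bsub>\<A>\<^esub> Y \<otimes>\<^bsub>\<A>\<^esub> U) i $$ (p, q)"
      using assms(3)[OF i(1)] by (simp add: ent_def)
  qed (use assms in \<open>simp_all flip: \<A>_def\<close>)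
  then have "U \<otimes>\<^bsub>\<A>\<^esub> (U\<^sup>\<star>\<^bsub>\<A>\<^esub> \<otimes>\<^bsub>\<A>\<^esub> X \<otimes>\<^bsub>\<A>\<^esub> U) \<otimes>\<^bsub>\<A>\<^esub> U\<^sup>\<star>\<^bsub>\<A>\<^esub>
    = U \<otimes>\<^bsub>\<A>\<^esub> (U\<^sup>\<star>\<^bsub>\<A>\<^esub> \<otimes>\<^bsub>\<A>\<^esub> Y \<otimes>\<^bsub>\<A>\<^esub> U) \<otimes>\<^bsub>\<A>\<^esub> U\<^sup>\<star>\<^bsub>\<A>\<^esub>"
    by simp
  then show ?thesis
    using assms A_unitary[OF U] by (simp add: A.m_assoc unconj)
qed

section \<open>Operations and traces in the adapted coordinates\<close>

lemma conj_dims: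
  assumes "Y \<in> carrier \<A>" "i < s"
  shows "dim_row ((U\<^sup>\<star>\<^bsub>\<A>\<^esub> \<otimes>\<^bsub>\<A>\<^esub> Y \<otimes>\<^bsub>\<A>\<^esub> U) i) = n i" "dim_col ((U\<^sup>\<star>\<^bsub>\<A>\<^esub> \<otimes>\<^bsub>\<A>\<^esub> Y \<otimes>\<^bsub>\<A>\<^esub> U) i) = n i"
  using assms multimatrix_dims[of "U\<^sup>\<star>\<^bsub>\<A>\<^esub> \<otimes>\<^bsub>\<A>\<^esub> Y \<otimes>\<^bsub>\<A>\<^esub> U" s n i] by (simp_all flip: \<A>_def)

lemma ent_mult:
  assumes "X \<in> carrier \<A>" "Y \<in> carrier \<A>" "i < s" "P \<in> idx i" "Q \<in> idx i"
  shows "ent (X \<otimes>\<^bsub>\<A>\<^esub> Y) i P Q = (\<Sum>R\<in>idx i. ent X i P R * ent Y i R Q)"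
proof -
  have "U\<^sup>\<star>\<^bsub>\<A>\<^esub> \<otimes>\<^bsub>\<A>\<^esub> (X \<otimes>\<^bsub>\<A>\<^esub> Y) \<otimes>\<^bsub>\<A>\<^esub> U
    = (U\<^sup>\<star>\<^bsub>\<A>\<^esub> \<otimes>\<^bsub>\<A>\<^esub> X \<otimes>\<^bsub>\<A>\<^esub> U) \<otimes>\<^bsub>\<A>\<^esub> (U\<^sup>\<star>\<^bsub>\<A>\<^esub> \<otimes>\<^bsub>\<A>\<^esub> Y \<otimes>\<^bsub>\<A>\<^esub> U)" (is "_ = ?X \<otimes>\<^bsub>\<A>\<^esub> ?Y")
    using assms by (simp add: A.m_assoc unconj)
  moreover have "(?X \<otimes>\<^bsub>\<A>\<^esub> ?Y) i $$ (enc i P, enc i Q) = (\<Sum>p<n i. ?X i $$ (enc i P, p) * ?Y i $$ (p, enc i Q))"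
    unfolding A_apply(1)[OF assms(3), of ?X ?Y]
    using assms enc_less by (simp add: conj_dims scalar_prod_def atLeast0LessThan)
  ultimately show ?thesis
    using assms by (simp add: ent_def sum_enc)
qed

lemma ent_star:
  assumes "X \<in> carrier \<A>" "i < s" "P \<in> idx i" "Q \<in> idx i"
  shows "ent (X\<^sup>\<star>\<^bsub>\<A>\<^esub>) i P Q = cnj (ent X i Q P)"
proof -
  have "U\<^sup>\<star>\<^bsub>\<A>\<^esub> \<otimes>\<^bsub>\<A>\<^esub> X\<^sup>\<star>\<^bsub>\<A>\<^esub> \<otimes>\<^bsub>\<A>\<^esub> U = (U\<^sup>\<star>\<^bsub>\<A>\<^esub> \<otimes>\<^bsub>\<A>\<^esub> X \<otimes>\<^bsub>\<A>\<^esub> U)\<^sup>\<star>\<^bsub>\<A>\<^esub>"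
    using assms by (simp add: A.m_assoc)
  then have "ent (X\<^sup>\<star>\<^bsub>\<A>\<^esub>) i P Q = mat_adjoint ((U\<^sup>\<star>\<^bsub>\<A>\<^esub> \<otimes>\<^bsub>\<A>\<^esub> X \<otimes>\<^bsub>\<A>\<^esub> U) i) $$ (enc i P, enc i Q)"
    unfolding ent_def by (simp only: A_apply(6)[OF assms(2)])
  then show ?thesis
    using assms enc_less[OF assms(2)] by (simp add: conj_dims ent_def)
qed

lemma ent_add:
  assumes "X \<in> carrier \<A>" "Y \<in> carrier \<A>" "i < s" "P \<in> idx i" "Q \<in> idx i"
  shows "ent (X \<oplus>\<^bsub>\<A>\<^esub> Y) i P Q = ent X i P Q + ent Y i P Q"
proof -
  have "U\<^sup>\<star>\<^bsub>\<A>\<^esub> \<otimes>\<^bsub>\<A>\<^esub> (X \<oplus>\<^bsub>\<A>\<^esub> Y) \<otimes>\<^bsub>\<A>\<^esub> U = (U\<^sup>\<star>\<^bsub>\<A>\<^esub> \<otimes>\<^bsub>\<A>\<^esub> X \<otimes>\<^bsub>\<A>\<^esub> U) \<oplus>\<^bsub>\<A>\<^esub> (U\<^sup>\<star>\<^bsub>\<A>\<^esub> \<otimes>\<^bsub>\<A>\<^esub> Y \<otimes>\<^bsub>\<A>\<^esub> U)"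
    using assms by (simp add: A.r_distr A.l_distr)
  then show ?thesis
    using assms enc_less unfolding ent_def by (simp add: A_apply(4) conj_dims)
qed

lemma smult_mult:
  assumes "X \<in> carrier \<A>" "Y \<in> carrier \<A>"
  shows "(c \<odot>\<^bsub>\<A>\<^esub> X) \<otimes>\<^bsub>\<A>\<^esub> Y = c \<odot>\<^bsub>\<A>\<^esub> (X \<otimes>\<^bsub>\<A>\<^esub> Y)" "X \<otimes>\<^bsub>\<A>\<^esub> (c \<odot>\<^bsub>\<A>\<^esub> Y) = c \<odot>\<^bsub>\<A>\<^esub> (X \<otimes>\<^bsub>\<A>\<^esub> Y)"
proof -
  have dims: "X i \<in> carrier_mat (n i) (n i)" "Y i \<in> carrier_mat (n i) (n i)" if "i < s" for i
    using assms multimatrix_dims that unfolding \<A>_def by blast+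
  show "(c \<odot>\<^bsub>\<A>\<^esub> X) \<otimes>\<^bsub>\<A>\<^esub> Y = c \<odot>\<^bsub>\<A>\<^esub> (X \<otimes>\<^bsub>\<A>\<^esub> Y)"
    by (rule multimatrix_ext[of _ s n, folded \<A>_def])
      (use assms in \<open>simp_all add: A_apply mult_smult_assoc_mat[OF dims(1) dims(2)]\<close>)
  show "X \<otimes>\<^bsub>\<A>\<^esub> (c \<odot>\<^bsub>\<A>\<^esub> Y) = c \<odot>\<^bsub>\<A>\<^esub> (X \<otimes>\<^bsub>\<A>\<^esub> Y)"
    by (rule multimatrix_ext[of _ s n, folded \<A>_def])
      (use assms in \<open>simp_all add: A_apply mult_smult_distrib[OF dims(1) dims(2)]\<close>)
qed

lemma ent_smult:
  assumes "X \<in> carrier \<A>" "i < s" "P \<in> idx i" "Q \<in> idx i"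
  shows "ent (c \<odot>\<^bsub>\<A>\<^esub> X) i P Q = c * ent X i P Q"
  using assms enc_less unfolding ent_def by (simp add: smult_mult A_apply(5) conj_dims)

lemma ent_one:
  assumes "i < s" "P \<in> idx i" "Q \<in> idx i"
  shows "ent \<one>\<^bsub>\<A>\<^esub> i P Q = (if P = Q then 1 else 0)"
proof -
  have "enc i P = enc i Q \<longleftrightarrow> P = Q"
    using assms inj_on_eq_iff[OF bij_betw_imp_inj_on[OF enc_bij]] by blast
  then show ?thesis
    using assms A_unitary(2)[OF U] enc_less[OF assms(1)] by (simp add: ent_def A_apply(2))
qed

lemma ent_zero: "\<lbrakk>i < s; P \<in> idx i; Q \<in> idx i\<rbrakk> \<Longrightarrow> ent \<zero>\<^bsub>\<A>\<^esub> i P Q = 0"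
  using enc_less unfolding ent_def by (simp add: A_apply(3))

lemma ent_finsum:
  assumes "finite J" "\<And>l. l \<in> J \<Longrightarrow> f l \<in> carrier \<A>" "i < s" "P \<in> idx i" "Q \<in> idx i"
  shows "ent (finsum \<A> f J) i P Q = (\<Sum>l\<in>J. ent (f l) i P Q)"
  using assms(1,2)
proof (induction J rule: finite_induct)
  case (insert l J)
  then show ?case
    using assms(3-) by (simp add: Pi_def ent_add)
qed (use assms in \<open>simp add: ent_zero\<close>)

lemma mat_trace_ent:
  assumes "Y \<in> carrier \<A>" "i < s"
  shows "mat_trace (Y i) = (\<Sum>P\<in>idx i. ent Y i P P)"
proof -
  have dims: "X \<in> carrier \<A> \<Longrightarrow> X i \<in> carrier_mat (n i) (n i)" for X
    using assms(2) multimatrix_dims unfolding \<A>_def by blast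
  have "(\<Sum>P\<in>idx i. ent Y i P P) = mat_trace ((U\<^sup>\<star>\<^bsub>\<A>\<^esub> \<otimes>\<^bsub>\<A>\<^esub> Y \<otimes>\<^bsub>\<A>\<^esub> U) i)"
    using assms unfolding ent_def mat_trace_def by (simp add: conj_dims sum_enc)
  also have "\<dots> = mat_trace ((U \<otimes>\<^bsub>\<A>\<^esub> (U\<^sup>\<star>\<^bsub>\<A>\<^esub> \<otimes>\<^bsub>\<A>\<^esub> Y)) i)"
    unfolding A_apply(1)[OF assms(2), of U] A_apply(1)[OF assms(2), of "U\<^sup>\<star>\<^bsub>\<A>\<^esub> \<otimes>\<^bsub>\<A>\<^esub> Y"]
    by (rule mat_trace_mult_comm[OF dims dims]) (use assms in simp_all)
  finally show ?thesis
    using assms by (simp add: unconj)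
qed

lemma \<iota>_hom:
  assumes "X \<in> carrier \<B>"
  shows "\<iota> X \<in> carrier \<A>" "Y \<in> carrier \<B> \<Longrightarrow> \<iota> (X \<otimes>\<^bsub>\<B>\<^esub> Y) = \<iota> X \<otimes>\<^bsub>\<A>\<^esub> \<iota> Y"
    "Y \<in> carrier \<B> \<Longrightarrow> \<iota> (X \<oplus>\<^bsub>\<B>\<^esub> Y) = \<iota> X \<oplus>\<^bsub>\<A>\<^esub> \<iota> Y" "\<iota> (c \<odot>\<^bsub>\<B>\<^esub> X) = c \<odot>\<^bsub>\<A>\<^esub> \<iota> X"
    "\<iota> (X\<^sup>\<star>\<^bsub>\<B>\<^esub>) = (\<iota> X)\<^sup>\<star>\<^bsub>\<A>\<^esub>" "Y \<in> carrier \<B> \<Longrightarrow> \<iota> X = \<iota> Y \<longleftrightarrow> X = Y"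
    "\<iota> \<one>\<^bsub>\<B>\<^esub> = \<one>\<^bsub>\<A>\<^esub>"
proof -
  have hom: "\<iota> \<in> Ring.ring_hom \<B> \<A>" and inj: "inj_on \<iota> (carrier \<B>)"
    and lin: "\<forall>c. \<forall>X \<in> carrier \<B>. \<iota> (c \<odot>\<^bsub>\<B>\<^esub> X) = c \<odot>\<^bsub>\<A>\<^esub> \<iota> X"
    and star: "\<forall>X \<in> carrier \<B>. \<iota> (X\<^sup>\<star>\<^bsub>\<B>\<^esub>) = (\<iota> X)\<^sup>\<star>\<^bsub>\<A>\<^esub>"
    using embedding unfolding unital_star_embedding_def by blast+
  show "\<iota> X \<in> carrier \<A>" "\<iota> \<one>\<^bsub>\<B>\<^esub> = \<one>\<^bsub>\<A>\<^esub>"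
    by (rule ring_hom_closed[OF hom assms], rule ring_hom_one[OF hom])
  show "\<iota> (c \<odot>\<^bsub>\<B>\<^esub> X) = c \<odot>\<^bsub>\<A>\<^esub> \<iota> X" "\<iota> (X\<^sup>\<star>\<^bsub>\<B>\<^esub>) = (\<iota> X)\<^sup>\<star>\<^bsub>\<A>\<^esub>"
    using lin star assms by blast+
  assume Y: "Y \<in> carrier \<B>"
  show "\<iota> (X \<otimes>\<^bsub>\<B>\<^esub> Y) = \<iota> X \<otimes>\<^bsub>\<A>\<^esub> \<iota> Y" "\<iota> (X \<oplus>\<^bsub>\<B>\<^esub> Y) = \<iota> X \<oplus>\<^bsub>\<A>\<^esub> \<iota> Y"
    using ring_hom_mult[OF hom assms Y] ring_hom_add[OF hom assms Y] by blast+
  show "\<iota> X = \<iota> Y \<longleftrightarrow> X = Y"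
    by (rule inj_on_eq_iff[OF inj assms Y])
qed

text \<open>Dividing the offset \<open>x * a i j + c\<close> by \<open>a i j\<close> returns
  \<open>x\<close>, which addresses \<open>X j\<close>, and leaves \<open>c\<close>, which addresses
  the identity factor; so entries between different copies vanish.\<close>

lemma ent_\<iota>:
  assumes X: "X \<in> carrier \<B>" and i: "i < s" "(j, x, c) \<in> idx i" "(j', x', c') \<in> idx i"
  shows "ent (\<iota> X) i (j, x, c) (j', x', c') = (if j = j' \<and> c = c' then X j $$ (x, x') else 0)"
proof -
  define As where "As = (\<lambda>i. map (\<lambda>j. X j \<otimes>\<^sub>K 1\<^sub>m (a i j)) [0..<r])"
  have dims: "dim_row (As i ! k) = m k * a i k" "dim_col (As i ! k) = m k * a i k" if "k < r" for k i
    using that B_dims[OF X] by (simp_all add: As_def kronecker_product_def)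
  have len: "length (As i) = r" for i
    by (simp add: As_def)
  have dim: "dim_row (diag_block_mat (As i)) = n i" "dim_col (diag_block_mat (As i)) = n i" if "i < s" for i
    unfolding n_eq[OF that] dim_diag_block_mat sum_list_sum_nth length_map len atLeast0LessThan
    by (rule sum.cong[OF refl]; simp add: dims len)+
  have "diag_block_mat (As i) \<in> carrier_mat (n i) (n i)" if "i < s" for i
    using dim[OF that] by (rule carrier_matI)
  then have S: "standard_inclusion r s \<Lambda> X \<in> carrier \<A>"
    unfolding \<A>_def multimatrix_simps standard_inclusion_def As_def by simp
  have lt: "y * a i k + b < m k * a i k" if "y < m k" "b < a i k" for y b k
  proof -
    have "y * a i k + b < Suc y * a i k" using that by simp
    also have "\<dots> \<le> m k * a i k" using that by (intro mult_right_mono) auto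
    finally show ?thesis .
  qed
  have "U\<^sup>\<star>\<^bsub>\<A>\<^esub> \<otimes>\<^bsub>\<A>\<^esub> \<iota> X \<otimes>\<^bsub>\<A>\<^esub> U = standard_inclusion r s \<Lambda> X"
    using A_unitary[OF U] S by (simp add: \<iota>_eq[OF X] A.m_assoc unconj)
  then have "ent (\<iota> X) i (j, x, c) (j', x', c')
    = diag_block_mat (As i) $$ ((\<Sum>k<j. m k * a i k) + (x * a i j + c), (\<Sum>k<j'. m k * a i k) + (x' * a i j' + c'))"
    using i by (simp add: ent_def enc_def standard_inclusion_def As_def)
  also have "\<dots> = diag_block_mat (As i) $$ ((\<Sum>k<j. dim_row (As i ! k)) + (x * a i j + c),
      (\<Sum>k<j'. dim_row (As i ! k)) + (x' * a i j' + c'))"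
    using i dims by simp
  also have "\<dots> = (if j = j' then (As i ! j) $$ (x * a i j + c, x' * a i j' + c') else 0)"
  proof (rule index_diag_block_mat)
    show "dim_col A = dim_row A" if "A \<in> set (As i)" for A
      using that B_dims(2,3)[OF X] by (auto simp: As_def kronecker_product_def)
  qed (use i dims len lt in simp_all)
  also have "\<dots> = (if j = j' \<and> c = c' then X j $$ (x, x') else 0)"
  proof (cases "j = j'")
    case True
    then show ?thesis
      using i lt[of x j c] lt[of x' j c'] B_dims(2)[OF X, of j] B_dims(3)[OF X, of j]
      by (simp add: As_def kronecker_product_def)
  qed simp
  finally show ?thesis .
qed

end

section \<open>Normalizers and the conditional expectation\<close>

context multimatrix_inclusion
begin

abbreviation "\<B>\<^sub>\<iota> \<equiv> \<iota> ` carrier \<B>"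

text \<open>Right multiplication by the image of \<B> moves only the middle coordinate of a triple,
  whereas traces against matrix units of \<B> and products with monomials run only over copies. This
  lemma and the next collapse the two kinds of sums.\<close>

lemma sum_idx_row:
  assumes "j < r" "c < a i j"
    and "\<And>k y b. \<lbrakk>(k, y, b) \<in> idx i; k \<noteq> j \<or> b \<noteq> c\<rbrakk> \<Longrightarrow> f (k, y, b) = 0"
  shows "(\<Sum>P\<in>idx i. f P) = (\<Sum>x<m j. f (j, x, c))"
proof -
  have "(\<Sum>P\<in>idx i. f P) = (\<Sum>P\<in>(\<lambda>x. (j, x, c)) ` {..<m j}. f P)"
  proof (rule sum.mono_neutral_right)
    show "\<forall>P\<in>idx i - (\<lambda>x. (j, x, c)) ` {..<m j}. f P = 0"
    proof
      fix P assume P: "P \<in> idx i - (\<lambda>x. (j, x, c)) ` {..<m j}"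
      obtain k y b where "P = (k, y, b)" by (cases P)
      then show "f P = 0"
        using P by (intro assms(3)[of k y b, folded \<open>P = (k, y, b)\<close>]) auto
    qed
  qed (use assms in auto)
  also have "\<dots> = (\<Sum>x<m j. f (j, x, c))"
    by (subst sum.reindex) (auto simp: inj_on_def)
  finally show ?thesis .
qed

lemma sum_idx_copies:
  assumes "j < r" "x < m j"
    and "\<And>k y b. \<lbrakk>(k, y, b) \<in> idx i; k \<noteq> j \<or> y \<noteq> x\<rbrakk> \<Longrightarrow> f (k, y, b) = 0"
  shows "(\<Sum>P\<in>idx i. f P) = (\<Sum>c<a i j. f (j, x, c))"
proof -
  have "(\<Sum>P\<in>idx i. f P) = (\<Sum>P\<in>(\<lambda>c. (j, x, c)) ` {..<a i j}. f P)"
  proof (rule sum.mono_neutral_right)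
    show "\<forall>P\<in>idx i - (\<lambda>c. (j, x, c)) ` {..<a i j}. f P = 0"
    proof
      fix P assume P: "P \<in> idx i - (\<lambda>c. (j, x, c)) ` {..<a i j}"
      obtain k y b where "P = (k, y, b)" by (cases P)
      then show "f P = 0"
        using P by (intro assms(3)[of k y b, folded \<open>P = (k, y, b)\<close>]) auto
    qed
  qed (use assms in auto)
  also have "\<dots> = (\<Sum>c<a i j. f (j, x, c))"
    by (subst sum.reindex) (auto simp: inj_on_def)
  finally show ?thesis .
qed

lemma ent_mult_\<iota>:
  assumes "Y \<in> carrier \<A>" "X \<in> carrier \<B>" "i < s" "P \<in> idx i" "(j, x, c) \<in> idx i"
  shows "ent (Y \<otimes>\<^bsub>\<A>\<^esub> \<iota> X) i P (j, x, c) = (\<Sum>y<m j. ent Y i P (j, y, c) * X j $$ (y, x))"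
proof -
  have "ent (Y \<otimes>\<^bsub>\<A>\<^esub> \<iota> X) i P (j, x, c) = (\<Sum>R\<in>idx i. ent Y i P R * ent (\<iota> X) i R (j, x, c))"
    using assms \<iota>_hom(1) by (intro ent_mult) auto
  also have "\<dots> = (\<Sum>y<m j. ent Y i P (j, y, c) * ent (\<iota> X) i (j, y, c) (j, x, c))"
    by (rule sum_idx_row) (use assms in \<open>auto simp: ent_\<iota>\<close>)
  also have "\<dots> = (\<Sum>y<m j. ent Y i P (j, y, c) * X j $$ (y, x))"
    by (rule sum.cong) (use assms in \<open>auto simp: ent_\<iota>\<close>)
  finally show ?thesis .
qed

abbreviation unit :: "nat \<Rightarrow> nat \<Rightarrow> nat \<Rightarrow> nat \<Rightarrow> complex mat" where
  "unit \<equiv> matrix_unit r m"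

lemmas unit_closed [simp] = matrix_unit_closed[of r m, folded \<B>_def]
  and index_unit = index_matrix_unit[where k = r and d = m]

text \<open>Matrix units of \<B> serve as test elements: the traces against them see exactly the
  sums over copies that will determine the expectation.\<close>

lemma mat_trace_mult_unit:
  assumes "Y \<in> carrier \<A>" "i < s" "j < r" "x < m j" "y < m j"
  shows "mat_trace ((Y \<otimes>\<^bsub>\<A>\<^esub> \<iota> (unit j y x)) i) = (\<Sum>c<a i j. ent Y i (j, x, c) (j, y, c))"
proof -
  have e: "ent (Y \<otimes>\<^bsub>\<A>\<^esub> \<iota> (unit j y x)) i (k, z, b) (k, z, b)
    = (if k = j \<and> z = x then ent Y i (j, x, b) (j, y, b) else 0)" if "(k, z, b) \<in> idx i" for k z b
  proof -
    have "ent (Y \<otimes>\<^bsub>\<A>\<^esub> \<iota> (unit j y x)) i (k, z, b) (k, z, b)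
      = (\<Sum>z'<m k. ent Y i (k, z, b) (k, z', b) * unit j y x k $$ (z', z))"
      using assms that by (intro ent_mult_\<iota>) auto
    also have "\<dots> = (\<Sum>z'<m k. if z' = y then (if k = j \<and> z = x then ent Y i (j, x, b) (j, y, b) else 0) else 0)"
      using that by (intro sum.cong) (auto simp: index_unit)
    also have "\<dots> = (if k = j \<and> z = x then ent Y i (j, x, b) (j, y, b) else 0)"
      using assms by auto
    finally show ?thesis .
  qed
  have "mat_trace ((Y \<otimes>\<^bsub>\<A>\<^esub> \<iota> (unit j y x)) i)
    = (\<Sum>P\<in>idx i. ent (Y \<otimes>\<^bsub>\<A>\<^esub> \<iota> (unit j y x)) i P P)"
    using assms by (intro mat_trace_ent) (auto simp: \<iota>_hom(1))
  also have "\<dots> = (\<Sum>c<a i j. ent (Y \<otimes>\<^bsub>\<A>\<^esub> \<iota> (unit j y x)) i (j, x, c) (j, x, c))"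
    by (rule sum_idx_copies) (use assms e in auto)
  also have "\<dots> = (\<Sum>c<a i j. ent Y i (j, x, c) (j, y, c))"
    using assms by (intro sum.cong) (auto simp: e)
  finally show ?thesis .
qed

text \<open>The \<open>j\<close>-th coordinate of the vector in the spectral condition, and also the
  normalizing constant of the expectation on the \<open>j\<close>-th summand of \<B>.\<close>

definition weight :: "nat \<Rightarrow> nat" where
  "weight j = (\<Sum>i<s. n i * a i j)"

text \<open>A zero column of \<Lambda> would make \<iota> kill a matrix unit of that summand,
  against injectivity.\<close>

lemma ex_multiplicity_pos:
  assumes "j < r"
  shows "\<exists>i<s. 0 < a i j"
proof (rule ccontr)
  assume "\<not> (\<exists>i<s. 0 < a i j)"
  then have "\<iota> (unit j 0 0) = \<iota> \<zero>\<^bsub>\<B>\<^esub>"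
    by (intro ent_eqI)
      (auto simp: \<iota>_hom(1) ent_\<iota> index_unit multimatrix_apply(3)[where k = r and d = m, folded \<B>_def])
  then have "unit j 0 0 = \<zero>\<^bsub>\<B>\<^esub>"
    by (simp add: \<iota>_hom(6))
  then have "unit j 0 0 j $$ (0, 0) = \<zero>\<^bsub>\<B>\<^esub> j $$ (0, 0)"
    by simp
  then show False
    using assms m_pos[OF assms]
    by (simp add: index_unit multimatrix_apply(3)[where k = r and d = m, folded \<B>_def])
qed

lemma weight_pos:
  assumes "j < r"
  shows "0 < weight j"
proof -
  obtain i where "i < s" "0 < a i j"
    using ex_multiplicity_pos[OF assms] by blast
  then show ?thesis
    unfolding weight_def using n_pos by (intro sum_pos2[of "{..<s}" i]) auto
qed

lemma spectral_condition_iff: "spectral_condition r m s n \<Lambda> \<longleftrightarrow> (\<exists>d. \<forall>j<r. weight j = d * m j)"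
proof -
  have "(transpose_mat \<Lambda> *\<^sub>v vec s n) = vec r weight"
    using \<Lambda>_carrier
    by (intro eq_vecI) (auto simp: scalar_prod_def weight_def atLeast0LessThan mult.commute intro!: sum.cong)
  moreover have "d \<cdot>\<^sub>v vec r m = vec r (\<lambda>j. d * m j)" for d :: nat
    by auto
  moreover have "vec r f = vec r g \<longleftrightarrow> (\<forall>j<r. f j = g j)" for f g :: "nat \<Rightarrow> nat"
    by (metis eq_vecI dim_vec index_vec)
  ultimately show ?thesis
    unfolding spectral_condition_def by simp
qed

lemma normalizer_unitary: "V \<in> normalizer \<A> \<B>\<^sub>\<iota> \<Longrightarrow> V \<in> unitary_elements \<A>"
  by (simp add: normalizer_def)

lemma normalizer_carrier: "V \<in> normalizer \<A> \<B>\<^sub>\<iota> \<Longrightarrow> V \<in> carrier \<A>"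
  using normalizer_unitary A_unitary(1) by blast

lemma normalizer_conj:
  assumes "V \<in> normalizer \<A> \<B>\<^sub>\<iota>" "X \<in> carrier \<B>"
  obtains Y where "Y \<in> carrier \<B>" "V \<otimes>\<^bsub>\<A>\<^esub> \<iota> X \<otimes>\<^bsub>\<A>\<^esub> V\<^sup>\<star>\<^bsub>\<A>\<^esub> = \<iota> Y"
proof -
  have "V \<otimes>\<^bsub>\<A>\<^esub> \<iota> X \<otimes>\<^bsub>\<A>\<^esub> V\<^sup>\<star>\<^bsub>\<A>\<^esub> \<in> \<B>\<^sub>\<iota>"
    using assms unfolding normalizer_def by blast
  then show ?thesis using that by blast
qed

lemma normalizer_star:
  assumes V: "V \<in> normalizer \<A> \<B>\<^sub>\<iota>"
  shows "V\<^sup>\<star>\<^bsub>\<A>\<^esub> \<in> normalizer \<A> \<B>\<^sub>\<iota>"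
proof -
  note u = A_unitary[OF normalizer_unitary[OF V]]
  have cancel: "V\<^sup>\<star>\<^bsub>\<A>\<^esub> \<otimes>\<^bsub>\<A>\<^esub> (V \<otimes>\<^bsub>\<A>\<^esub> X \<otimes>\<^bsub>\<A>\<^esub> V\<^sup>\<star>\<^bsub>\<A>\<^esub>) \<otimes>\<^bsub>\<A>\<^esub> V = X" if "X \<in> carrier \<A>" for X
  proof -
    have "V\<^sup>\<star>\<^bsub>\<A>\<^esub> \<otimes>\<^bsub>\<A>\<^esub> (V \<otimes>\<^bsub>\<A>\<^esub> X \<otimes>\<^bsub>\<A>\<^esub> V\<^sup>\<star>\<^bsub>\<A>\<^esub>) \<otimes>\<^bsub>\<A>\<^esub> V
      = (V\<^sup>\<star>\<^bsub>\<A>\<^esub> \<otimes>\<^bsub>\<A>\<^esub> V) \<otimes>\<^bsub>\<A>\<^esub> X \<otimes>\<^bsub>\<A>\<^esub> (V\<^sup>\<star>\<^bsub>\<A>\<^esub> \<otimes>\<^bsub>\<A>\<^esub> V)"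
      using that u(1) by (simp only: A.m_assoc A.m_closed A_closed)
    then show ?thesis
      using that u by simp
  qed
  have B: "\<B>\<^sub>\<iota> = (\<lambda>X. V \<otimes>\<^bsub>\<A>\<^esub> X \<otimes>\<^bsub>\<A>\<^esub> V\<^sup>\<star>\<^bsub>\<A>\<^esub>) ` \<B>\<^sub>\<iota>"
    using V by (simp add: normalizer_def)
  have "(\<lambda>X. V\<^sup>\<star>\<^bsub>\<A>\<^esub> \<otimes>\<^bsub>\<A>\<^esub> X \<otimes>\<^bsub>\<A>\<^esub> V) ` \<B>\<^sub>\<iota>
    = (\<lambda>X. V\<^sup>\<star>\<^bsub>\<A>\<^esub> \<otimes>\<^bsub>\<A>\<^esub> (V \<otimes>\<^bsub>\<A>\<^esub> X \<otimes>\<^bsub>\<A>\<^esub> V\<^sup>\<star>\<^bsub>\<A>\<^esub>) \<otimes>\<^bsub>\<A>\<^esub> V) ` \<B>\<^sub>\<iota>"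
    by (subst B) (simp only: image_image)
  also have "\<dots> = (\<lambda>X. X) ` \<B>\<^sub>\<iota>"
    by (rule image_cong) (use cancel \<iota>_hom(1) in auto)
  finally show ?thesis
    using u unfolding normalizer_def by simp
qed

lemma normalizer_mult_\<iota>:
  assumes V: "V \<in> normalizer \<A> \<B>\<^sub>\<iota>" and u: "u \<in> unitary_elements \<B>"
  shows "V \<otimes>\<^bsub>\<A>\<^esub> \<iota> u \<in> normalizer \<A> \<B>\<^sub>\<iota>"
proof -
  have u': "u \<in> carrier \<B>" "u\<^sup>\<star>\<^bsub>\<B>\<^esub> \<otimes>\<^bsub>\<B>\<^esub> u = \<one>\<^bsub>\<B>\<^esub>" "u \<otimes>\<^bsub>\<B>\<^esub> u\<^sup>\<star>\<^bsub>\<B>\<^esub> = \<one>\<^bsub>\<B>\<^esub>"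
    and u_star: "u\<^sup>\<star>\<^bsub>\<B>\<^esub> \<in> carrier \<B>"
    using u B_closed by (auto simp: unitary_elements_def)
  have v: "V \<in> carrier \<A>" and vv: "V\<^sup>\<star>\<^bsub>\<A>\<^esub> \<otimes>\<^bsub>\<A>\<^esub> V = \<one>\<^bsub>\<A>\<^esub>" "V \<otimes>\<^bsub>\<A>\<^esub> V\<^sup>\<star>\<^bsub>\<A>\<^esub> = \<one>\<^bsub>\<A>\<^esub>"
    using A_unitary[OF normalizer_unitary[OF V]] by auto
  have \<iota>u: "\<iota> u \<in> unitary_elements \<A>"
    using u' u_star unfolding unitary_elements_def
    by (simp add: \<iota>_hom(1) flip: \<iota>_hom(2,5,7))
  have "(\<lambda>X. u \<otimes>\<^bsub>\<B>\<^esub> X \<otimes>\<^bsub>\<B>\<^esub> u\<^sup>\<star>\<^bsub>\<B>\<^esub>) ` carrier \<B> = carrier \<B>"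
  proof
    show "carrier \<B> \<subseteq> (\<lambda>X. u \<otimes>\<^bsub>\<B>\<^esub> X \<otimes>\<^bsub>\<B>\<^esub> u\<^sup>\<star>\<^bsub>\<B>\<^esub>) ` carrier \<B>"
    proof
      fix X assume X: "X \<in> carrier \<B>"
      have "X = (u \<otimes>\<^bsub>\<B>\<^esub> u\<^sup>\<star>\<^bsub>\<B>\<^esub>) \<otimes>\<^bsub>\<B>\<^esub> X \<otimes>\<^bsub>\<B>\<^esub> (u \<otimes>\<^bsub>\<B>\<^esub> u\<^sup>\<star>\<^bsub>\<B>\<^esub>)"
        using X u' by simp
      also have "\<dots> = u \<otimes>\<^bsub>\<B>\<^esub> (u\<^sup>\<star>\<^bsub>\<B>\<^esub> \<otimes>\<^bsub>\<B>\<^esub> X \<otimes>\<^bsub>\<B>\<^esub> u) \<otimes>\<^bsub>\<B>\<^esub> u\<^sup>\<star>\<^bsub>\<B>\<^esub>"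
        using X u'(1) u_star by (simp only: B.m_assoc B.m_closed)
      finally show "X \<in> (\<lambda>X. u \<otimes>\<^bsub>\<B>\<^esub> X \<otimes>\<^bsub>\<B>\<^esub> u\<^sup>\<star>\<^bsub>\<B>\<^esub>) ` carrier \<B>"
        using X u'(1) u_star by (metis (no_types, lifting) B.m_closed image_eqI)
    qed
  qed (use u'(1) u_star in auto)
  then have "\<iota> ` (\<lambda>X. u \<otimes>\<^bsub>\<B>\<^esub> X \<otimes>\<^bsub>\<B>\<^esub> u\<^sup>\<star>\<^bsub>\<B>\<^esub>) ` carrier \<B> = \<B>\<^sub>\<iota>"
    by (simp only:)
  moreover have "\<iota> ` (\<lambda>X. u \<otimes>\<^bsub>\<B>\<^esub> X \<otimes>\<^bsub>\<B>\<^esub> u\<^sup>\<star>\<^bsub>\<B>\<^esub>) ` carrier \<B>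
    = (\<lambda>X. \<iota> u \<otimes>\<^bsub>\<A>\<^esub> X \<otimes>\<^bsub>\<A>\<^esub> (\<iota> u)\<^sup>\<star>\<^bsub>\<A>\<^esub>) ` \<B>\<^sub>\<iota>"
    unfolding image_image by (rule image_cong[OF refl]) (use u'(1) u_star in \<open>simp add: \<iota>_hom(2,5)\<close>)
  ultimately have \<iota>u_B: "(\<lambda>X. \<iota> u \<otimes>\<^bsub>\<A>\<^esub> X \<otimes>\<^bsub>\<A>\<^esub> (\<iota> u)\<^sup>\<star>\<^bsub>\<A>\<^esub>) ` \<B>\<^sub>\<iota> = \<B>\<^sub>\<iota>"
    by simp
  have \<iota>u_c: "\<iota> u \<in> carrier \<A>"
    using u'(1) by (rule \<iota>_hom(1))
  have "(\<lambda>X. (V \<otimes>\<^bsub>\<A>\<^esub> \<iota> u) \<otimes>\<^bsub>\<A>\<^esub> X \<otimes>\<^bsub>\<A>\<^esub> (V \<otimes>\<^bsub>\<A>\<^esub> \<iota> u)\<^sup>\<star>\<^bsub>\<A>\<^esub>) ` \<B>\<^sub>\<iota>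
    = (\<lambda>X. V \<otimes>\<^bsub>\<A>\<^esub> X \<otimes>\<^bsub>\<A>\<^esub> V\<^sup>\<star>\<^bsub>\<A>\<^esub>) ` (\<lambda>X. \<iota> u \<otimes>\<^bsub>\<A>\<^esub> X \<otimes>\<^bsub>\<A>\<^esub> (\<iota> u)\<^sup>\<star>\<^bsub>\<A>\<^esub>) ` \<B>\<^sub>\<iota>"
    unfolding image_image by (rule image_cong[OF refl]) (use v \<iota>u_c \<iota>_hom(1) in \<open>simp add: A.m_assoc\<close>)
  then have "(\<lambda>X. (V \<otimes>\<^bsub>\<A>\<^esub> \<iota> u) \<otimes>\<^bsub>\<A>\<^esub> X \<otimes>\<^bsub>\<A>\<^esub> (V \<otimes>\<^bsub>\<A>\<^esub> \<iota> u)\<^sup>\<star>\<^bsub>\<A>\<^esub>) ` \<B>\<^sub>\<iota> = \<B>\<^sub>\<iota>"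
    using V unfolding \<iota>u_B by (simp add: normalizer_def)
  moreover have "V \<otimes>\<^bsub>\<A>\<^esub> \<iota> u \<in> unitary_elements \<A>"
    using unitary_mult[of V s n "\<iota> u"] normalizer_unitary[OF V] \<iota>u by (simp add: \<A>_def)
  ultimately show ?thesis
    by (simp add: normalizer_def)
qed

lemma span_normalizer_submodule:
  "LinearCombinations.submodule class_ring (LinearCombinations.module.span class_ring \<A> (normalizer \<A> \<B>\<^sub>\<iota>)) \<A>"
proof -
  interpret M: Module.module class_ring \<A>
    unfolding \<A>_def by (rule multimatrix_module)
  show ?thesis
    by (rule M.span_is_submodule) (use normalizer_carrier in blast)
qed

lemma normalizer_subset_span:
  "normalizer \<A> \<B>\<^sub>\<iota> \<subseteq> LinearCombinations.module.span class_ring \<A> (normalizer \<A> \<B>\<^sub>\<iota>)"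
proof -
  interpret M: Module.module class_ring \<A>
    unfolding \<A>_def by (rule multimatrix_module)
  show ?thesis
    by (rule M.in_own_span) (use normalizer_carrier in blast)
qed

text \<open>The vanishing of one entry cuts out a submodule, which is proper because it misses the
  element with all entries \<open>1\<close>. It cannot contain the normalizer, whose span is
  everything.\<close>

lemma regular_inclusion_ex_normalizer:
  assumes "regular_inclusion \<A> \<B>\<^sub>\<iota>" "i < s" "P \<in> idx i" "Q \<in> idx i"
  obtains V where "V \<in> normalizer \<A> \<B>\<^sub>\<iota>" "ent V i P Q \<noteq> 0"
proof (rule ccontr)
  assume "\<not> thesis"
  then have zero: "ent V i P Q = 0" if "V \<in> normalizer \<A> \<B>\<^sub>\<iota>" for V
    using that \<open>\<And>V. \<lbrakk>V \<in> normalizer \<A> \<B>\<^sub>\<iota>; ent V i P Q \<noteq> 0\<rbrakk> \<Longrightarrow> thesis\<close> by blast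
  interpret M: Module.module class_ring \<A>
    unfolding \<A>_def by (rule multimatrix_module)
  define K where "K = {X \<in> carrier \<A>. ent X i P Q = 0}"
  have "LinearCombinations.submodule class_ring K \<A>"
    by (rule submodule.intro)
      (use assms in \<open>auto simp: K_def M.module_axioms ent_add ent_smult ent_zero\<close>)
  moreover have "normalizer \<A> \<B>\<^sub>\<iota> \<subseteq> K"
    using zero normalizer_carrier by (auto simp: K_def)
  ultimately have "LinearCombinations.module.span class_ring \<A> (normalizer \<A> \<B>\<^sub>\<iota>) \<subseteq> K"
    by (intro M.span_is_subset)
  then have "mk (\<lambda>_ _ _. 1) \<in> K"
    using assms(1) mk_closed[of "\<lambda>_ _ _. 1"] unfolding regular_inclusion_def by blast
  then show False
    using assms by (simp add: K_def ent_mk)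
qed

end

section \<open>The trace-preserving conditional expectation\<close>

locale multimatrix_expectation = multimatrix_inclusion +
  fixes E :: "(nat \<Rightarrow> complex mat) \<Rightarrow> (nat \<Rightarrow> complex mat)"
  assumes s_pos: "0 < s"
    and cond_exp: "conditional_expectation \<A> (\<iota> ` carrier \<B>) E"
    and trace_preserving: "\<And>X. X \<in> carrier \<A> \<Longrightarrow> tracial_state s n (E X) = tracial_state s n X"
begin

text \<open>The closed form of the expectation: the mean over all copies of the \<open>j\<close>-th
  summand of \<B> in \<A>, where a copy in summand \<open>i\<close> carries the weight
  \<open>n i\<close> coming from the tracial state.\<close>

definition avg :: "(nat \<Rightarrow> complex mat) \<Rightarrow> nat \<Rightarrow> nat \<Rightarrow> nat \<Rightarrow> complex" where
  "avg Y j x y = (\<Sum>i<s. of_nat (n i) * (\<Sum>c<a i j. ent Y i (j, x, c) (j, y, c))) / of_nat (weight j)"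

text \<open>The bimodule property and the invariance of the trace give equal traces for
  \<open>E Y\<close> and \<open>Y\<close> against every matrix unit of \<B>, and these traces
  determine an element of \<B>.\<close>

lemma E_eq:
  assumes Y: "Y \<in> carrier \<A>"
  obtains X where "X \<in> carrier \<B>" "E Y = \<iota> X"
    "\<And>j x y. \<lbrakk>j < r; x < m j; y < m j\<rbrakk> \<Longrightarrow> X j $$ (x, y) = avg Y j x y"
proof -
  obtain X where X: "X \<in> carrier \<B>" "E Y = \<iota> X"
    using cond_exp Y unfolding conditional_expectation_def by blast
  have entries: "X j $$ (x, y) = avg Y j x y" if j: "j < r" "x < m j" "y < m j" for j x y
  proof -
    let ?e = "\<iota> (unit j y x)"
    have bimod: "E (Z \<otimes>\<^bsub>\<A>\<^esub> Y \<otimes>\<^bsub>\<A>\<^esub> Z') = Z \<otimes>\<^bsub>\<A>\<^esub> E Y \<otimes>\<^bsub>\<A>\<^esub> Z'" if "Z \<in> \<B>\<^sub>\<iota>" "Z' \<in> \<B>\<^sub>\<iota>" for Z Z'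
      using cond_exp that Y unfolding conditional_expectation_def by blast
    \<comment> \<open>One-sided multiplication is the bimodule property with left factor
      \<open>1\<close>, which lies in the image because \<iota> is unital.\<close>
    have "\<one>\<^bsub>\<A>\<^esub> \<in> \<B>\<^sub>\<iota>"
      using \<iota>_hom(7) by (metis B.one_closed image_eqI)
    then have "E (Y \<otimes>\<^bsub>\<A>\<^esub> ?e) = \<iota> X \<otimes>\<^bsub>\<A>\<^esub> ?e"
      using bimod[of "\<one>\<^bsub>\<A>\<^esub>" ?e] Y X by (simp add: \<iota>_hom(1))
    then have "tracial_state s n (\<iota> X \<otimes>\<^bsub>\<A>\<^esub> ?e) = tracial_state s n (Y \<otimes>\<^bsub>\<A>\<^esub> ?e)"
      using trace_preserving[of "Y \<otimes>\<^bsub>\<A>\<^esub> ?e"] Y by (simp add: \<iota>_hom(1))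
    moreover have "(\<Sum>i<s. (n i)\<^sup>2) \<noteq> 0"
      using s_pos n_pos by (auto intro!: bexI[of _ 0])
    ultimately have "(\<Sum>i<s. of_nat (n i) * mat_trace ((\<iota> X \<otimes>\<^bsub>\<A>\<^esub> ?e) i))
      = (\<Sum>i<s. of_nat (n i) * mat_trace ((Y \<otimes>\<^bsub>\<A>\<^esub> ?e) i))"
      unfolding tracial_state_def by (metis (no_types, lifting) divide_eq_0_iff mult_left_cancel of_nat_eq_0_iff one_neq_zero)
    moreover have "mat_trace ((Y \<otimes>\<^bsub>\<A>\<^esub> ?e) i) = (\<Sum>c<a i j. ent Y i (j, x, c) (j, y, c))"
      "mat_trace ((\<iota> X \<otimes>\<^bsub>\<A>\<^esub> ?e) i) = of_nat (a i j) * X j $$ (x, y)" if "i < s" for i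
      using that j X Y by (simp_all add: mat_trace_mult_unit \<iota>_hom(1) ent_\<iota>)
    ultimately have "(\<Sum>i<s. of_nat (n i) * (of_nat (a i j) * X j $$ (x, y)))
      = (\<Sum>i<s. of_nat (n i) * (\<Sum>c<a i j. ent Y i (j, x, c) (j, y, c)))"
      by simp
    moreover have "(\<Sum>i<s. of_nat (n i) * (of_nat (a i j) * X j $$ (x, y))) = of_nat (weight j) * X j $$ (x, y)"
      by (simp add: weight_def sum_distrib_right mult.assoc)
    ultimately show ?thesis
      using weight_pos[OF j(1)] by (simp add: avg_def field_simps)
  qed
  show ?thesis
    by (rule that[OF X]) (rule entries)
qed

lemma E_closed: "Y \<in> carrier \<A> \<Longrightarrow> E Y \<in> carrier \<A>"
  using E_eq \<iota>_hom(1) by metis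

lemma ent_E:
  assumes "Y \<in> carrier \<A>" "i < s" "(j, x, c) \<in> idx i" "(j', x', c') \<in> idx i"
  shows "ent (E Y) i (j, x, c) (j', x', c') = (if j = j' \<and> c = c' then avg Y j x x' else 0)"
  using E_eq[OF assms(1)] ent_\<iota>[OF _ assms(2-4)] assms(3,4) by (smt (verit) idx_iff)

lemma ent_mult_E:
  assumes "Z \<in> carrier \<A>" "Y \<in> carrier \<A>" "i < s" "P \<in> idx i" "(j, x, c) \<in> idx i"
  shows "ent (Z \<otimes>\<^bsub>\<A>\<^esub> E Y) i P (j, x, c) = (\<Sum>y<m j. ent Z i P (j, y, c) * avg Y j y x)"
proof -
  obtain X where X: "X \<in> carrier \<B>" "E Y = \<iota> X"
    "\<And>j x y. \<lbrakk>j < r; x < m j; y < m j\<rbrakk> \<Longrightarrow> X j $$ (x, y) = avg Y j x y"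
    using E_eq[OF assms(2)] by blast
  show ?thesis
    unfolding X(2) ent_mult_\<iota>[OF assms(1) X(1) assms(3-5)]
    by (rule sum.cong) (use assms X(3) in auto)
qed

section \<open>What a normalizing unitary basis implies\<close>

lemma basis_imp_regular:
  assumes "has_unitary_orthonormal_basis_in_normalizer \<A> \<B>\<^sub>\<iota> E"
  shows "regular_inclusion \<A> \<B>\<^sub>\<iota>"
proof -
  interpret M: Module.module class_ring \<A>
    unfolding \<A>_def by (rule multimatrix_module)
  let ?S = "LinearCombinations.module.span class_ring \<A> (normalizer \<A> \<B>\<^sub>\<iota>)"
  interpret S: LinearCombinations.submodule class_ring ?S \<A>
    by (rule span_normalizer_submodule)
  obtain d W where basis: "unitary_orthonormal_basis \<A> E d W" and W: "\<And>w. w < d \<Longrightarrow> W w \<in> normalizer \<A> \<B>\<^sub>\<iota>"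
    using assms unfolding has_unitary_orthonormal_basis_in_normalizer_def by blast
  have mult: "V \<otimes>\<^bsub>\<A>\<^esub> \<iota> X \<in> ?S" if V: "V \<in> normalizer \<A> \<B>\<^sub>\<iota>" and X: "X \<in> carrier \<B>" for V X
  proof (rule multimatrix_unitary_induct[of X r m "\<lambda>X. V \<otimes>\<^bsub>\<A>\<^esub> \<iota> X \<in> ?S", folded \<B>_def, OF X])
    fix u assume "u \<in> unitary_elements \<B>"
    then show "V \<otimes>\<^bsub>\<A>\<^esub> \<iota> u \<in> ?S"
      using normalizer_mult_\<iota>[OF V] normalizer_subset_span by blast
  next
    fix X Y assume "X \<in> carrier \<B>" "Y \<in> carrier \<B>" "V \<otimes>\<^bsub>\<A>\<^esub> \<iota> X \<in> ?S" "V \<otimes>\<^bsub>\<A>\<^esub> \<iota> Y \<in> ?S"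
    then show "V \<otimes>\<^bsub>\<A>\<^esub> \<iota> (X \<oplus>\<^bsub>\<B>\<^esub> Y) \<in> ?S"
      using normalizer_carrier[OF V] by (simp add: \<iota>_hom(1,3) A.r_distr)
  next
    fix c X assume "X \<in> carrier \<B>" "V \<otimes>\<^bsub>\<A>\<^esub> \<iota> X \<in> ?S"
    then show "V \<otimes>\<^bsub>\<A>\<^esub> \<iota> (c \<odot>\<^bsub>\<B>\<^esub> X) \<in> ?S"
      using normalizer_carrier[OF V] by (simp add: \<iota>_hom(1,4) smult_mult)
  qed
  have sums: "finsum \<A> f J \<in> ?S" if "finite J" "\<And>l. l \<in> J \<Longrightarrow> f l \<in> ?S" for f :: "nat \<Rightarrow> _" and J
    using that
  proof (induction J rule: finite_induct)
    case (insert l J)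
    then have "f \<in> J \<rightarrow> carrier \<A>" "f l \<in> carrier \<A>"
      using S.subset by blast+
    with insert show ?case by simp
  qed simp
  have "X \<in> ?S" if X: "X \<in> carrier \<A>" for X
  proof -
    have "W w \<otimes>\<^bsub>\<A>\<^esub> E ((W w)\<^sup>\<star>\<^bsub>\<A>\<^esub> \<otimes>\<^bsub>\<A>\<^esub> X) \<in> ?S" if "w < d" for w
    proof -
      have "(W w)\<^sup>\<star>\<^bsub>\<A>\<^esub> \<otimes>\<^bsub>\<A>\<^esub> X \<in> carrier \<A>"
        using X normalizer_carrier[OF W[OF that]] by simp
      then show ?thesis
        using E_eq mult[OF W[OF that]] by metis
    qed
    then have "(\<Oplus>\<^bsub>\<A>\<^esub> w \<in> {..<d}. W w \<otimes>\<^bsub>\<A>\<^esub> E ((W w)\<^sup>\<star>\<^bsub>\<A>\<^esub> \<otimes>\<^bsub>\<A>\<^esub> X)) \<in> ?S"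
      by (intro sums) auto
    moreover have "X = (\<Oplus>\<^bsub>\<A>\<^esub> w \<in> {..<d}. W w \<otimes>\<^bsub>\<A>\<^esub> E ((W w)\<^sup>\<star>\<^bsub>\<A>\<^esub> \<otimes>\<^bsub>\<A>\<^esub> X))"
      using basis X unfolding unitary_orthonormal_basis_def by blast
    ultimately show ?thesis
      by (simp only:)
  qed
  then show ?thesis
    using S.subset unfolding regular_inclusion_def by blast
qed

text \<open>Expand the matrix unit \<open>e\<close> at \<open>(p, q)\<close> of the \<open>i\<close>-th summand of \<open>\<A>\<close> in the basis, where \<open>q\<close>
  is a column belonging to the \<open>j\<close>-th summand of \<open>\<B>\<close>. Its coefficient at \<open>(p, q)\<close> is
  \<open>n i / weight j\<close> times the sum of \<open>(cmod (W w p q'))\<^sup>2\<close> over \<open>w < d\<close> and over \<open>m j\<close> columns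
  \<open>q'\<close>; summing over the rows \<open>p\<close> gives \<open>weight j = d * m j\<close>, as the \<open>W w\<close> are unitary.\<close>

lemma basis_imp_spectral:
  assumes "has_unitary_orthonormal_basis_in_normalizer \<A> \<B>\<^sub>\<iota> E"
  shows "spectral_condition r m s n \<Lambda>"
proof -
  obtain d W where basis: "unitary_orthonormal_basis \<A> E d W"
    using assms unfolding has_unitary_orthonormal_basis_in_normalizer_def by blast
  then have W: "W w \<in> carrier \<A>" "(W w)\<^sup>\<star>\<^bsub>\<A>\<^esub> \<otimes>\<^bsub>\<A>\<^esub> W w = \<one>\<^bsub>\<A>\<^esub>" if "w < d" for w
    using that unfolding unitary_orthonormal_basis_def unitary_elements_def by blast+
  have "weight j = d * m j" if j: "j < r" for j
  proof -
    obtain i where i: "i < s" "0 < a i j"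
      using ex_multiplicity_pos[OF j] by blast
    define q where "q = (j, 0::nat, 0::nat)"
    have q: "q \<in> idx i"
      using i j m_pos by (simp add: q_def)
    have row: "of_nat (weight j)
      = (\<Sum>w<d. \<Sum>x<m j. of_nat (n i) * (cnj (ent (W w) i p (j, x, 0)) * ent (W w) i p (j, x, 0)))"
      if p: "p \<in> idx i" for p
    proof -
      define e where "e = mk (\<lambda>i' P Q. if i' = i \<and> P = p \<and> Q = q then 1 else 0)"
      have e: "e \<in> carrier \<A>"
        by (simp add: e_def)
      have We: "ent ((W w)\<^sup>\<star>\<^bsub>\<A>\<^esub> \<otimes>\<^bsub>\<A>\<^esub> e) i' P Q = (if i' = i \<and> Q = q then cnj (ent (W w) i p P) else 0)"
        if "w < d" "i' < s" "P \<in> idx i'" "Q \<in> idx i'" for w i' P Q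
      proof -
        have "ent ((W w)\<^sup>\<star>\<^bsub>\<A>\<^esub> \<otimes>\<^bsub>\<A>\<^esub> e) i' P Q = (\<Sum>R\<in>idx i'. cnj (ent (W w) i' R P) * ent e i' R Q)"
          using that W e by (simp add: ent_mult ent_star)
        also have "\<dots> = (\<Sum>R\<in>idx i'. if R = p then (if i' = i \<and> Q = q then cnj (ent (W w) i p P) else 0) else 0)"
          by (rule sum.cong) (use that in \<open>auto simp: e_def ent_mk\<close>)
        also have "\<dots> = (if i' = i \<and> Q = q then cnj (ent (W w) i p P) else 0)"
          using p by auto
        finally show ?thesis .
      qed
      have avg: "avg ((W w)\<^sup>\<star>\<^bsub>\<A>\<^esub> \<otimes>\<^bsub>\<A>\<^esub> e) j x 0
        = of_nat (n i) * cnj (ent (W w) i p (j, x, 0)) / of_nat (weight j)" if w: "w < d" and x: "x < m j" for w x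
      proof -
        have "(\<Sum>c<a i' j. ent ((W w)\<^sup>\<star>\<^bsub>\<A>\<^esub> \<otimes>\<^bsub>\<A>\<^esub> e) i' (j, x, c) (j, 0, c))
          = (if i' = i then cnj (ent (W w) i p (j, x, 0)) else 0)" if "i' < s" for i'
        proof -
          have "(\<Sum>c<a i' j. ent ((W w)\<^sup>\<star>\<^bsub>\<A>\<^esub> \<otimes>\<^bsub>\<A>\<^esub> e) i' (j, x, c) (j, 0, c))
            = (\<Sum>c<a i' j. if c = 0 then (if i' = i then cnj (ent (W w) i p (j, x, 0)) else 0) else 0)"
            using w x j m_pos that by (intro sum.cong) (auto simp: We q_def)
          then show ?thesis using i by auto
        qed
        then show ?thesis
          using i(1) by (simp add: avg_def if_distrib[of "\<lambda>z. _ * z"] cong: if_cong)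
      qed
      have "e = (\<Oplus>\<^bsub>\<A>\<^esub> w \<in> {..<d}. W w \<otimes>\<^bsub>\<A>\<^esub> E ((W w)\<^sup>\<star>\<^bsub>\<A>\<^esub> \<otimes>\<^bsub>\<A>\<^esub> e))"
        using basis e unfolding unitary_orthonormal_basis_def by blast
      then have "ent e i p q = ent (\<Oplus>\<^bsub>\<A>\<^esub> w \<in> {..<d}. W w \<otimes>\<^bsub>\<A>\<^esub> E ((W w)\<^sup>\<star>\<^bsub>\<A>\<^esub> \<otimes>\<^bsub>\<A>\<^esub> e)) i p q"
        by (simp only:)
      also have "\<dots> = (\<Sum>w<d. ent (W w \<otimes>\<^bsub>\<A>\<^esub> E ((W w)\<^sup>\<star>\<^bsub>\<A>\<^esub> \<otimes>\<^bsub>\<A>\<^esub> e)) i p q)"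
        by (rule ent_finsum) (use W e i p q E_closed in auto)
      also have "\<dots> = (\<Sum>w<d. \<Sum>x<m j. ent (W w) i p (j, x, 0) * avg ((W w)\<^sup>\<star>\<^bsub>\<A>\<^esub> \<otimes>\<^bsub>\<A>\<^esub> e) j x 0)"
        using W e i p q unfolding q_def by (intro sum.cong ent_mult_E) auto
      also have "\<dots> = (\<Sum>w<d. \<Sum>x<m j. of_nat (n i) * (cnj (ent (W w) i p (j, x, 0)) * ent (W w) i p (j, x, 0)))
          / of_nat (weight j)"
        by (simp add: avg sum_divide_distrib mult_ac)
      finally show ?thesis
        using weight_pos[OF j] i(1) p q by (simp add: e_def ent_mk field_simps)
    qed
    have unitary: "(\<Sum>p\<in>idx i. cnj (ent (W w) i p (j, x, 0)) * ent (W w) i p (j, x, 0)) = 1"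
      if w: "w < d" and x: "x < m j" for w x
    proof -
      have P: "(j, x, 0) \<in> idx i" using x i j by simp
      have "ent ((W w)\<^sup>\<star>\<^bsub>\<A>\<^esub> \<otimes>\<^bsub>\<A>\<^esub> W w) i (j, x, 0) (j, x, 0)
        = (\<Sum>p\<in>idx i. cnj (ent (W w) i p (j, x, 0)) * ent (W w) i p (j, x, 0))"
        using W(1)[OF w] i P by (simp add: ent_mult ent_star del: idx_iff)
      then show ?thesis
        using W[OF w] i P by (simp add: ent_one del: idx_iff)
    qed
    \<comment> \<open>The factor \<open>n i\<close> occurs on both sides and cancels: on the left as
      the number of rows, on the right as the weight in the trace.\<close>
    have "of_nat (card (idx i) * weight j) = (\<Sum>p\<in>idx i. of_nat (weight j) :: complex)"
      by simp
    also have "\<dots> = (\<Sum>p\<in>idx i. \<Sum>w<d. \<Sum>x<m j. of_nat (n i) * (cnj (ent (W w) i p (j, x, 0)) * ent (W w) i p (j, x, 0)))"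
      using row by (intro sum.cong) auto
    also have "\<dots> = (\<Sum>w<d. \<Sum>x<m j. of_nat (n i) * (\<Sum>p\<in>idx i. cnj (ent (W w) i p (j, x, 0)) * ent (W w) i p (j, x, 0)))"
      unfolding sum_distrib_left by (subst sum.swap, subst (2) sum.swap) simp
    also have "\<dots> = of_nat (n i * (d * m j))"
      by (simp add: unitary)
    finally have "card (idx i) * weight j = n i * (d * m j)"
      using of_nat_eq_iff by blast
    moreover have "card (idx i) = n i"
      using bij_betw_same_card[OF enc_bij[OF i(1)]] by simp
    ultimately show ?thesis
      using n_pos[OF i(1)] by simp
  qed
  then show ?thesis
    unfolding spectral_condition_iff by blast
qed

end

section \<open>Regularity and equal columns of the inclusion matrix\<close>

lemma index_matrix_unit_mult:
  assumes "X \<in> carrier (multimatrix_algebra k d)" "l < k" "p < d l" "q < d l" "x < d j" "y < d j"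
  shows "(matrix_unit k d j x y \<otimes>\<^bsub>multimatrix_algebra k d\<^esub> X) l $$ (p, q)
      = (if l = j \<and> p = x then X l $$ (y, q) else 0)"
    and "(X \<otimes>\<^bsub>multimatrix_algebra k d\<^esub> matrix_unit k d j x y) l $$ (p, q)
      = (if l = j \<and> q = y then X l $$ (p, x) else 0)"
proof -
  note dims = multimatrix_dims[OF assms(1,2)] multimatrix_dims[OF matrix_unit_closed assms(2)]
  have "(matrix_unit k d j x y \<otimes>\<^bsub>multimatrix_algebra k d\<^esub> X) l $$ (p, q)
    = (\<Sum>z<d l. matrix_unit k d j x y l $$ (p, z) * X l $$ (z, q))"
    using assms dims by (simp add: multimatrix_apply scalar_prod_def atLeast0LessThan)
  also have "\<dots> = (\<Sum>z<d l. if z = y then (if l = j \<and> p = x then X l $$ (y, q) else 0) else 0)"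
    using assms by (intro sum.cong) (auto simp: index_matrix_unit)
  finally show "(matrix_unit k d j x y \<otimes>\<^bsub>multimatrix_algebra k d\<^esub> X) l $$ (p, q)
      = (if l = j \<and> p = x then X l $$ (y, q) else 0)"
    using assms by auto
  have "(X \<otimes>\<^bsub>multimatrix_algebra k d\<^esub> matrix_unit k d j x y) l $$ (p, q)
    = (\<Sum>z<d l. X l $$ (p, z) * matrix_unit k d j x y l $$ (z, q))"
    using assms dims by (simp add: multimatrix_apply scalar_prod_def atLeast0LessThan)
  also have "\<dots> = (\<Sum>z<d l. if z = x then (if l = j \<and> q = y then X l $$ (p, x) else 0) else 0)"
    using assms by (intro sum.cong) (auto simp: index_matrix_unit)
  finally show "(X \<otimes>\<^bsub>multimatrix_algebra k d\<^esub> matrix_unit k d j x y) l $$ (p, q)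
      = (if l = j \<and> q = y then X l $$ (p, x) else 0)"
    using assms by auto
qed

text \<open>A central projection, used to compare sizes of summands in the way that rank one
  projections are used to compare multiplicities.\<close>

definition central_unit :: "nat \<Rightarrow> (nat \<Rightarrow> nat) \<Rightarrow> nat \<Rightarrow> nat \<Rightarrow> complex mat" where
  "central_unit k d j = (\<lambda>l\<in>{..<k}. if l = j then 1\<^sub>m (d l) else 0\<^sub>m (d l) (d l))"

lemma central_unit_closed: "central_unit k d j \<in> carrier (multimatrix_algebra k d)"
  unfolding multimatrix_simps central_unit_def by auto

lemma central_unit_commute:
  assumes "X \<in> carrier (multimatrix_algebra k d)"
  shows "central_unit k d j \<otimes>\<^bsub>multimatrix_algebra k d\<^esub> X = X \<otimes>\<^bsub>multimatrix_algebra k d\<^esub> central_unit k d j"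
proof (rule multimatrix_ext[of _ k d])
  fix l assume l: "l < k"
  note dims = multimatrix_dims[OF assms l]
  show "(central_unit k d j \<otimes>\<^bsub>multimatrix_algebra k d\<^esub> X) l = (X \<otimes>\<^bsub>multimatrix_algebra k d\<^esub> central_unit k d j) l"
    unfolding multimatrix_apply(1)[OF l] central_unit_def using l left_mult_one_mat[OF dims(1)]
      right_mult_one_mat[OF dims(1)] left_mult_zero_mat[OF dims(1)] right_mult_zero_mat[OF dims(1)]
    by (cases "l = j") simp_all
qed (use assms central_unit_closed multimatrix_closed in auto)

lemma central_unit_projection:
  "central_unit k d j \<otimes>\<^bsub>multimatrix_algebra k d\<^esub> central_unit k d j = central_unit k d j"
  "(central_unit k d j)\<^sup>\<star>\<^bsub>multimatrix_algebra k d\<^esub> = central_unit k d j"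
proof -
  have l: "central_unit k d j l = (if l = j then 1\<^sub>m (d l) else 0\<^sub>m (d l) (d l))" if "l < k" for l
    using that by (simp add: central_unit_def)
  show "central_unit k d j \<otimes>\<^bsub>multimatrix_algebra k d\<^esub> central_unit k d j = central_unit k d j"
  proof (rule multimatrix_ext[of _ k d])
    fix i assume "i < k"
    then show "(central_unit k d j \<otimes>\<^bsub>multimatrix_algebra k d\<^esub> central_unit k d j) i = central_unit k d j i"
      by (cases "i = j") (simp_all add: multimatrix_apply l)
  qed (simp_all add: central_unit_closed multimatrix_closed)
  show "(central_unit k d j)\<^sup>\<star>\<^bsub>multimatrix_algebra k d\<^esub> = central_unit k d j"
  proof (rule multimatrix_eqI[of _ k d])
    fix i p q assume "i < k" "p < d i" "q < d i"
    then show "((central_unit k d j)\<^sup>\<star>\<^bsub>multimatrix_algebra k d\<^esub>) i $$ (p, q) = central_unit k d j i $$ (p, q)"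
      by (cases "i = j") (simp_all add: multimatrix_apply l)
  qed (simp_all add: central_unit_closed multimatrix_closed)
qed

context multimatrix_inclusion
begin

lemmas index_unit_mult = index_matrix_unit_mult[where k = r and d = m, folded \<B>_def]

lemma index_B_mult:
  assumes "X \<in> carrier \<B>" "Y \<in> carrier \<B>" "l < r" "p < m l" "q < m l"
  shows "(X \<otimes>\<^bsub>\<B>\<^esub> Y) l $$ (p, q) = (\<Sum>z<m l. X l $$ (p, z) * Y l $$ (z, q))"
  using assms B_dims[OF assms(1,3)] B_dims[OF assms(2,3)]
  by (simp add: multimatrix_apply[where k = r and d = m, folded \<B>_def] scalar_prod_def atLeast0LessThan)

lemma mat_trace_\<iota>:
  assumes "X \<in> carrier \<B>" "i < s"
  shows "mat_trace (\<iota> X i) = (\<Sum>j<r. of_nat (a i j) * (\<Sum>x<m j. X j $$ (x, x)))"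
proof -
  have "mat_trace (\<iota> X i) = (\<Sum>j<r. \<Sum>x<m j. \<Sum>c<a i j. ent (\<iota> X) i (j, x, c) (j, x, c))"
    using assms by (simp add: mat_trace_ent \<iota>_hom(1) sum_idx)
  also have "\<dots> = (\<Sum>j<r. \<Sum>x<m j. \<Sum>c<a i j. X j $$ (x, x))"
    using assms by (intro sum.cong) (auto simp: ent_\<iota>)
  finally show ?thesis
    by (simp add: sum_distrib_left)
qed

lemma mat_trace_conj:
  assumes "V \<in> unitary_elements \<A>" "Y \<in> carrier \<A>" "i < s"
  shows "mat_trace ((V \<otimes>\<^bsub>\<A>\<^esub> Y \<otimes>\<^bsub>\<A>\<^esub> V\<^sup>\<star>\<^bsub>\<A>\<^esub>) i) = mat_trace (Y i)"
proof -
  note v = A_unitary[OF assms(1)]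
  have dims: "X \<in> carrier \<A> \<Longrightarrow> X i \<in> carrier_mat (n i) (n i)" for X
    using assms(3) multimatrix_dims unfolding \<A>_def by blast
  have "mat_trace ((V \<otimes>\<^bsub>\<A>\<^esub> Y \<otimes>\<^bsub>\<A>\<^esub> V\<^sup>\<star>\<^bsub>\<A>\<^esub>) i) = mat_trace ((V\<^sup>\<star>\<^bsub>\<A>\<^esub> \<otimes>\<^bsub>\<A>\<^esub> (V \<otimes>\<^bsub>\<A>\<^esub> Y)) i)"
    unfolding A_apply(1)[OF assms(3), of "V \<otimes>\<^bsub>\<A>\<^esub> Y"] A_apply(1)[OF assms(3), of _ "V \<otimes>\<^bsub>\<A>\<^esub> Y"]
    by (rule mat_trace_mult_comm[OF dims dims]) (use assms v in simp_all)
  also have "V\<^sup>\<star>\<^bsub>\<A>\<^esub> \<otimes>\<^bsub>\<A>\<^esub> (V \<otimes>\<^bsub>\<A>\<^esub> Y) = Y"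
    using assms v by (simp flip: A.m_assoc)
  finally show ?thesis .
qed

lemma conj_mult:
  assumes "V \<in> unitary_elements \<A>" "X \<in> carrier \<B>" "Y \<in> carrier \<B>"
  shows "(V \<otimes>\<^bsub>\<A>\<^esub> \<iota> X \<otimes>\<^bsub>\<A>\<^esub> V\<^sup>\<star>\<^bsub>\<A>\<^esub>) \<otimes>\<^bsub>\<A>\<^esub> (V \<otimes>\<^bsub>\<A>\<^esub> \<iota> Y \<otimes>\<^bsub>\<A>\<^esub> V\<^sup>\<star>\<^bsub>\<A>\<^esub>) = V \<otimes>\<^bsub>\<A>\<^esub> \<iota> (X \<otimes>\<^bsub>\<B>\<^esub> Y) \<otimes>\<^bsub>\<A>\<^esub> V\<^sup>\<star>\<^bsub>\<A>\<^esub>"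
proof -
  note v = A_unitary[OF assms(1)]
  note c = v(1) \<iota>_hom(1)[OF assms(2)] \<iota>_hom(1)[OF assms(3)]
  have "(V \<otimes>\<^bsub>\<A>\<^esub> \<iota> X \<otimes>\<^bsub>\<A>\<^esub> V\<^sup>\<star>\<^bsub>\<A>\<^esub>) \<otimes>\<^bsub>\<A>\<^esub> (V \<otimes>\<^bsub>\<A>\<^esub> \<iota> Y \<otimes>\<^bsub>\<A>\<^esub> V\<^sup>\<star>\<^bsub>\<A>\<^esub>)
    = V \<otimes>\<^bsub>\<A>\<^esub> \<iota> X \<otimes>\<^bsub>\<A>\<^esub> (V\<^sup>\<star>\<^bsub>\<A>\<^esub> \<otimes>\<^bsub>\<A>\<^esub> V) \<otimes>\<^bsub>\<A>\<^esub> \<iota> Y \<otimes>\<^bsub>\<A>\<^esub> V\<^sup>\<star>\<^bsub>\<A>\<^esub>"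
    using c by (simp only: A.m_assoc A.m_closed A_closed)
  also have "\<dots> = V \<otimes>\<^bsub>\<A>\<^esub> (\<iota> X \<otimes>\<^bsub>\<A>\<^esub> \<iota> Y) \<otimes>\<^bsub>\<A>\<^esub> V\<^sup>\<star>\<^bsub>\<A>\<^esub>"
    using c v by (simp add: A.m_assoc)
  finally show ?thesis
    using assms by (simp add: \<iota>_hom(2))
qed

lemma normalizer_preimage:
  assumes "V \<in> normalizer \<A> \<B>\<^sub>\<iota>" "X \<in> carrier \<B>"
  obtains Y where "Y \<in> carrier \<B>" "\<iota> X = V \<otimes>\<^bsub>\<A>\<^esub> \<iota> Y \<otimes>\<^bsub>\<A>\<^esub> V\<^sup>\<star>\<^bsub>\<A>\<^esub>"
proof -
  have "\<iota> X \<in> (\<lambda>X. V \<otimes>\<^bsub>\<A>\<^esub> X \<otimes>\<^bsub>\<A>\<^esub> V\<^sup>\<star>\<^bsub>\<A>\<^esub>) ` \<B>\<^sub>\<iota>"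
    using assms unfolding normalizer_def by simp
  then show ?thesis using that by blast
qed

text \<open>For a projection \<open>p\<close>, the conjugate of \<open>\<iota> p\<close> by
  \<open>V\<close> is the product of \<open>V \<otimes> \<iota> p\<close> with its own adjoint. Its
  diagonal is therefore nonnegative, and a nonzero entry of \<open>V \<otimes> \<iota> p\<close>
  makes a diagonal entry nonzero.\<close>

lemma conj_projection_diag:
  assumes "V \<in> carrier \<A>" "p \<in> carrier \<B>" "p \<otimes>\<^bsub>\<B>\<^esub> p = p" "p\<^sup>\<star>\<^bsub>\<B>\<^esub> = p" "i < s" "P \<in> idx i"
  shows "ent (V \<otimes>\<^bsub>\<A>\<^esub> \<iota> p \<otimes>\<^bsub>\<A>\<^esub> V\<^sup>\<star>\<^bsub>\<A>\<^esub>) i P P = of_real (\<Sum>R\<in>idx i. (cmod (ent (V \<otimes>\<^bsub>\<A>\<^esub> \<iota> p) i P R))\<^sup>2)"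
proof -
  note c = assms(1) \<iota>_hom(1)[OF assms(2)]
  have "(\<iota> p)\<^sup>\<star>\<^bsub>\<A>\<^esub> = \<iota> p" "\<iota> p \<otimes>\<^bsub>\<A>\<^esub> \<iota> p = \<iota> p"
    using assms \<iota>_hom(2,5)[OF assms(2)] by metis+
  have "(V \<otimes>\<^bsub>\<A>\<^esub> \<iota> p) \<otimes>\<^bsub>\<A>\<^esub> (V \<otimes>\<^bsub>\<A>\<^esub> \<iota> p)\<^sup>\<star>\<^bsub>\<A>\<^esub> = V \<otimes>\<^bsub>\<A>\<^esub> (\<iota> p \<otimes>\<^bsub>\<A>\<^esub> \<iota> p) \<otimes>\<^bsub>\<A>\<^esub> V\<^sup>\<star>\<^bsub>\<A>\<^esub>"
    using c \<open>(\<iota> p)\<^sup>\<star>\<^bsub>\<A>\<^esub> = \<iota> p\<close> by (simp add: A.m_assoc)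
  also have "\<dots> = V \<otimes>\<^bsub>\<A>\<^esub> \<iota> p \<otimes>\<^bsub>\<A>\<^esub> V\<^sup>\<star>\<^bsub>\<A>\<^esub>"
    using \<open>\<iota> p \<otimes>\<^bsub>\<A>\<^esub> \<iota> p = \<iota> p\<close> by simp
  finally have eq: "V \<otimes>\<^bsub>\<A>\<^esub> \<iota> p \<otimes>\<^bsub>\<A>\<^esub> V\<^sup>\<star>\<^bsub>\<A>\<^esub> = (V \<otimes>\<^bsub>\<A>\<^esub> \<iota> p) \<otimes>\<^bsub>\<A>\<^esub> (V \<otimes>\<^bsub>\<A>\<^esub> \<iota> p)\<^sup>\<star>\<^bsub>\<A>\<^esub>" by simp
  have Vp: "V \<otimes>\<^bsub>\<A>\<^esub> \<iota> p \<in> carrier \<A>" using c by simp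
  show ?thesis
    unfolding eq ent_mult[OF Vp A_closed(2)[OF Vp] assms(5,6,6)] of_real_sum
    by (rule sum.cong[OF refl]) (simp only: ent_star[OF Vp assms(5) _ assms(6)] complex_norm_square)
qed

text \<open>A normalizing unitary whose compression to the corner between the central summands \<open>j\<close> and
  \<open>k\<close> does not vanish maps a rank one projection of the \<open>j\<close>-th summand to one of the \<open>k\<close>-th;
  comparing traces in each summand of \<open>\<A>\<close> shows that the multiplicities agree.\<close>

lemma normalizer_multiplicity_eq:
  assumes V: "V \<in> normalizer \<A> \<B>\<^sub>\<iota>" and i: "i < s" and j: "(j, 0, 0) \<in> idx i" and k: "(k, 0, 0) \<in> idx i"
    and nz: "ent V i (k, 0, 0) (j, 0, 0) \<noteq> 0" and l: "l < s"
  shows "a l j = a l k"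
proof -
  note v = A_unitary[OF normalizer_unitary[OF V]]
  let ?T = "\<lambda>X. V \<otimes>\<^bsub>\<A>\<^esub> \<iota> X \<otimes>\<^bsub>\<A>\<^esub> V\<^sup>\<star>\<^bsub>\<A>\<^esub>"
  let ?e = "unit j 0 0" and ?f = "unit k 0 0"
  have jk: "j < r" "0 < m j" "k < r" "0 < m k"
    using j k by auto
  have e: "?e \<otimes>\<^bsub>\<B>\<^esub> ?e = ?e" "?e\<^sup>\<star>\<^bsub>\<B>\<^esub> = ?e"
    by (rule multimatrix_eqI[of _ r m, folded \<B>_def];
        use jk in \<open>auto simp: B_closed index_unit index_unit_mult
          multimatrix_apply(6)[where k = r and d = m, folded \<B>_def] B_dims[OF unit_closed]\<close>)+
  obtain Y where Y: "Y \<in> carrier \<B>" "?T ?e = \<iota> Y"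
    by (rule normalizer_conj[OF V unit_closed])
  have "\<iota> (Y \<otimes>\<^bsub>\<B>\<^esub> Y) = \<iota> Y"
    using conj_mult[OF normalizer_unitary[OF V], of ?e ?e] e Y by (simp add: \<iota>_hom(2))
  then have idem: "Y \<otimes>\<^bsub>\<B>\<^esub> Y = Y"
    using Y by (simp add: \<iota>_hom(6))
  \<comment> \<open>The entry \<open>g\<close> is nonzero: it is a diagonal entry of the conjugated
    projection, hence a sum of squares that contains the given nonzero entry of
    \<open>V\<close>.\<close>
  define g where "g = Y k $$ (0, 0)"
  have "ent (V \<otimes>\<^bsub>\<A>\<^esub> \<iota> ?e) i (k, 0, 0) (j, 0, 0) = (\<Sum>y<m j. ent V i (k, 0, 0) (j, y, 0) * ?e j $$ (y, 0))"
    using v i j k by (intro ent_mult_\<iota>) auto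
  also have "\<dots> = (\<Sum>y<m j. if y = 0 then ent V i (k, 0, 0) (j, 0, 0) else 0)"
    using jk by (intro sum.cong) (auto simp: index_unit)
  finally have "ent (V \<otimes>\<^bsub>\<A>\<^esub> \<iota> ?e) i (k, 0, 0) (j, 0, 0) \<noteq> 0"
    using nz jk by simp
  then have "0 < (\<Sum>R\<in>idx i. (cmod (ent (V \<otimes>\<^bsub>\<A>\<^esub> \<iota> ?e) i (k, 0, 0) R))\<^sup>2)"
    using j by (intro sum_pos2[of _ "(j, 0, 0)"]) auto
  moreover have "g = ent (?T ?e) i (k, 0, 0) (k, 0, 0)"
    unfolding Y(2) g_def using Y(1) i k by (simp add: ent_\<iota>)
  ultimately have g: "g \<noteq> 0"
    using conj_projection_diag[OF v(1) unit_closed e i k] by (simp add: of_real_eq_0_iff flip: of_real_sum)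
  obtain F where F: "F \<in> carrier \<B>" "\<iota> ?f = ?T F"
    by (rule normalizer_preimage[OF V unit_closed])
  define c where "c = F j $$ (0, 0)"
  \<comment> \<open>Compressing by a rank one projection leaves only a scalar. Conjugated by
    \<open>V\<close>, this says that \<open>Y\<close> compresses the matrix unit \<open>?f\<close>
    to \<open>c\<close> times \<open>Y\<close>, which confines the diagonal of \<open>Y\<close> to
    summand \<open>k\<close> once \<open>c\<close> is known to be nonzero.\<close>
  have "?e \<otimes>\<^bsub>\<B>\<^esub> F \<otimes>\<^bsub>\<B>\<^esub> ?e = c \<odot>\<^bsub>\<B>\<^esub> ?e"
    by (rule multimatrix_eqI[of _ r m, folded \<B>_def])
      (use jk F in \<open>auto simp: B_closed index_unit index_unit_mult c_def
          multimatrix_apply(5)[where k = r and d = m, folded \<B>_def] B_dims[OF unit_closed]\<close>)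
  then have "\<iota> (Y \<otimes>\<^bsub>\<B>\<^esub> ?f \<otimes>\<^bsub>\<B>\<^esub> Y) = ?T (c \<odot>\<^bsub>\<B>\<^esub> ?e)"
    using Y F conj_mult[OF normalizer_unitary[OF V], of ?e F]
      conj_mult[OF normalizer_unitary[OF V], of "?e \<otimes>\<^bsub>\<B>\<^esub> F" ?e]
    by (simp add: \<iota>_hom(2) flip: Y(2))
  also have "\<dots> = \<iota> (c \<odot>\<^bsub>\<B>\<^esub> Y)"
    using v Y by (simp add: \<iota>_hom(1,4) smult_mult)
  finally have YfY: "Y \<otimes>\<^bsub>\<B>\<^esub> ?f \<otimes>\<^bsub>\<B>\<^esub> Y = c \<odot>\<^bsub>\<B>\<^esub> Y"
    using Y by (simp add: \<iota>_hom(6) B_closed)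
  have entry: "c * Y q $$ (x, y) = (if q = k then Y k $$ (x, 0) * Y k $$ (0, y) else 0)"
    if q: "q < r" "x < m q" "y < m q" for q x y
  proof -
    have "c * Y q $$ (x, y) = (Y \<otimes>\<^bsub>\<B>\<^esub> ?f \<otimes>\<^bsub>\<B>\<^esub> Y) q $$ (x, y)"
      unfolding YfY using q Y(1)
      by (simp add: multimatrix_apply(5)[where k = r and d = m, folded \<B>_def] B_dims)
    also have "\<dots> = (\<Sum>z<m q. (Y \<otimes>\<^bsub>\<B>\<^esub> ?f) q $$ (x, z) * Y q $$ (z, y))"
      using q Y(1) by (intro index_B_mult) auto
    also have "\<dots> = (\<Sum>z<m q. if z = 0 then (if q = k then Y k $$ (x, 0) * Y k $$ (0, y) else 0) else 0)"
      using q Y(1) jk by (intro sum.cong) (auto simp: index_unit_mult)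
    also have "\<dots> = (if q = k then Y k $$ (x, 0) * Y k $$ (0, y) else 0)"
      using jk by auto
    finally show ?thesis .
  qed
  have "c = g"
    using entry[of k 0 0] jk g by (simp add: g_def)
  then have zero: "Y q $$ (x, x) = 0" if "q < r" "x < m q" "q \<noteq> k" for q x
    using entry[of q x x] that g by simp
  \<comment> \<open>The entries of \<open>Y\<close> in summand \<open>k\<close> factor through its
    first row and column, so \<open>g\<close> times the trace is the \<open>(0, 0)\<close> entry of
    the square of \<open>Y\<close>, which is \<open>g\<close> again.\<close>
  have "g * (\<Sum>x<m k. Y k $$ (x, x)) = (\<Sum>x<m k. Y k $$ (0, x) * Y k $$ (x, 0))"
    unfolding sum_distrib_left using entry[of k] jk \<open>c = g\<close> by (intro sum.cong) (auto simp: mult.commute)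
  also have "\<dots> = g"
    using index_B_mult[OF Y(1) Y(1), of k 0 0] jk by (simp add: idem g_def)
  finally have trace: "(\<Sum>x<m k. Y k $$ (x, x)) = 1"
    using g by simp
  \<comment> \<open>Conjugate projections have the same trace in every summand of \<A>; before
    conjugation it counts the copies of \<open>j\<close>, afterwards those of
    \<open>k\<close>.\<close>
  have "mat_trace (\<iota> ?e l) = (\<Sum>q<r. if q = j then of_nat (a l j) else 0)"
    unfolding mat_trace_\<iota>[OF unit_closed l]
  proof (intro sum.cong refl)
    fix q assume "q \<in> {..<r}"
    then have "(\<Sum>x<m q. ?e q $$ (x, x)) = (\<Sum>x<m q. if x = 0 then (if q = j then 1 else 0) else 0)"
      by (intro sum.cong) (auto simp: index_unit)
    then show "of_nat (a l q) * (\<Sum>x<m q. ?e q $$ (x, x)) = (if q = j then of_nat (a l j) else 0)"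
      using jk by auto
  qed
  also have "\<dots> = of_nat (a l j)"
    using jk by simp
  finally have "of_nat (a l j) = mat_trace (\<iota> Y l)"
    using mat_trace_conj[OF normalizer_unitary[OF V] \<iota>_hom(1)[OF unit_closed] l, of j 0 0] Y by simp
  also have "\<dots> = (\<Sum>q<r. if q = k then of_nat (a l k) else 0)"
    unfolding mat_trace_\<iota>[OF Y(1) l] using zero trace by (intro sum.cong) auto
  also have "\<dots> = of_nat (a l k)"
    using jk by simp
  finally show ?thesis
    using of_nat_eq_iff by blast
qed

text \<open>Conjugation by \<open>V\<close> carries the central projection of summand
  \<open>j\<close> to a central projection that does not vanish on summand \<open>k\<close>, hence
  is the identity there. Its trace in the \<open>i\<close>-th summand of \<A> is then at least the
  dimension occupied by \<open>k\<close>. The reverse inequality comes from the adjoint of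
  \<open>V\<close>.\<close>

lemma normalizer_dimension_le:
  assumes V: "V \<in> normalizer \<A> \<B>\<^sub>\<iota>" and i: "i < s" and j: "(j, 0, 0) \<in> idx i" and k: "(k, 0, 0) \<in> idx i"
    and nz: "ent V i (k, 0, 0) (j, 0, 0) \<noteq> 0"
  shows "a i k * m k \<le> a i j * m j"
proof -
  note v = A_unitary[OF normalizer_unitary[OF V]]
  let ?T = "\<lambda>X. V \<otimes>\<^bsub>\<A>\<^esub> \<iota> X \<otimes>\<^bsub>\<A>\<^esub> V\<^sup>\<star>\<^bsub>\<A>\<^esub>"
  let ?p = "central_unit r m j"
  have jk: "j < r" "0 < m j" "k < r" "0 < m k"
    using j k by auto
  have p: "?p \<in> carrier \<B>" "?p \<otimes>\<^bsub>\<B>\<^esub> ?p = ?p" "?p\<^sup>\<star>\<^bsub>\<B>\<^esub> = ?p"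
    unfolding \<B>_def by (rule central_unit_closed central_unit_projection)+
  have p_entry: "?p q $$ (x, y) = (if q = j \<and> x = y then 1 else 0)" if "q < r" "x < m q" "y < m q" for q x y
    using that by (auto simp: central_unit_def)
  obtain Z where Z: "Z \<in> carrier \<B>" "?T ?p = \<iota> Z"
    by (rule normalizer_conj[OF V p(1)])
  have "\<iota> (Z \<otimes>\<^bsub>\<B>\<^esub> Z) = \<iota> Z"
    using conj_mult[OF normalizer_unitary[OF V], of ?p ?p] p Z by (simp add: \<iota>_hom(2))
  then have idem: "Z \<otimes>\<^bsub>\<B>\<^esub> Z = Z"
    using Z by (simp add: \<iota>_hom(6))
  \<comment> \<open>Conjugation by \<open>V\<close> maps \<B> onto itself, so every \<open>X\<close>
    is a conjugate and the center goes to the center.\<close>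
  have central: "Z \<otimes>\<^bsub>\<B>\<^esub> X = X \<otimes>\<^bsub>\<B>\<^esub> Z" if X: "X \<in> carrier \<B>" for X
  proof -
    obtain F where F: "F \<in> carrier \<B>" "\<iota> X = ?T F"
      by (rule normalizer_preimage[OF V X])
    have "\<iota> (Z \<otimes>\<^bsub>\<B>\<^esub> X) = ?T (?p \<otimes>\<^bsub>\<B>\<^esub> F)"
      using conj_mult[OF normalizer_unitary[OF V] p(1) F(1)] X Z by (simp add: \<iota>_hom(2) flip: F(2))
    also have "?p \<otimes>\<^bsub>\<B>\<^esub> F = F \<otimes>\<^bsub>\<B>\<^esub> ?p"
      using F(1) unfolding \<B>_def by (rule central_unit_commute)
    also have "?T (F \<otimes>\<^bsub>\<B>\<^esub> ?p) = \<iota> (X \<otimes>\<^bsub>\<B>\<^esub> Z)"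
      using conj_mult[OF normalizer_unitary[OF V] F(1) p(1)] X Z by (simp add: \<iota>_hom(2) flip: F(2))
    finally show ?thesis
      using X Z by (simp add: \<iota>_hom(6))
  qed
  \<comment> \<open>Commuting with the matrix units of the first row makes the diagonal constant and
    clears the rest of that row; idempotence then leaves only the values \<open>0\<close> and
    \<open>1\<close>.\<close>
  have diag: "Z k $$ (y, y) = Z k $$ (0, 0)" if "y < m k" for y
    using arg_cong[OF central[OF unit_closed, of k 0 y], of "\<lambda>X. X k $$ (0, y)"] that jk Z(1)
    by (simp add: index_unit_mult)
  have off: "Z k $$ (0, y) = 0" if "y < m k" "y \<noteq> 0" for y
    using arg_cong[OF central[OF unit_closed, of k 0 0], of "\<lambda>X. X k $$ (0, y)"] that jk Z(1)
    by (simp add: index_unit_mult)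
  have "Z k $$ (0, 0) = (\<Sum>y<m k. Z k $$ (0, y) * Z k $$ (y, 0))"
    using index_B_mult[OF Z(1) Z(1), of k 0 0] jk by (simp add: idem)
  also have "\<dots> = (\<Sum>y<m k. if y = 0 then Z k $$ (0, 0) * Z k $$ (0, 0) else 0)"
    using off by (intro sum.cong) auto
  finally have sq: "Z k $$ (0, 0) = Z k $$ (0, 0) * Z k $$ (0, 0)"
    using jk by simp
  have Z_diag: "Z q $$ (x, x) = of_real (\<Sum>R\<in>idx i. (cmod (ent (V \<otimes>\<^bsub>\<A>\<^esub> \<iota> ?p) i (q, x, 0) R))\<^sup>2)"
    if "(q, x, 0) \<in> idx i" for q x
    unfolding conj_projection_diag[OF v(1) p i that, symmetric] Z(2)
    using that i Z(1) by (simp add: ent_\<iota>)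
  have "ent (V \<otimes>\<^bsub>\<A>\<^esub> \<iota> ?p) i (k, 0, 0) (j, 0, 0) = (\<Sum>y<m j. ent V i (k, 0, 0) (j, y, 0) * ?p j $$ (y, 0))"
    using v i j k p by (intro ent_mult_\<iota>) auto
  also have "\<dots> = (\<Sum>y<m j. if y = 0 then ent V i (k, 0, 0) (j, 0, 0) else 0)"
    using jk by (intro sum.cong) (auto simp: p_entry)
  finally have "ent (V \<otimes>\<^bsub>\<A>\<^esub> \<iota> ?p) i (k, 0, 0) (j, 0, 0) \<noteq> 0"
    using nz jk by simp
  then have "0 < (\<Sum>R\<in>idx i. (cmod (ent (V \<otimes>\<^bsub>\<A>\<^esub> \<iota> ?p) i (k, 0, 0) R))\<^sup>2)"
    using j by (intro sum_pos2[of _ "(j, 0, 0)"]) auto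
  then have "Z k $$ (0, 0) \<noteq> 0"
    using Z_diag[OF k] by (simp add: of_real_eq_0_iff flip: of_real_sum)
  then have one: "Z k $$ (y, y) = 1" if "y < m k" for y
    using sq diag[OF that] by simp
  \<comment> \<open>If \<open>a i q = 0\<close>, the \<open>i\<close>-th summand of \<A> has no
    coordinate showing the block \<open>Z q\<close>, but then the factor \<open>a i q\<close>
    removes its contribution.\<close>
  have nonneg: "0 \<le> real (a i q) * (\<Sum>x<m q. Re (Z q $$ (x, x)))" if "q < r" for q
  proof (cases "a i q = 0")
    case False
    then have "0 \<le> Re (Z q $$ (x, x))" if "x < m q" for x
      using Z_diag[of q x] that \<open>q < r\<close> by (simp add: sum_nonneg)
    then show ?thesis
      by (intro mult_nonneg_nonneg sum_nonneg) auto
  qed simp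
  have "real (a i k * m k) = real (a i k) * (\<Sum>x<m k. Re (Z k $$ (x, x)))"
    using one by simp
  also have "\<dots> \<le> (\<Sum>q<r. real (a i q) * (\<Sum>x<m q. Re (Z q $$ (x, x))))"
    using nonneg jk by (intro member_le_sum[of k "{..<r}" "\<lambda>q. real (a i q) * (\<Sum>x<m q. Re (Z q $$ (x, x)))"]) auto
  also have "\<dots> = Re (mat_trace (\<iota> Z i))"
    unfolding mat_trace_\<iota>[OF Z(1) i] by simp
  also have "mat_trace (\<iota> Z i) = mat_trace (\<iota> ?p i)"
    using mat_trace_conj[OF normalizer_unitary[OF V] \<iota>_hom(1)[OF p(1)] i] Z by simp
  also have "mat_trace (\<iota> ?p i) = (\<Sum>q<r. if q = j then of_nat (a i j * m j) else 0)"
    unfolding mat_trace_\<iota>[OF p(1) i] by (intro sum.cong) (auto simp: p_entry)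
  also have "Re \<dots> = real (a i j * m j)"
    using jk by simp
  finally show ?thesis
    by (simp only: of_nat_le_iff)
qed

text \<open>The two inequalities for \<open>V\<close> and its adjoint give
  \<open>a i k * m k = a i j * m j\<close>; the common positive multiplicity then cancels.\<close>

lemma regular_imp_homogeneous:
  assumes "regular_inclusion \<A> \<B>\<^sub>\<iota>" "i < s" "j < r" "k < r" "0 < a i j" "0 < a i k"
  shows "m j = m k" "\<And>l. l < s \<Longrightarrow> a l j = a l k"
proof -
  have idx: "(j, 0, 0) \<in> idx i" "(k, 0, 0) \<in> idx i"
    using assms m_pos by auto
  obtain V where V: "V \<in> normalizer \<A> \<B>\<^sub>\<iota>" "ent V i (k, 0, 0) (j, 0, 0) \<noteq> 0"
    by (rule regular_inclusion_ex_normalizer[OF assms(1,2) idx(2,1)])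
  have "ent (V\<^sup>\<star>\<^bsub>\<A>\<^esub>) i (j, 0, 0) (k, 0, 0) \<noteq> 0"
    using V normalizer_carrier assms(2) idx by (simp add: ent_star del: idx_iff)
  then have "a i k * m k = a i j * m j"
    using normalizer_dimension_le[OF V(1) assms(2) idx V(2)]
      normalizer_dimension_le[OF normalizer_star[OF V(1)] assms(2) idx(2,1)] by simp
  moreover show "a l j = a l k" if "l < s" for l
    using normalizer_multiplicity_eq[OF V(1) assms(2) idx V(2) that] .
  ultimately show "m j = m k"
    using assms by simp
qed

text \<open>With a single summand in \<B> the condition is one equation, solved by the sum of the
  squared multiplicities. With a single summand in \<A> all summands of \<B> meet there, so sizes
  and multiplicities are constant and \<open>d = r * a 0 0 * a 0 0\<close>.\<close>

lemma spectral_condition_of_matrix_algebra: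
  assumes "regular_inclusion \<A> \<B>\<^sub>\<iota>" "r = 1 \<or> s = 1" "0 < r"
  shows "spectral_condition r m s n \<Lambda>"
proof (cases "r = 1")
  case True
  then have "n i = m 0 * a i 0" if "i < s" for i
    using n_eq[OF that] by simp
  then have "weight 0 = (\<Sum>i<s. a i 0 * a i 0 * m 0)"
    unfolding weight_def by (intro sum.cong) auto
  then have "\<forall>j<r. weight j = (\<Sum>i<s. a i 0 * a i 0) * m j"
    using True by (simp add: sum_distrib_right)
  then show ?thesis
    unfolding spectral_condition_iff by blast
next
  case False
  then have s: "s = 1" using assms by simp
  have pos: "0 < a 0 j" if "j < r" for j
    using ex_multiplicity_pos[OF that] s by simp
  have eq: "m j = m 0" "a 0 j = a 0 0" if "j < r" for j
    using regular_imp_homogeneous[OF assms(1), of 0 j 0] that pos s assms by auto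
  have "n 0 = (\<Sum>j<r. m 0 * a 0 0)"
    using n_eq[of 0] s eq by (metis (no_types, lifting) lessThan_iff less_one sum.cong)
  moreover have "weight j = n 0 * a 0 j" for j
    unfolding weight_def using s by simp
  ultimately have "weight j = (r * a 0 0 * a 0 0) * m j" if "j < r" for j
    using eq(1)[OF that] eq(2)[OF that] by simp
  then show ?thesis
    unfolding spectral_condition_iff by blast
qed

end

section \<open>Fourier unitaries\<close>

definition root_of_unity :: "nat \<Rightarrow> complex" where
  "root_of_unity k = cis (2 * pi / real k)"

lemma root_of_unity_cnj: "root_of_unity k ^ x * cnj (root_of_unity k ^ x) = 1"
  by (simp add: root_of_unity_def DeMoivre cis_cnj cis_mult)

lemma root_of_unity_cnj': "cnj (root_of_unity k ^ x) * root_of_unity k ^ x = 1"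
  using root_of_unity_cnj[of k x] by (simp only: mult.commute)

text \<open>For \<open>x \<noteq> y\<close> this is a geometric sum whose ratio is a
  \<open>k\<close>-th root of unity different from \<open>1\<close>.\<close>

lemma root_of_unity_orthogonal:
  assumes "x < k" "y < k"
  shows "(\<Sum>g<k. root_of_unity k ^ (g * x) * cnj (root_of_unity k ^ (g * y))) = (if x = y then of_nat k else 0)"
proof (cases "x = y")
  case False
  let ?z = "root_of_unity k ^ x * cnj (root_of_unity k ^ y)"
  have cis: "root_of_unity k ^ x = cis (2 * pi * real x / real k)" for x
    by (simp add: root_of_unity_def DeMoivre mult_ac)
  have "inj_on (\<lambda>x. cis (2 * pi * real x / real k)) {..<k}"
    using bij_betw_roots_unity[of k] assms by (auto simp: bij_betw_def)
  then have "root_of_unity k ^ x \<noteq> root_of_unity k ^ y"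
    unfolding cis using False assms by (auto simp: inj_on_def)
  moreover have "root_of_unity k ^ x = ?z * root_of_unity k ^ y"
    by (simp only: mult.assoc root_of_unity_cnj' mult_1_right)
  ultimately have "?z \<noteq> 1"
    by (metis mult_1)
  have one: "root_of_unity k ^ k = 1"
    using assms cis[of k] by simp
  have "(root_of_unity k ^ x) ^ k = 1" for x
  proof -
    have "(root_of_unity k ^ x) ^ k = (root_of_unity k ^ k) ^ x"
      by (simp only: power_mult[symmetric] mult.commute)
    then show ?thesis by (simp only: one power_one)
  qed
  then have "?z ^ k = 1"
    by (simp only: power_mult_distrib complex_cnj_power[symmetric] complex_cnj_one mult_1_left)
  have "(\<Sum>g<k. root_of_unity k ^ (g * x) * cnj (root_of_unity k ^ (g * y))) = (\<Sum>g<k. ?z ^ g)"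
    by (intro sum.cong) (simp_all add: power_mult_distrib power_mult[symmetric] mult.commute)
  also have "\<dots> = 0"
    unfolding sum_gp_strict \<open>?z ^ k = 1\<close> using \<open>?z \<noteq> 1\<close> by simp
  finally show ?thesis
    using False by simp
next
  case True
  then show ?thesis
    by (simp add: root_of_unity_cnj del: complex_cnj_power)
qed

lemma sum_offset3:
  fixes u v :: "nat \<Rightarrow> nat"
  shows "(\<Sum>j<r. \<Sum>x<u j. \<Sum>y<v j. f ((\<Sum>k<j. u k * v k) + (x * v j + y))) = (\<Sum>e<(\<Sum>k<r. u k * v k). f e)"
proof -
  have "(\<Sum>j<r. \<Sum>x<u j. \<Sum>y<v j. f ((\<Sum>k<j. u k * v k) + (x * v j + y)))
    = (\<Sum>(j, x, y)\<in>(SIGMA j:{..<r}. {..<u j} \<times> {..<v j}). f ((\<Sum>k<j. u k * v k) + (x * v j + y)))"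
    unfolding sum.cartesian_product by (subst sum.Sigma) (auto simp: split_def)
  also have "\<dots> = (\<Sum>e<(\<Sum>k<r. u k * v k). f e)"
    using sum.reindex_bij_betw[OF bij_betw_offset3[of u v r], of f] by (simp add: split_def)
  finally show ?thesis .
qed

text \<open>Products of a diagonal unitary, a Fourier matrix and a diagonal unitary. The exponents
  \<open>fourier_index\<close> enumerate all matrix positions of all summands of \<open>\<Oplus>\<^sub>i M\<^bsub>v i\<^esub>\<close>, so that the
  orthogonality relations reduce to those of the characters of a cyclic group.\<close>

definition fourier_index :: "(nat \<Rightarrow> nat) \<Rightarrow> nat \<Rightarrow> nat \<Rightarrow> nat \<Rightarrow> nat" where
  "fourier_index v i b c = (\<Sum>l<i. v l * v l) + (b * v i + c)"

definition fourier_unitary :: "nat \<Rightarrow> (nat \<Rightarrow> nat) \<Rightarrow> nat \<Rightarrow> nat \<Rightarrow> nat \<Rightarrow> nat \<Rightarrow> complex" where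
  "fourier_unitary s v g i b c = root_of_unity (\<Sum>l<s. v l * v l) ^ (g * fourier_index v i b c)
     * root_of_unity (v i) ^ (b * c) / of_real (sqrt (real (v i)))"

text \<open>The parameter \<open>v\<close> will be a column of \<Lambda>, and columns of one class
  are known to agree only at row numbers below \<open>s\<close>.\<close>

lemma fourier_unitary_cong:
  assumes "\<And>l. l < s \<Longrightarrow> v l = v' l" "i < s"
  shows "fourier_unitary s v g i b c = fourier_unitary s v' g i b c"
proof -
  have "(\<Sum>l<s. v l * v l) = (\<Sum>l<s. v' l * v' l)" "(\<Sum>l<i. v l * v l) = (\<Sum>l<i. v' l * v' l)" "v i = v' i"
    using assms by (auto intro!: sum.cong)
  then show ?thesis
    by (simp add: fourier_unitary_def fourier_index_def)
qed

lemma fourier_unitary_mult: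
  assumes "v i = v i'"
  shows "fourier_unitary s v g i b c * cnj (fourier_unitary s v g' i' b' c')
    = root_of_unity (\<Sum>l<s. v l * v l) ^ (g * fourier_index v i b c)
      * cnj (root_of_unity (\<Sum>l<s. v l * v l) ^ (g' * fourier_index v i' b' c'))
      * (root_of_unity (v i) ^ (b * c) * cnj (root_of_unity (v i) ^ (b' * c'))) / of_nat (v i)"
proof -
  have "complex_of_real (sqrt (real (v i))) * complex_of_real (sqrt (real (v i))) = of_nat (v i)"
    by (simp flip: of_real_mult)
  then show ?thesis
    using assms by (simp add: fourier_unitary_def flip: times_divide_times_eq)
qed

text \<open>The position number is a part depending on \<open>b\<close> plus \<open>c\<close>. The
  phase from \<open>c\<close> cancels against its conjugate and the phases from \<open>b\<close> and
  \<open>b'\<close> leave the sum, so orthogonality of the rows of the Fourier matrix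
  remains.\<close>

lemma fourier_unitary_rows:
  assumes "b < v i" "b' < v i"
  shows "(\<Sum>c<v i. fourier_unitary s v g i b c * cnj (fourier_unitary s v g i b' c)) = (if b = b' then 1 else 0)"
proof -
  let ?z = "root_of_unity (\<Sum>l<s. v l * v l)"
  define e where "e b = (\<Sum>l<i. v l * v l) + b * v i" for b
  have "(\<Sum>c<v i. fourier_unitary s v g i b c * cnj (fourier_unitary s v g i b' c))
    = (\<Sum>c<v i. ?z ^ (g * e b) * cnj (?z ^ (g * e b'))
        * (root_of_unity (v i) ^ (c * b) * cnj (root_of_unity (v i) ^ (c * b'))) / of_nat (v i))"
  proof (rule sum.cong[OF refl])
    fix c
    have "fourier_index v i b c = e b + c" for b
      by (simp add: fourier_index_def e_def)
    then have "?z ^ (g * fourier_index v i b c) * cnj (?z ^ (g * fourier_index v i b' c))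
      = ?z ^ (g * e b) * cnj (?z ^ (g * e b')) * (?z ^ (g * c) * cnj (?z ^ (g * c)))"
      by (simp only: distrib_left power_add complex_cnj_mult mult_ac)
    also have "?z ^ (g * c) * cnj (?z ^ (g * c)) = 1"
      by (rule root_of_unity_cnj)
    finally show "fourier_unitary s v g i b c * cnj (fourier_unitary s v g i b' c)
      = ?z ^ (g * e b) * cnj (?z ^ (g * e b'))
        * (root_of_unity (v i) ^ (c * b) * cnj (root_of_unity (v i) ^ (c * b'))) / of_nat (v i)"
      unfolding fourier_unitary_mult[of v i i, OF refl] by (simp only: mult_1_right mult.commute[of _ c])
  qed
  also have "\<dots> = ?z ^ (g * e b) * cnj (?z ^ (g * e b'))
    * (\<Sum>c<v i. root_of_unity (v i) ^ (c * b) * cnj (root_of_unity (v i) ^ (c * b'))) / of_nat (v i)"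
    by (simp only: sum_distrib_left sum_divide_distrib)
  also have "\<dots> = (if b = b' then 1 else 0)"
    unfolding root_of_unity_orthogonal[OF assms] using assms root_of_unity_cnj[of _ "g * e b"] by auto
  finally show ?thesis .
qed

text \<open>As for the rows, with the row part of the phase cancelling and the column part leaving
  the sum.\<close>

lemma fourier_unitary_columns:
  assumes "c < v i" "c' < v i"
  shows "(\<Sum>b<v i. fourier_unitary s v g i b c * cnj (fourier_unitary s v g i b c')) = (if c = c' then 1 else 0)"
proof -
  let ?z = "root_of_unity (\<Sum>l<s. v l * v l)"
  define e where "e b = (\<Sum>l<i. v l * v l) + b * v i" for b
  have "(\<Sum>b<v i. fourier_unitary s v g i b c * cnj (fourier_unitary s v g i b c'))
    = (\<Sum>b<v i. ?z ^ (g * c) * cnj (?z ^ (g * c'))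
        * (root_of_unity (v i) ^ (b * c) * cnj (root_of_unity (v i) ^ (b * c'))) / of_nat (v i))"
  proof (rule sum.cong[OF refl])
    fix b
    have "fourier_index v i b c = e b + c" for c
      by (simp add: fourier_index_def e_def)
    then have "?z ^ (g * fourier_index v i b c) * cnj (?z ^ (g * fourier_index v i b c'))
      = ?z ^ (g * c) * cnj (?z ^ (g * c')) * (?z ^ (g * e b) * cnj (?z ^ (g * e b)))"
      by (simp only: distrib_left power_add complex_cnj_mult mult_ac)
    also have "?z ^ (g * e b) * cnj (?z ^ (g * e b)) = 1"
      by (rule root_of_unity_cnj)
    finally show "fourier_unitary s v g i b c * cnj (fourier_unitary s v g i b c')
      = ?z ^ (g * c) * cnj (?z ^ (g * c'))
        * (root_of_unity (v i) ^ (b * c) * cnj (root_of_unity (v i) ^ (b * c'))) / of_nat (v i)"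
      unfolding fourier_unitary_mult[of v i i, OF refl] by (simp only: mult_1_right)
  qed
  also have "\<dots> = ?z ^ (g * c) * cnj (?z ^ (g * c'))
    * (\<Sum>b<v i. root_of_unity (v i) ^ (b * c) * cnj (root_of_unity (v i) ^ (b * c'))) / of_nat (v i)"
    by (simp only: sum_distrib_left sum_divide_distrib)
  also have "\<dots> = (if c = c' then 1 else 0)"
    unfolding root_of_unity_orthogonal[OF assms] using assms root_of_unity_cnj[of _ "g * c"] by auto
  finally show ?thesis .
qed

lemma fourier_index_bij:
  "bij_betw (\<lambda>(i, b, c). fourier_index v i b c) (SIGMA i:{..<s}. {..<v i} \<times> {..<v i}) {..<\<Sum>l<s. v l * v l}"
  unfolding fourier_index_def by (rule bij_betw_offset3)

text \<open>Only the phase depends on \<open>g\<close>, and distinct positions have distinct numbers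
  below the group order, so the sum over \<open>g\<close> is character orthogonality. On equal
  positions the remaining factor is the squared modulus \<open>1 / v i\<close>.\<close>

lemma fourier_unitary_complete:
  assumes "i < s" "b < v i" "c < v i" "i' < s" "b' < v i'" "c' < v i'"
  shows "(\<Sum>g<(\<Sum>l<s. v l * v l). fourier_unitary s v g i b c * cnj (fourier_unitary s v g i' b' c'))
    = (if i = i' \<and> b = b' \<and> c = c' then of_nat (\<Sum>l<s. v l * v l) / of_nat (v i) else 0)"
proof -
  let ?D = "\<Sum>l<s. v l * v l"
  let ?I = "SIGMA i:{..<s}. {..<v i} \<times> {..<v i}"
  have I: "(i, b, c) \<in> ?I" "(i', b', c') \<in> ?I"
    using assms by auto
  have less: "fourier_index v i b c < ?D" "fourier_index v i' b' c' < ?D"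
    using bij_betwE[OF fourier_index_bij[of v s]] I by (force, force)
  have eq: "fourier_index v i b c = fourier_index v i' b' c' \<longleftrightarrow> i = i' \<and> b = b' \<and> c = c'"
    using inj_on_eq_iff[OF bij_betw_imp_inj_on[OF fourier_index_bij[of v s]] I] by simp
  define K where "K = root_of_unity (v i) ^ (b * c) / of_real (sqrt (real (v i)))
    * cnj (root_of_unity (v i') ^ (b' * c') / of_real (sqrt (real (v i'))))"
  have "(\<Sum>g<?D. fourier_unitary s v g i b c * cnj (fourier_unitary s v g i' b' c'))
    = (\<Sum>g<?D. root_of_unity ?D ^ (g * fourier_index v i b c) * cnj (root_of_unity ?D ^ (g * fourier_index v i' b' c')) * K)"
    by (simp add: fourier_unitary_def K_def mult_ac)
  also have "\<dots> = (if fourier_index v i b c = fourier_index v i' b' c' then of_nat ?D else 0) * K"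
    by (simp only: root_of_unity_orthogonal[OF less] flip: sum_distrib_right)
  also have "\<dots> = (if i = i' \<and> b = b' \<and> c = c' then of_nat ?D / of_nat (v i) else 0)"
  proof (cases "i = i' \<and> b = b' \<and> c = c'")
    case True
    have "complex_of_real (sqrt (real (v i))) * complex_of_real (sqrt (real (v i))) = of_nat (v i)"
      by (simp flip: of_real_mult)
    then have "K = 1 / of_nat (v i)"
      using True root_of_unity_cnj[of "v i" "b * c"] by (simp add: K_def)
    then show ?thesis
      using True by simp
  qed (auto simp: eq)
  finally show ?thesis .
qed

text \<open>The weight \<open>v i\<close> cancels the squared modulus \<open>1 / v i\<close>, so
  each position contributes a pure phase. The position numbers run once through the whole cyclic
  group, which gives character orthogonality in the other variable.\<close>

lemma fourier_unitary_orthogonal: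
  assumes "g < (\<Sum>l<s. v l * v l)" "g' < (\<Sum>l<s. v l * v l)"
  shows "(\<Sum>i<s. of_nat (v i) * (\<Sum>b<v i. \<Sum>c<v i. fourier_unitary s v g i b c * cnj (fourier_unitary s v g' i b c)))
    = (if g = g' then of_nat (\<Sum>l<s. v l * v l) else 0)"
proof -
  let ?D = "\<Sum>l<s. v l * v l"
  have "of_nat (v i) * (fourier_unitary s v g i b c * cnj (fourier_unitary s v g' i b c))
    = root_of_unity ?D ^ (fourier_index v i b c * g) * cnj (root_of_unity ?D ^ (fourier_index v i b c * g'))"
    if "b < v i" for i b c
    unfolding fourier_unitary_mult[of v i i, OF refl] root_of_unity_cnj
    using that by (simp add: mult.commute)
  then have "(\<Sum>i<s. of_nat (v i) * (\<Sum>b<v i. \<Sum>c<v i. fourier_unitary s v g i b c * cnj (fourier_unitary s v g' i b c)))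
    = (\<Sum>i<s. \<Sum>b<v i. \<Sum>c<v i. root_of_unity ?D ^ (fourier_index v i b c * g) * cnj (root_of_unity ?D ^ (fourier_index v i b c * g')))"
    by (simp add: sum_distrib_left)
  also have "\<dots> = (\<Sum>e<?D. root_of_unity ?D ^ (e * g) * cnj (root_of_unity ?D ^ (e * g')))"
    unfolding fourier_index_def by (rule sum_offset3)
  also have "\<dots> = (if g = g' then of_nat ?D else 0)"
    by (rule root_of_unity_orthogonal[OF assms])
  finally show ?thesis .
qed

text \<open>Division with remainder: for each quotient \<open>g\<close> exactly one \<open>w\<close>
  has residue \<open>t\<close>. Once a permutation is selected by its residue, this leaves a free
  sum over the Fourier index.\<close>

lemma sum_mod_eq:
  fixes f :: "nat \<Rightarrow> 'a::comm_monoid_add"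
  assumes "t < R"
  shows "(\<Sum>w<R * D. if w mod R = t then f (w div R) else 0) = (\<Sum>g<D. f g)"
proof -
  have bij: "bij_betw (\<lambda>(g, t). g * R + t) ({..<D} \<times> {..<R}) {..<R * D}"
    using bij_betw_sum_offset[of "\<lambda>_. R" D] by (simp add: mult.commute)
  have "(\<Sum>w<R * D. if w mod R = t then f (w div R) else 0)
    = (\<Sum>(g, t')\<in>{..<D} \<times> {..<R}. if (g * R + t') mod R = t then f ((g * R + t') div R) else 0)"
    using sum.reindex_bij_betw[OF bij, of "\<lambda>w. if w mod R = t then f (w div R) else 0", symmetric]
    by (simp only: split_def)
  also have "\<dots> = (\<Sum>(g, t')\<in>{..<D} \<times> {..<R}. if t' = t then f g else 0)"
    by (rule sum.cong) auto
  also have "\<dots> = (\<Sum>g<D. \<Sum>t'<R. if t' = t then f g else 0)"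
    by (simp only: sum.cartesian_product)
  finally show ?thesis
    using assms by simp
qed

text \<open>Enumerate every class as \<open>{..<R}\<close> and solve \<open>pos k + pos j \<equiv> w (mod R)\<close> for \<open>j\<close>; since the
  equation is symmetric, \<open>\<sigma> w\<close> is an involution.\<close>

lemma ex_involutions:
  fixes C :: "nat \<Rightarrow> nat set"
  assumes C: "\<And>k. k < r \<Longrightarrow> k \<in> C k \<and> C k \<subseteq> {..<r}" "\<And>k j. \<lbrakk>k < r; j \<in> C k\<rbrakk> \<Longrightarrow> C j = C k"
  obtains \<sigma> :: "nat \<Rightarrow> nat \<Rightarrow> nat" and L :: "nat \<Rightarrow> nat \<Rightarrow> nat" where
    "\<And>w k. k < r \<Longrightarrow> \<sigma> w k \<in> C k" "\<And>w k. k < r \<Longrightarrow> \<sigma> w (\<sigma> w k) = k"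
    "\<And>w k j. \<lbrakk>k < r; j \<in> C k\<rbrakk> \<Longrightarrow> \<sigma> w k = j \<longleftrightarrow> w mod card (C k) = L k j"
    "\<And>k j. \<lbrakk>k < r; j \<in> C k\<rbrakk> \<Longrightarrow> L k j < card (C k)"
proof -
  \<comment> \<open>The enumeration is chosen for the set, not for an element of it, so all members
    of a class share it and their positions are comparable.\<close>
  define h :: "nat set \<Rightarrow> nat \<Rightarrow> nat" where "h S = (SOME h. bij_betw h S {0..<card S})" for S
  have h: "bij_betw (h S) S {0..<card S}" if "finite S" for S
    unfolding h_def by (rule someI_ex[OF ex_bij_betw_finite_nat[OF that]])
  define pos where "pos k = h (C k) k" for k
  have fin: "finite (C k)" if "k < r" for k
    using C(1)[OF that] finite_subset[of "C k" "{..<r}"] by simp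
  have bij: "bij_betw pos (C k) {0..<card (C k)}" if "k < r" for k
  proof -
    have "h (C k) j = pos j" if "j \<in> C k" for j
      unfolding pos_def C(2)[OF \<open>k < r\<close> that] ..
    from bij_betw_cong[THEN iffD1, OF this h[OF fin[OF that]]] show ?thesis
      by simp
  qed
  have pos: "pos j < card (C k)" if "k < r" "j \<in> C k" for j k
    using bij_betwE[OF bij[OF that(1)]] that by auto
  define L where "L k j = (pos k + pos j) mod card (C k)" for k j
  have ex1: "\<exists>!j. j \<in> C k \<and> w mod card (C k) = L k j" if k: "k < r" for w k
  proof -
    let ?R = "card (C k)"
    have pk: "pos k < ?R"
      using pos C(1) k by blast
    \<comment> \<open>This is \<open>w - pos k\<close> modulo \<open>?R\<close>, written so that no
      subtraction of natural numbers is truncated.\<close>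
    define q where "q = (w + (?R - pos k)) mod ?R"
    have "q \<in> pos ` C k"
      using bij_betw_imp_surj_on[OF bij[OF k]] pk by (simp add: q_def)
    then obtain j where j: "j \<in> C k" "pos j = q"
      by blast
    have "(pos k + q) mod ?R = (pos k + (w + (?R - pos k))) mod ?R"
      unfolding q_def by (rule mod_add_right_eq)
    also have "pos k + (w + (?R - pos k)) = w + ?R"
      using pk by simp
    finally have "w mod ?R = L k j"
      using j by (simp add: L_def)
    moreover have "j' = j" if j': "j' \<in> C k" "w mod ?R = L k j'" for j'
    proof -
      have "[pos k + pos j' = pos k + pos j] (mod ?R)"
        using j'(2) \<open>w mod ?R = L k j\<close> by (simp add: L_def cong_def)
      then have "[pos j' = pos j] (mod ?R)"
        by (simp only: cong_add_lcancel_nat)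
      then have "pos j' = pos j"
        using pos[OF k j'(1)] pos[OF k j(1)] by (rule cong_less_modulus_unique_nat)
      then show ?thesis
        using bij_betw_imp_inj_on[OF bij[OF k]] j'(1) j(1) by (simp add: inj_on_def)
    qed
    ultimately show ?thesis
      using j(1) by blast
  qed
  define \<sigma> where "\<sigma> w k = (THE j. j \<in> C k \<and> w mod card (C k) = L k j)" for w k
  have \<sigma>: "\<sigma> w k \<in> C k \<and> w mod card (C k) = L k (\<sigma> w k)" if "k < r" for w k
    unfolding \<sigma>_def by (rule theI'[OF ex1[OF that]])
  have unique: "\<sigma> w k = j" if "k < r" "j \<in> C k" "w mod card (C k) = L k j" for w k j
    unfolding \<sigma>_def by (rule the1_equality[OF ex1[OF that(1)]]) (use that in simp)
  show ?thesis
  proof (rule that[of \<sigma> L])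
    fix w k assume k: "k < r"
    show mem: "\<sigma> w k \<in> C k" using \<sigma>[OF k] by simp
    then have "\<sigma> w k < r"
      using C(1)[OF k] by blast
    moreover have "C (\<sigma> w k) = C k"
      by (rule C(2)[OF k mem])
    ultimately show "\<sigma> w (\<sigma> w k) = k"
      using \<sigma>[OF k, of w] C(1)[OF k] by (intro unique[of "\<sigma> w k" k w]) (simp_all add: L_def add.commute)
  next
    fix w k j assume kj: "k < r" "j \<in> C k"
    show "\<sigma> w k = j \<longleftrightarrow> w mod card (C k) = L k j"
    proof
      assume "\<sigma> w k = j"
      then show "w mod card (C k) = L k j"
        using \<sigma>[OF kj(1), of w] by simp
    qed (rule unique[OF kj])
  next
    fix k j assume kj: "k < r" "j \<in> C k"
    show "L k j < card (C k)"
      using pos[OF kj] unfolding L_def by (intro mod_less_divisor) simp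
  qed
qed

section \<open>Construction of the basis\<close>

context multimatrix_inclusion
begin

text \<open>In the tensor picture: the identity on \<open>x\<close>, the permutation \<tau> of
  summands, and on the copies a matrix \<open>q i k\<close> that may vary with the summand.\<close>

definition monomial :: "(nat \<Rightarrow> nat) \<Rightarrow> (nat \<Rightarrow> nat \<Rightarrow> nat \<Rightarrow> nat \<Rightarrow> complex) \<Rightarrow> nat \<Rightarrow> complex mat" where
  "monomial \<tau> q = mk (\<lambda>i (k, y, b) (j, x, c). if x = y \<and> j = \<tau> k then q i k b c else 0)"

lemma monomial_closed [simp]: "monomial \<tau> q \<in> carrier \<A>"
  by (simp add: monomial_def)

lemma ent_monomial:
  assumes "i < s" "(k, y, b) \<in> idx i" "(j, x, c) \<in> idx i"
  shows "ent (monomial \<tau> q) i (k, y, b) (j, x, c) = (if x = y \<and> j = \<tau> k then q i k b c else 0)"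
  unfolding monomial_def ent_mk[OF assms] by simp

text \<open>Involutions are used so that the adjoint of a monomial is again a monomial for the same
  \<tau>.\<close>

definition block_symmetry :: "(nat \<Rightarrow> nat) \<Rightarrow> bool" where
  "block_symmetry \<tau> \<longleftrightarrow> (\<forall>k<r. \<tau> k < r \<and> \<tau> (\<tau> k) = k \<and> m (\<tau> k) = m k \<and> (\<forall>i<s. a i (\<tau> k) = a i k))"

lemma block_symmetryD:
  assumes "block_symmetry \<tau>" "k < r"
  shows "\<tau> k < r" "\<tau> (\<tau> k) = k" "m (\<tau> k) = m k" "i < s \<Longrightarrow> a i (\<tau> k) = a i k"
  using assms by (auto simp: block_symmetry_def)

lemma block_symmetry_eq_iff: "\<lbrakk>block_symmetry \<tau>; k < r; j < r\<rbrakk> \<Longrightarrow> \<tau> k = j \<longleftrightarrow> \<tau> j = k"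
  using block_symmetryD(2)[of \<tau>] by metis

lemma monomial_star:
  assumes "block_symmetry \<tau>"
  shows "(monomial \<tau> q)\<^sup>\<star>\<^bsub>\<A>\<^esub> = monomial \<tau> (\<lambda>i k b c. cnj (q i (\<tau> k) c b))"
proof (rule ent_eqI)
  fix i P Q assume i: "i < s" "P \<in> idx i" "Q \<in> idx i"
  obtain k y b j x c where PQ: "P = (k, y, b)" "Q = (j, x, c)"
    by (cases P; cases Q) auto
  have kj: "k < r" "j < r" using i PQ by auto
  show "ent ((monomial \<tau> q)\<^sup>\<star>\<^bsub>\<A>\<^esub>) i P Q = ent (monomial \<tau> (\<lambda>i k b c. cnj (q i (\<tau> k) c b))) i P Q"
    using i block_symmetry_eq_iff[OF assms kj] unfolding PQ
    by (auto simp: ent_star ent_monomial simp del: idx_iff)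
qed auto

lemma ent_monomial_mult:
  assumes "block_symmetry \<tau>" "Y \<in> carrier \<A>" "i < s" "(k, y, b) \<in> idx i" "Q \<in> idx i"
  shows "ent (monomial \<tau> q \<otimes>\<^bsub>\<A>\<^esub> Y) i (k, y, b) Q = (\<Sum>c<a i k. q i k b c * ent Y i (\<tau> k, y, c) Q)"
proof -
  have k: "k < r" "y < m k" using assms(4) by auto
  note \<tau> = block_symmetryD[OF assms(1) k(1)]
  have "ent (monomial \<tau> q \<otimes>\<^bsub>\<A>\<^esub> Y) i (k, y, b) Q
    = (\<Sum>R\<in>idx i. ent (monomial \<tau> q) i (k, y, b) R * ent Y i R Q)"
    using assms by (intro ent_mult) auto
  also have "\<dots> = (\<Sum>c<a i (\<tau> k). ent (monomial \<tau> q) i (k, y, b) (\<tau> k, y, c) * ent Y i (\<tau> k, y, c) Q)"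
    using \<tau>(1,3) k assms(3,4) by (intro sum_idx_copies) (auto simp: ent_monomial simp del: idx_iff)
  also have "\<dots> = (\<Sum>c<a i (\<tau> k). q i k b c * ent Y i (\<tau> k, y, c) Q)"
    using \<tau>(1,3) k assms(3,4) by (intro sum.cong) (auto simp: ent_monomial)
  finally show ?thesis
    using \<tau>(4) assms(3) by simp
qed

lemma ent_mult_monomial_star:
  assumes "block_symmetry \<tau>" "Y \<in> carrier \<A>" "i < s" "(k, y, b) \<in> idx i" "P \<in> idx i"
  shows "ent (Y \<otimes>\<^bsub>\<A>\<^esub> (monomial \<tau> q)\<^sup>\<star>\<^bsub>\<A>\<^esub>) i P (k, y, b) = (\<Sum>c<a i k. ent Y i P (\<tau> k, y, c) * cnj (q i k b c))"
proof -
  have "(Y \<otimes>\<^bsub>\<A>\<^esub> (monomial \<tau> q)\<^sup>\<star>\<^bsub>\<A>\<^esub>) = (monomial \<tau> q \<otimes>\<^bsub>\<A>\<^esub> Y\<^sup>\<star>\<^bsub>\<A>\<^esub>)\<^sup>\<star>\<^bsub>\<A>\<^esub>"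
    using assms(2) by simp
  then have "ent (Y \<otimes>\<^bsub>\<A>\<^esub> (monomial \<tau> q)\<^sup>\<star>\<^bsub>\<A>\<^esub>) i P (k, y, b) = cnj (ent (monomial \<tau> q \<otimes>\<^bsub>\<A>\<^esub> Y\<^sup>\<star>\<^bsub>\<A>\<^esub>) i (k, y, b) P)"
    using ent_star[of "monomial \<tau> q \<otimes>\<^bsub>\<A>\<^esub> Y\<^sup>\<star>\<^bsub>\<A>\<^esub>" i P "(k, y, b)"] assms(2-5) by (simp del: A_star idx_iff)
  also have "\<dots> = (\<Sum>c<a i k. cnj (q i k b c * ent (Y\<^sup>\<star>\<^bsub>\<A>\<^esub>) i (\<tau> k, y, c) P))"
    using assms by (simp add: ent_monomial_mult del: idx_iff)
  also have "\<dots> = (\<Sum>c<a i k. ent Y i P (\<tau> k, y, c) * cnj (q i k b c))"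
  proof (rule sum.cong[OF refl])
    fix c assume "c \<in> {..<a i k}"
    then have "(\<tau> k, y, c) \<in> idx i"
      using assms(3,4) block_symmetryD[OF assms(1), of k] by simp
    then show "cnj (q i k b c * ent (Y\<^sup>\<star>\<^bsub>\<A>\<^esub>) i (\<tau> k, y, c) P) = ent Y i P (\<tau> k, y, c) * cnj (q i k b c)"
      using assms(2,3,5) by (simp add: ent_star del: idx_iff)
  qed
  finally show ?thesis .
qed

text \<open>An element of \<B> acts by the same matrix on every copy, so the factor \<open>q\<close>
  cancels against its adjoint by row orthonormality and only a relabelling of the summands by \<tau>
  survives.\<close>

lemma monomial_conj:
  assumes \<tau>: "block_symmetry \<tau>"
    and rows: "\<And>i k b b'. \<lbrakk>i < s; k < r; b < a i k; b' < a i k\<rbrakk> \<Longrightarrow>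
      (\<Sum>c<a i k. q i k b c * cnj (q i k b' c)) = (if b = b' then 1 else 0)"
    and X: "X \<in> carrier \<B>"
  shows "monomial \<tau> q \<otimes>\<^bsub>\<A>\<^esub> \<iota> X \<otimes>\<^bsub>\<A>\<^esub> (monomial \<tau> q)\<^sup>\<star>\<^bsub>\<A>\<^esub> = \<iota> (\<lambda>l\<in>{..<r}. X (\<tau> l))"
    and "(\<lambda>l\<in>{..<r}. X (\<tau> l)) \<in> carrier \<B>"
proof -
  have "X (\<tau> l) \<in> carrier_mat (m l) (m l)" if "l < r" for l
    using B_dims(1)[OF X] block_symmetryD[OF \<tau> that] by metis
  then show X': "(\<lambda>l\<in>{..<r}. X (\<tau> l)) \<in> carrier \<B>"
    unfolding \<B>_def multimatrix_simps by simp
  note \<iota>X = \<iota>_hom(1)[OF X]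
  show "monomial \<tau> q \<otimes>\<^bsub>\<A>\<^esub> \<iota> X \<otimes>\<^bsub>\<A>\<^esub> (monomial \<tau> q)\<^sup>\<star>\<^bsub>\<A>\<^esub> = \<iota> (\<lambda>l\<in>{..<r}. X (\<tau> l))"
  proof (rule ent_eqI)
    fix i P Q assume i: "i < s" "P \<in> idx i" "Q \<in> idx i"
    obtain k y b k' y' b' where PQ: "P = (k, y, b)" "Q = (k', y', b')"
      by (cases P; cases Q) auto
    have k: "k < r" "k' < r" "y < m k" "y' < m k'" "b < a i k" "b' < a i k'"
      using i PQ by auto
    note t = block_symmetryD[OF \<tau> k(1)] and t' = block_symmetryD[OF \<tau> k(2)]
    have inj: "\<tau> k = \<tau> k' \<longleftrightarrow> k = k'"
      using t(2) t'(2) by metis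
    have "ent (monomial \<tau> q \<otimes>\<^bsub>\<A>\<^esub> \<iota> X \<otimes>\<^bsub>\<A>\<^esub> (monomial \<tau> q)\<^sup>\<star>\<^bsub>\<A>\<^esub>) i P Q
      = (\<Sum>c'<a i k'. ent (monomial \<tau> q \<otimes>\<^bsub>\<A>\<^esub> \<iota> X) i P (\<tau> k', y', c') * cnj (q i k' b' c'))"
      unfolding PQ using i PQ \<iota>X by (intro ent_mult_monomial_star[OF \<tau>]) auto
    also have "\<dots> = (\<Sum>c'<a i k'. (\<Sum>c<a i k. q i k b c * (if k = k' \<and> c = c' then X (\<tau> k) $$ (y, y') else 0)) * cnj (q i k' b' c'))"
    proof (rule sum.cong[OF refl])
      fix c' assume c': "c' \<in> {..<a i k'}"
      have Q': "(\<tau> k', y', c') \<in> idx i"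
        using c' t' k i(1) by simp
      have "ent (monomial \<tau> q \<otimes>\<^bsub>\<A>\<^esub> \<iota> X) i P (\<tau> k', y', c')
        = (\<Sum>c<a i k. q i k b c * ent (\<iota> X) i (\<tau> k, y, c) (\<tau> k', y', c'))"
        unfolding PQ using i PQ by (intro ent_monomial_mult[OF \<tau> \<iota>X _ _ Q']) auto
      also have "\<dots> = (\<Sum>c<a i k. q i k b c * (if k = k' \<and> c = c' then X (\<tau> k) $$ (y, y') else 0))"
      proof (rule sum.cong[OF refl])
        fix c assume "c \<in> {..<a i k}"
        then have "(\<tau> k, y, c) \<in> idx i"
          using t k i(1) by simp
        then show "q i k b c * ent (\<iota> X) i (\<tau> k, y, c) (\<tau> k', y', c')
          = q i k b c * (if k = k' \<and> c = c' then X (\<tau> k) $$ (y, y') else 0)"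
          by (simp only: ent_\<iota>[OF X i(1) _ Q'] inj)
      qed
      finally show "ent (monomial \<tau> q \<otimes>\<^bsub>\<A>\<^esub> \<iota> X) i P (\<tau> k', y', c') * cnj (q i k' b' c')
        = (\<Sum>c<a i k. q i k b c * (if k = k' \<and> c = c' then X (\<tau> k) $$ (y, y') else 0)) * cnj (q i k' b' c')"
        by (simp only:)
    qed
    also have "\<dots> = (if k = k' then X (\<tau> k) $$ (y, y') * (\<Sum>c<a i k. q i k b c * cnj (q i k b' c)) else 0)"
    proof (cases "k = k'")
      case True
      have "(\<Sum>c<a i k. q i k b c * (if k = k' \<and> c = c' then X (\<tau> k) $$ (y, y') else 0)) = q i k b c' * X (\<tau> k) $$ (y, y')"
        if "c' < a i k" for c'
      proof -
        have "(\<Sum>c<a i k. q i k b c * (if k = k' \<and> c = c' then X (\<tau> k) $$ (y, y') else 0))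
          = (\<Sum>c<a i k. if c = c' then q i k b c' * X (\<tau> k) $$ (y, y') else 0)"
          using True by (intro sum.cong) auto
        then show ?thesis using that by simp
      qed
      then show ?thesis
        using True by (simp add: sum_distrib_left mult_ac)
    qed simp
    also have "\<dots> = (if k = k' \<and> b = b' then X (\<tau> k) $$ (y, y') else 0)"
      using rows[OF i(1) k(1) k(5), of b'] k by auto
    also have "\<dots> = ent (\<iota> (\<lambda>l\<in>{..<r}. X (\<tau> l))) i P Q"
      unfolding PQ using ent_\<iota>[OF X' i(1), of k y b k' y' b'] i PQ k by simp
    finally show "ent (monomial \<tau> q \<otimes>\<^bsub>\<A>\<^esub> \<iota> X \<otimes>\<^bsub>\<A>\<^esub> (monomial \<tau> q)\<^sup>\<star>\<^bsub>\<A>\<^esub>) i P Q = ent (\<iota> (\<lambda>l\<in>{..<r}. X (\<tau> l))) i P Q" .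
  qed (use \<iota>X X' \<iota>_hom(1) in auto)
qed

text \<open>Orthonormal rows give unitarity, as the case \<open>X = 1\<close> of conjugation, and
  the invariance of \<B>. Orthonormal columns are the rows of the adjoint and give invariance under
  the inverse, hence equality.\<close>

lemma monomial_normalizer:
  assumes \<tau>: "block_symmetry \<tau>"
    and rows: "\<And>i k b b'. \<lbrakk>i < s; k < r; b < a i k; b' < a i k\<rbrakk> \<Longrightarrow>
      (\<Sum>c<a i k. q i k b c * cnj (q i k b' c)) = (if b = b' then 1 else 0)"
    and columns: "\<And>i k c c'. \<lbrakk>i < s; k < r; c < a i k; c' < a i k\<rbrakk> \<Longrightarrow>
      (\<Sum>b<a i k. q i k b c * cnj (q i k b c')) = (if c = c' then 1 else 0)"
  shows "monomial \<tau> q \<in> normalizer \<A> \<B>\<^sub>\<iota>"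
proof -
  let ?W = "monomial \<tau> q"
  have conj_star: "?W\<^sup>\<star>\<^bsub>\<A>\<^esub> \<otimes>\<^bsub>\<A>\<^esub> \<iota> X \<otimes>\<^bsub>\<A>\<^esub> ?W \<in> \<B>\<^sub>\<iota>" if X: "X \<in> carrier \<B>" for X
  proof -
    define q' where "q' = (\<lambda>i k b c. cnj (q i (\<tau> k) c b))"
    have star: "?W\<^sup>\<star>\<^bsub>\<A>\<^esub> = monomial \<tau> q'"
      unfolding q'_def by (rule monomial_star[OF \<tau>])
    have "(\<Sum>c<a i k. q' i k b c * cnj (q' i k b' c)) = (if b = b' then 1 else 0)"
      if "i < s" "k < r" "b < a i k" "b' < a i k" for i k b b'
      using columns[OF that(1) block_symmetryD(1)[OF \<tau> that(2)], of b' b] that(3,4)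
        block_symmetryD(4)[OF \<tau> that(2,1)]
      by (auto simp: q'_def mult.commute)
    from monomial_conj[OF \<tau> this X]
    have "monomial \<tau> q' \<otimes>\<^bsub>\<A>\<^esub> \<iota> X \<otimes>\<^bsub>\<A>\<^esub> (monomial \<tau> q')\<^sup>\<star>\<^bsub>\<A>\<^esub> \<in> \<B>\<^sub>\<iota>"
      by simp
    moreover have "(monomial \<tau> q')\<^sup>\<star>\<^bsub>\<A>\<^esub> = ?W"
      unfolding star[symmetric] by simp
    ultimately show ?thesis
      unfolding star by simp
  qed
  have one: "(\<lambda>l\<in>{..<r}. \<one>\<^bsub>\<B>\<^esub> (\<tau> l)) = \<one>\<^bsub>\<B>\<^esub>"
    by (rule multimatrix_ext[of _ r m, folded \<B>_def])
      (use monomial_conj(2)[OF \<tau> rows B.one_closed] block_symmetryD[OF \<tau>] in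
        \<open>simp_all add: multimatrix_apply(2)[where k = r and d = m, folded \<B>_def]\<close>)
  have "?W \<otimes>\<^bsub>\<A>\<^esub> ?W\<^sup>\<star>\<^bsub>\<A>\<^esub> = ?W \<otimes>\<^bsub>\<A>\<^esub> \<iota> \<one>\<^bsub>\<B>\<^esub> \<otimes>\<^bsub>\<A>\<^esub> ?W\<^sup>\<star>\<^bsub>\<A>\<^esub>"
    by (simp add: \<iota>_hom(7)[OF B.one_closed])
  also have "\<dots> = \<one>\<^bsub>\<A>\<^esub>"
    using monomial_conj(1)[OF \<tau> rows B.one_closed] one \<iota>_hom(7)[OF B.one_closed] by simp
  finally have unitary: "?W \<in> unitary_elements \<A>"
    using monomial_closed[of \<tau> q] unfolding \<A>_def by (intro multimatrix_unitaryI)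
  note w = A_unitary[OF unitary]
  have "(\<lambda>X. ?W \<otimes>\<^bsub>\<A>\<^esub> X \<otimes>\<^bsub>\<A>\<^esub> ?W\<^sup>\<star>\<^bsub>\<A>\<^esub>) ` \<B>\<^sub>\<iota> = \<B>\<^sub>\<iota>"
  proof
    show "(\<lambda>X. ?W \<otimes>\<^bsub>\<A>\<^esub> X \<otimes>\<^bsub>\<A>\<^esub> ?W\<^sup>\<star>\<^bsub>\<A>\<^esub>) ` \<B>\<^sub>\<iota> \<subseteq> \<B>\<^sub>\<iota>"
      using monomial_conj[OF \<tau> rows] by auto
    show "\<B>\<^sub>\<iota> \<subseteq> (\<lambda>X. ?W \<otimes>\<^bsub>\<A>\<^esub> X \<otimes>\<^bsub>\<A>\<^esub> ?W\<^sup>\<star>\<^bsub>\<A>\<^esub>) ` \<B>\<^sub>\<iota>"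
    proof
      fix Y assume "Y \<in> \<B>\<^sub>\<iota>"
      then have Y: "?W\<^sup>\<star>\<^bsub>\<A>\<^esub> \<otimes>\<^bsub>\<A>\<^esub> Y \<otimes>\<^bsub>\<A>\<^esub> ?W \<in> \<B>\<^sub>\<iota>" "Y \<in> carrier \<A>"
        using conj_star \<iota>_hom(1) by auto
      have "?W \<otimes>\<^bsub>\<A>\<^esub> (?W\<^sup>\<star>\<^bsub>\<A>\<^esub> \<otimes>\<^bsub>\<A>\<^esub> Y \<otimes>\<^bsub>\<A>\<^esub> ?W) \<otimes>\<^bsub>\<A>\<^esub> ?W\<^sup>\<star>\<^bsub>\<A>\<^esub>
        = (?W \<otimes>\<^bsub>\<A>\<^esub> ?W\<^sup>\<star>\<^bsub>\<A>\<^esub>) \<otimes>\<^bsub>\<A>\<^esub> Y \<otimes>\<^bsub>\<A>\<^esub> (?W \<otimes>\<^bsub>\<A>\<^esub> ?W\<^sup>\<star>\<^bsub>\<A>\<^esub>)"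
        using Y(2) w(1) by (simp only: A.m_assoc A.m_closed A_closed)
      also have "\<dots> = Y"
        using Y(2) w by simp
      finally show "Y \<in> (\<lambda>X. ?W \<otimes>\<^bsub>\<A>\<^esub> X \<otimes>\<^bsub>\<A>\<^esub> ?W\<^sup>\<star>\<^bsub>\<A>\<^esub>) ` \<B>\<^sub>\<iota>"
        using Y(1) by (intro rev_image_eqI[OF Y(1)]) simp
    qed
  qed
  then show ?thesis
    using unitary by (simp add: normalizer_def)
qed

end

section \<open>Classes of summands and the basis built from them\<close>

locale homogeneous_inclusion = multimatrix_expectation +
  fixes d :: nat
  assumes homogeneous: "\<And>i j k. \<lbrakk>i < s; j < r; k < r; 0 < a i j; 0 < a i k\<rbrakk> \<Longrightarrow> m j = m k"
      "\<And>i j k l. \<lbrakk>i < s; j < r; k < r; 0 < a i j; 0 < a i k; l < s\<rbrakk> \<Longrightarrow> a l j = a l k"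
    and spectral: "\<And>j. j < r \<Longrightarrow> weight j = d * m j"
begin

text \<open>The summands of \<B> that meet \<open>k\<close> inside some summand of \<A>; by
  homogeneity these sets partition the summands, and each is one piece of the decomposition, with
  \<open>R = card (cls k)\<close>.\<close>

definition cls :: "nat \<Rightarrow> nat set" where
  "cls k = {j. j < r \<and> (\<exists>i<s. 0 < a i j \<and> 0 < a i k)}"

text \<open>The dimension of the direct sum of full matrix algebras of sizes \<open>a l k\<close>,
  and so the order of the cyclic group attached to the class.\<close>

definition dim_sum :: "nat \<Rightarrow> nat" where
  "dim_sum k = (\<Sum>l<s. a l k * a l k)"

lemma cls_self: "k < r \<Longrightarrow> k \<in> cls k"
  using ex_multiplicity_pos[of k] by (auto simp: cls_def)

lemma cls_less: "j \<in> cls k \<Longrightarrow> j < r"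
  by (simp add: cls_def)

lemma in_cls: "\<lbrakk>i < s; j < r; 0 < a i j; 0 < a i k\<rbrakk> \<Longrightarrow> j \<in> cls k"
  by (auto simp: cls_def)

lemma cls_homogeneous:
  assumes "k < r" "j \<in> cls k"
  shows "m j = m k" "l < s \<Longrightarrow> a l j = a l k"
proof -
  obtain i where i: "i < s" "j < r" "0 < a i j" "0 < a i k"
    using assms by (auto simp: cls_def)
  show "m j = m k" by (rule homogeneous(1)[OF i(1,2) assms(1) i(3,4)])
  show "a l j = a l k" if "l < s" by (rule homogeneous(2)[OF i(1,2) assms(1) i(3,4) that])
qed

text \<open>Meeting another summand depends only on the column of \<Lambda>, and \<open>j\<close>
  and \<open>k\<close> have the same column.\<close>

lemma cls_eq:
  assumes "k < r" "j \<in> cls k"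
  shows "cls j = cls k"
proof -
  have "(\<exists>i<s. 0 < a i l \<and> 0 < a i j) \<longleftrightarrow> (\<exists>i<s. 0 < a i l \<and> 0 < a i k)" for l
    using cls_homogeneous(2)[OF assms] by metis
  then show ?thesis
    by (simp add: cls_def)
qed

text \<open>Every summand of \<B> that occurs in summand \<open>i\<close> of \<A> belongs to the
  class of \<open>k\<close> and contributes the same dimension. Hence the trace weights are
  proportional to the multiplicities within a class.\<close>

lemma n_eq_cls:
  assumes "i < s" "k < r" "0 < a i k"
  shows "n i = card (cls k) * m k * a i k"
proof -
  have "n i = (\<Sum>j\<in>cls k. m j * a i j)"
    unfolding n_eq[OF assms(1)]
  proof (rule sum.mono_neutral_right)
    show "\<forall>j\<in>{..<r} - cls k. m j * a i j = 0"
      using in_cls[OF assms(1) _ _ assms(3)] by auto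
  qed (auto simp: cls_def)
  also have "\<dots> = (\<Sum>j\<in>cls k. m k * a i k)"
    by (rule sum.cong[OF refl]) (simp only: cls_homogeneous[OF assms(2)] assms(1))
  finally show ?thesis
    by simp
qed

lemma weight_eq:
  assumes "k < r"
  shows "weight k = card (cls k) * m k * dim_sum k"
proof -
  have eq: "n i * a i k = card (cls k) * m k * (a i k * a i k)" if "i < s" for i
    using n_eq_cls[OF that assms] by (cases "a i k = 0") simp_all
  show ?thesis
    unfolding weight_def dim_sum_def sum_distrib_left by (rule sum.cong[OF refl], rule eq) simp
qed

lemma d_eq:
  assumes "k < r"
  shows "d = card (cls k) * dim_sum k"
  using spectral[OF assms] weight_eq[OF assms] m_pos[OF assms] by simp

text \<open>The factor \<open>card (cls k) * m k\<close> is common to the trace weights and to the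
  total weight. Cancelling it leaves the weights under which the Fourier unitaries are
  orthogonal.\<close>

lemma avg_eq:
  assumes "k < r"
  shows "avg Y k x y = (\<Sum>i<s. of_nat (a i k) * (\<Sum>c<a i k. ent Y i (k, x, c) (k, y, c))) / of_nat (dim_sum k)"
proof -
  have pos: "card (cls k) * m k \<noteq> 0"
    using weight_pos[OF assms] unfolding weight_eq[OF assms] by (intro notI) simp
  \<comment> \<open>Where the multiplicity vanishes, \<open>n i\<close> is not given by the class,
    but then the sum over copies is empty.\<close>
  have "of_nat (n i) * (\<Sum>c<a i k. ent Y i (k, x, c) (k, y, c))
    = of_nat (card (cls k) * m k) * (of_nat (a i k) * (\<Sum>c<a i k. ent Y i (k, x, c) (k, y, c)))" if "i < s" for i
    using n_eq_cls[OF that assms] by (cases "a i k = 0") simp_all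
  then have "avg Y k x y = of_nat (card (cls k) * m k) * (\<Sum>i<s. of_nat (a i k) * (\<Sum>c<a i k. ent Y i (k, x, c) (k, y, c)))
      / of_nat (card (cls k) * m k * dim_sum k)"
    unfolding avg_def weight_eq[OF assms] sum_distrib_left by simp
  then show ?thesis
    using pos by simp
qed

text \<open>In the class of \<open>k\<close>, the unitary \<open>W w\<close> permutes summands by
  the residue of \<open>w\<close> and acts on copies by the Fourier unitary numbered by the
  quotient. Since \<open>d = card (cls k) * dim_sum k\<close> for every \<open>k\<close>, each pair
  of residue and quotient is met exactly once in each class.\<close>

lemma has_basis: "has_unitary_orthonormal_basis_in_normalizer \<A> \<B>\<^sub>\<iota> E"
proof -
  have C: "k \<in> cls k \<and> cls k \<subseteq> {..<r}" if "k < r" for k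
    using cls_self[OF that] by (auto simp: cls_def)
  obtain \<sigma> L where \<sigma>_cls: "\<And>w k. k < r \<Longrightarrow> \<sigma> w k \<in> cls k" and \<sigma>_inv: "\<And>w k. k < r \<Longrightarrow> \<sigma> w (\<sigma> w k) = k"
    and \<sigma>_iff: "\<And>w k j. \<lbrakk>k < r; j \<in> cls k\<rbrakk> \<Longrightarrow> \<sigma> w k = j \<longleftrightarrow> w mod card (cls k) = L k j"
    and L: "\<And>k j. \<lbrakk>k < r; j \<in> cls k\<rbrakk> \<Longrightarrow> L k j < card (cls k)"
    using ex_involutions[of r cls, OF C cls_eq] by blast
  have \<sigma>_less: "\<sigma> w k < r" if "k < r" for w k
    by (rule cls_less[OF \<sigma>_cls[OF that]])
  have sym: "block_symmetry (\<sigma> w)" for w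
    unfolding block_symmetry_def using \<sigma>_less \<sigma>_inv cls_homogeneous[OF _ \<sigma>_cls] by simp
  define q where "q w i k b c = fourier_unitary s (\<lambda>l. a l k) (w div card (cls k)) i b c" for w i k b c
  \<comment> \<open>The matrices on copies are constant on a class, so passing from \<open>k\<close>
    to \<open>\<sigma> w k\<close> does not change them.\<close>
  have q_cong: "q w i j b c = q w i k b c" if "i < s" "k < r" "j \<in> cls k" for w i j k b c
    unfolding q_def cls_eq[OF that(2,3)]
    by (rule fourier_unitary_cong[OF cls_homogeneous(2)[OF that(2,3)] that(1)])
  define W where "W w = monomial (\<sigma> w) (q w)" for w
  have W: "W w \<in> normalizer \<A> \<B>\<^sub>\<iota>" for w
    unfolding W_def
    by (rule monomial_normalizer[OF sym])
      (use fourier_unitary_rows[of _ "\<lambda>l. a l _"] fourier_unitary_columns[of _ "\<lambda>l. a l _"] in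
        \<open>auto simp: q_def\<close>)
  have W_c: "W w \<in> carrier \<A>" for w
    by (simp add: W_def)
  have ent_star_mult: "ent ((W w)\<^sup>\<star>\<^bsub>\<A>\<^esub> \<otimes>\<^bsub>\<A>\<^esub> Y) i (j, x, c) Q
      = (\<Sum>b<a i j. cnj (q w i j b c) * ent Y i (\<sigma> w j, x, b) Q)"
    if "Y \<in> carrier \<A>" "i < s" "(j, x, c) \<in> idx i" "Q \<in> idx i" for w Y i j x c Q
  proof -
    have "j < r" using that(3) by simp
    then show ?thesis
      unfolding W_def monomial_star[OF sym] ent_monomial_mult[OF sym that]
      using q_cong[OF that(2) _ \<sigma>_cls] by simp
  qed

  have avg_W: "avg ((W w)\<^sup>\<star>\<^bsub>\<A>\<^esub> \<otimes>\<^bsub>\<A>\<^esub> W w') j x y = (if w = w' \<and> x = y then 1 else 0)"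
    if w: "w < d" "w' < d" and j: "j < r" "x < m j" "y < m j" for w w' j x y
  proof -
    let ?R = "card (cls j)"
    let ?f = "fourier_unitary s (\<lambda>l. a l j)"
    have R: "0 < ?R" using d_eq[OF j(1)] w by (intro gr0I) simp
    \<comment> \<open>Different residues move \<open>j\<close> to different summands, which makes
      the relevant diagonal blocks of the product vanish; for equal residues the involutions cancel
      on \<open>j\<close> and only the Fourier parts interact.\<close>
    have same: "\<sigma> w' (\<sigma> w j) = j \<longleftrightarrow> w mod ?R = w' mod ?R"
    proof -
      have "\<sigma> w' (\<sigma> w j) = j \<longleftrightarrow> \<sigma> w' j = \<sigma> w j"
        by (rule block_symmetry_eq_iff[OF sym \<sigma>_less[OF j(1)] j(1)])
      also have "\<dots> \<longleftrightarrow> w' mod ?R = w mod ?R"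
        using \<sigma>_iff[OF j(1) \<sigma>_cls[OF j(1)], of w' w] \<sigma>_iff[OF j(1) \<sigma>_cls[OF j(1)], of w w] by simp
      finally show ?thesis by auto
    qed
    have entry: "ent ((W w)\<^sup>\<star>\<^bsub>\<A>\<^esub> \<otimes>\<^bsub>\<A>\<^esub> W w') i (j, x, c) (j, y, c)
      = (if x = y \<and> w mod ?R = w' mod ?R
         then \<Sum>b<a i j. ?f (w' div ?R) i b c * cnj (?f (w div ?R) i b c) else 0)"
      if i: "i < s" and c: "c < a i j" for i c
    proof -
      have idx: "(j, x, c) \<in> idx i" "(j, y, c) \<in> idx i"
        using j c by auto
      have "ent (W w') i (\<sigma> w j, x, b) (j, y, c) = (if y = x \<and> j = \<sigma> w' (\<sigma> w j) then q w' i j b c else 0)"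
        if "b < a i j" for b
      proof -
        have "(\<sigma> w j, x, b) \<in> idx i"
          using that j \<sigma>_less cls_homogeneous[OF j(1) \<sigma>_cls[OF j(1)]] i by simp
        then show ?thesis
          unfolding W_def by (simp only: ent_monomial[OF i _ idx(2)] q_cong[OF i j(1) \<sigma>_cls[OF j(1)]])
      qed
      then have "ent ((W w)\<^sup>\<star>\<^bsub>\<A>\<^esub> \<otimes>\<^bsub>\<A>\<^esub> W w') i (j, x, c) (j, y, c)
        = (\<Sum>b<a i j. cnj (q w i j b c) * (if y = x \<and> j = \<sigma> w' (\<sigma> w j) then q w' i j b c else 0))"
        unfolding ent_star_mult[OF W_c i idx] by (intro sum.cong) auto
      then show ?thesis
        using same by (auto simp: q_def mult.commute)
    qed
    have "avg ((W w)\<^sup>\<star>\<^bsub>\<A>\<^esub> \<otimes>\<^bsub>\<A>\<^esub> W w') j x y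
      = (\<Sum>i<s. of_nat (a i j) * (\<Sum>c<a i j. if x = y \<and> w mod ?R = w' mod ?R
         then \<Sum>b<a i j. ?f (w' div ?R) i b c * cnj (?f (w div ?R) i b c) else 0)) / of_nat (dim_sum j)"
      unfolding avg_eq[OF j(1)] by (simp add: entry)
    also have "\<dots> = (if x = y \<and> w mod ?R = w' mod ?R then
      (\<Sum>i<s. of_nat (a i j) * (\<Sum>b<a i j. \<Sum>c<a i j. ?f (w' div ?R) i b c * cnj (?f (w div ?R) i b c))) / of_nat (dim_sum j) else 0)"
      by (auto intro!: sum.cong sum.swap arg_cong2[of _ _ _ _ "(/)"] arg_cong2[of _ _ _ _ "(*)"])
    \<comment> \<open>Both quotients stay below \<open>dim_sum j\<close> because \<open>w\<close>
      and \<open>w'\<close> are below \<open>d\<close>, which factors as in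
      \<open>d_eq\<close>.\<close>
    also have "(\<Sum>i<s. of_nat (a i j) * (\<Sum>b<a i j. \<Sum>c<a i j. ?f (w' div ?R) i b c * cnj (?f (w div ?R) i b c)))
      = (if w' div ?R = w div ?R then of_nat (dim_sum j) else 0)"
      unfolding dim_sum_def
      by (rule fourier_unitary_orthogonal)
        (use w R d_eq[OF j(1)] in \<open>simp_all add: less_mult_imp_div_less mult.commute dim_sum_def\<close>)
    also have "(if x = y \<and> w mod ?R = w' mod ?R then
      (if w' div ?R = w div ?R then of_nat (dim_sum j) else 0) / of_nat (dim_sum j) else 0)
      = (if w = w' \<and> x = y then 1 else (0::complex))"
    proof -
      have "w = w' \<longleftrightarrow> w mod ?R = w' mod ?R \<and> w' div ?R = w div ?R"
        by (metis div_mult_mod_eq)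
      moreover have "dim_sum j \<noteq> 0"
        using d_eq[OF j(1)] w by (intro notI) simp
      ultimately show ?thesis by auto
    qed
    finally show ?thesis .
  qed

  have orthonormal: "E ((W w)\<^sup>\<star>\<^bsub>\<A>\<^esub> \<otimes>\<^bsub>\<A>\<^esub> W w') = (if w = w' then \<one>\<^bsub>\<A>\<^esub> else \<zero>\<^bsub>\<A>\<^esub>)"
    if w: "w < d" "w' < d" for w w'
  proof (rule ent_eqI)
    fix i P Q assume i: "i < s" "P \<in> idx i" "Q \<in> idx i"
    obtain j x c j' x' c' where PQ: "P = (j, x, c)" "Q = (j', x', c')"
      by (cases P; cases Q) auto
    have j: "j < r" "x < m j" "j = j' \<Longrightarrow> x' < m j"
      using i PQ by auto
    have "ent (E ((W w)\<^sup>\<star>\<^bsub>\<A>\<^esub> \<otimes>\<^bsub>\<A>\<^esub> W w')) i P Q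
      = (if j = j' \<and> c = c' then avg ((W w)\<^sup>\<star>\<^bsub>\<A>\<^esub> \<otimes>\<^bsub>\<A>\<^esub> W w') j x x' else 0)"
      using i W_c unfolding PQ by (intro ent_E) auto
    also have "\<dots> = (if w = w' \<and> P = Q then 1 else 0)"
      using avg_W[OF w j(1,2)] j(3) PQ by auto
    also have "\<dots> = ent (if w = w' then \<one>\<^bsub>\<A>\<^esub> else \<zero>\<^bsub>\<A>\<^esub>) i P Q"
      using i by (simp add: ent_one ent_zero)
    finally show "ent (E ((W w)\<^sup>\<star>\<^bsub>\<A>\<^esub> \<otimes>\<^bsub>\<A>\<^esub> W w')) i P Q
      = ent (if w = w' then \<one>\<^bsub>\<A>\<^esub> else \<zero>\<^bsub>\<A>\<^esub>) i P Q" .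
  qed (use W_c E_closed in auto)

  have reconstruct: "Y = (\<Oplus>\<^bsub>\<A>\<^esub> w \<in> {..<d}. W w \<otimes>\<^bsub>\<A>\<^esub> E ((W w)\<^sup>\<star>\<^bsub>\<A>\<^esub> \<otimes>\<^bsub>\<A>\<^esub> Y))"
    if Y: "Y \<in> carrier \<A>" for Y
  proof (rule ent_eqI)
    have WY: "(W w)\<^sup>\<star>\<^bsub>\<A>\<^esub> \<otimes>\<^bsub>\<A>\<^esub> Y \<in> carrier \<A>" for w
      using W_c Y by simp
    fix i P Q assume i: "i < s" "P \<in> idx i" "Q \<in> idx i"
    obtain k y b j x c where PQ: "P = (k, y, b)" "Q = (j, x, c)"
      by (cases P; cases Q) auto
    have kj: "k < r" "y < m k" "b < a i k" "j < r" "x < m j" "c < a i j"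
      using i PQ by auto
    \<comment> \<open>Both triples address the same summand of \<A>, so the summands
      \<open>j\<close> and \<open>k\<close> meet there.\<close>
    have jk: "j \<in> cls k"
      using in_cls[OF i(1) kj(4)] kj by simp
    note hom = cls_homogeneous[OF kj(1) jk]
    have ik: "c < a i k" "x < m k" "y < m j"
      using hom i kj by auto
    let ?R = "card (cls k)"
    let ?f = "fourier_unitary s (\<lambda>l. a l k)"
    \<comment> \<open>The expectation has no entries between different summands of \<B>, so only the
      indices \<open>w\<close> whose involution exchanges \<open>k\<close> and \<open>j\<close>
      contribute, and these form one residue class.\<close>
    have summand: "ent (W w \<otimes>\<^bsub>\<A>\<^esub> E ((W w)\<^sup>\<star>\<^bsub>\<A>\<^esub> \<otimes>\<^bsub>\<A>\<^esub> Y)) i P Q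
      = (if w mod ?R = L k j then ?f (w div ?R) i b c * avg ((W w)\<^sup>\<star>\<^bsub>\<A>\<^esub> \<otimes>\<^bsub>\<A>\<^esub> Y) j y x else 0)" for w
    proof -
      have "ent (W w \<otimes>\<^bsub>\<A>\<^esub> E ((W w)\<^sup>\<star>\<^bsub>\<A>\<^esub> \<otimes>\<^bsub>\<A>\<^esub> Y)) i P Q
        = (\<Sum>c'<a i k. q w i k b c' * ent (E ((W w)\<^sup>\<star>\<^bsub>\<A>\<^esub> \<otimes>\<^bsub>\<A>\<^esub> Y)) i (\<sigma> w k, y, c') Q)"
        unfolding PQ W_def using i PQ E_closed[OF WY[of w]]
        by (intro ent_monomial_mult[OF sym]) (auto simp: W_def)
      also have "\<dots> = (\<Sum>c'<a i k. if c' = c then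
        (if \<sigma> w k = j then q w i k b c * avg ((W w)\<^sup>\<star>\<^bsub>\<A>\<^esub> \<otimes>\<^bsub>\<A>\<^esub> Y) j y x else 0) else 0)"
      proof (rule sum.cong[OF refl])
        fix c' assume "c' \<in> {..<a i k}"
        then have "(\<sigma> w k, y, c') \<in> idx i"
          using kj \<sigma>_less cls_homogeneous[OF kj(1) \<sigma>_cls[OF kj(1)]] i by simp
        from ent_E[OF WY i(1) this i(3)[unfolded PQ]]
        show "q w i k b c' * ent (E ((W w)\<^sup>\<star>\<^bsub>\<A>\<^esub> \<otimes>\<^bsub>\<A>\<^esub> Y)) i (\<sigma> w k, y, c') Q
          = (if c' = c then (if \<sigma> w k = j then q w i k b c * avg ((W w)\<^sup>\<star>\<^bsub>\<A>\<^esub> \<otimes>\<^bsub>\<A>\<^esub> Y) j y x else 0) else 0)"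
          unfolding PQ by auto
      qed
      finally show ?thesis
        using ik(1) \<sigma>_iff[OF kj(1) jk, of w] by (simp add: q_def)
    qed
    have avg_Y: "avg ((W w)\<^sup>\<star>\<^bsub>\<A>\<^esub> \<otimes>\<^bsub>\<A>\<^esub> Y) j y x
      = (\<Sum>i'<s. \<Sum>c'<a i' k. \<Sum>b'<a i' k. of_nat (a i' k) * cnj (?f (w div ?R) i' b' c')
          * ent Y i' (k, y, b') (j, x, c')) / of_nat (dim_sum k)"
      if "w mod ?R = L k j" for w
    proof -
      \<comment> \<open>The involution property turns the condition on \<open>k\<close> into one on
        \<open>j\<close>, the summand over which the average is taken.\<close>
      have \<sigma>: "\<sigma> w j = k"
        using \<sigma>_iff[OF kj(1) jk, of w] that block_symmetry_eq_iff[OF sym kj(1,4)] by simp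
      have "ent ((W w)\<^sup>\<star>\<^bsub>\<A>\<^esub> \<otimes>\<^bsub>\<A>\<^esub> Y) i' (j, y, c') (j, x, c')
        = (\<Sum>b'<a i' k. cnj (?f (w div ?R) i' b' c') * ent Y i' (k, y, b') (j, x, c'))"
        if "i' < s" "c' < a i' k" for i' c'
      proof -
        have "(j, y, c') \<in> idx i'" "(j, x, c') \<in> idx i'"
          using that kj ik hom by auto
        from ent_star_mult[OF Y that(1) this, of w] show ?thesis
          unfolding \<sigma> q_cong[OF that(1) kj(1) jk] hom(2)[OF that(1)] by (simp add: q_def)
      qed
      moreover have "dim_sum j = dim_sum k"
        using hom(2) by (simp add: dim_sum_def)
      ultimately show ?thesis
        unfolding avg_eq[OF kj(4)] using hom(2) by (simp add: sum_distrib_left mult.assoc)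
    qed
    have "ent (\<Oplus>\<^bsub>\<A>\<^esub> w \<in> {..<d}. W w \<otimes>\<^bsub>\<A>\<^esub> E ((W w)\<^sup>\<star>\<^bsub>\<A>\<^esub> \<otimes>\<^bsub>\<A>\<^esub> Y)) i P Q
      = (\<Sum>w<d. ent (W w \<otimes>\<^bsub>\<A>\<^esub> E ((W w)\<^sup>\<star>\<^bsub>\<A>\<^esub> \<otimes>\<^bsub>\<A>\<^esub> Y)) i P Q)"
      by (rule ent_finsum) (use i W_c E_closed[OF WY] in auto)
    \<comment> \<open>On the contributing residue class the term depends on \<open>w\<close> only
      through \<open>w div ?R\<close>, which leaves a full sum over the Fourier index.\<close>
    also have "\<dots> = (\<Sum>w<?R * dim_sum k. if w mod ?R = L k j then
      (\<lambda>g. ?f g i b c * ((\<Sum>i'<s. \<Sum>c'<a i' k. \<Sum>b'<a i' k. of_nat (a i' k) * cnj (?f g i' b' c')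
          * ent Y i' (k, y, b') (j, x, c')) / of_nat (dim_sum k))) (w div ?R) else 0)"
      unfolding d_eq[OF kj(1), symmetric] by (rule sum.cong[OF refl]) (simp only: summand avg_Y cong: if_cong)
    also have "\<dots> = (\<Sum>g<dim_sum k. ?f g i b c * ((\<Sum>i'<s. \<Sum>c'<a i' k. \<Sum>b'<a i' k. of_nat (a i' k) * cnj (?f g i' b' c')
          * ent Y i' (k, y, b') (j, x, c')) / of_nat (dim_sum k)))"
      by (rule sum_mod_eq[OF L[OF kj(1) jk]])
    also have "\<dots> = (\<Sum>g<dim_sum k. \<Sum>i'<s. \<Sum>c'<a i' k. \<Sum>b'<a i' k.
        of_nat (a i' k) * ent Y i' (k, y, b') (j, x, c') / of_nat (dim_sum k) * (?f g i b c * cnj (?f g i' b' c')))"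
      by (simp only: sum_distrib_left sum_divide_distrib times_divide_eq_left times_divide_eq_right mult_ac)
    also have "\<dots> = (\<Sum>i'<s. \<Sum>c'<a i' k. \<Sum>b'<a i' k.
        of_nat (a i' k) * ent Y i' (k, y, b') (j, x, c') / of_nat (dim_sum k)
          * (\<Sum>g<dim_sum k. ?f g i b c * cnj (?f g i' b' c')))"
      unfolding sum_distrib_left
      by (rule trans[OF sum.swap], rule sum.cong[OF refl], rule trans[OF sum.swap],
          rule sum.cong[OF refl], rule sum.swap)
    \<comment> \<open>Completeness supplies the factor \<open>dim_sum k / a i k\<close>, which
      cancels both the normalization of the average and its weight.\<close>
    also have "\<dots> = (\<Sum>i'<s. \<Sum>c'<a i' k. \<Sum>b'<a i' k. if b' = b then if c' = c then if i' = i then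
        ent Y i (k, y, b) (j, x, c) else 0 else 0 else 0)"
    proof (intro sum.cong refl)
      fix i' c' b' assume lt: "i' \<in> {..<s}" "c' \<in> {..<a i' k}" "b' \<in> {..<a i' k}"
      have "dim_sum k \<noteq> 0"
        using weight_pos[OF kj(1)] unfolding weight_eq[OF kj(1)] by (intro notI) simp
      then show "of_nat (a i' k) * ent Y i' (k, y, b') (j, x, c') / of_nat (dim_sum k)
          * (\<Sum>g<dim_sum k. ?f g i b c * cnj (?f g i' b' c'))
        = (if b' = b then if c' = c then if i' = i then ent Y i (k, y, b) (j, x, c) else 0 else 0 else 0)"
        using fourier_unitary_complete[of i s b "\<lambda>l. a l k" c i' b' c'] i kj(3) ik(1) lt
        unfolding dim_sum_def[symmetric] by auto
    qed
    also have "\<dots> = (\<Sum>i'<s. if i' = i then ent Y i (k, y, b) (j, x, c) else 0)"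
    proof (intro sum.cong refl)
      fix i'
      \<comment> \<open>Collapsing the inner sum leaves the bound \<open>b < a i' k\<close>, which
        holds automatically once \<open>i' = i\<close>.\<close>
      have "(\<Sum>c'<a i' k. \<Sum>b'<a i' k. if b' = b then if c' = c then if i' = i then
        ent Y i (k, y, b) (j, x, c) else 0 else 0 else 0)
        = (\<Sum>c'<a i' k. if c' = c then if b < a i' k then if i' = i then
        ent Y i (k, y, b) (j, x, c) else 0 else 0 else 0)"
        by (intro sum.cong) auto
      then show "(\<Sum>c'<a i' k. \<Sum>b'<a i' k. if b' = b then if c' = c then if i' = i then
        ent Y i (k, y, b) (j, x, c) else 0 else 0 else 0) = (if i' = i then ent Y i (k, y, b) (j, x, c) else 0)"
        using kj(3) ik(1) by auto
    qed
    also have "\<dots> = ent Y i P Q"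
      using i(1) PQ by simp
    finally show "ent Y i P Q = ent (\<Oplus>\<^bsub>\<A>\<^esub> w \<in> {..<d}. W w \<otimes>\<^bsub>\<A>\<^esub> E ((W w)\<^sup>\<star>\<^bsub>\<A>\<^esub> \<otimes>\<^bsub>\<A>\<^esub> Y)) i P Q" ..
  qed (use Y W_c E_closed in \<open>auto intro!: A.finsum_closed\<close>)

  have "unitary_orthonormal_basis \<A> E d W"
    unfolding unitary_orthonormal_basis_def
    using normalizer_unitary[OF W] reconstruct orthonormal by blast
  then show ?thesis
    unfolding has_unitary_orthonormal_basis_in_normalizer_def using W by blast
qed

end

context multimatrix_expectation
begin

lemma basis_iff_regular_spectral:
  "has_unitary_orthonormal_basis_in_normalizer \<A> \<B>\<^sub>\<iota> E
    \<longleftrightarrow> regular_inclusion \<A> \<B>\<^sub>\<iota> \<and> spectral_condition r m s n \<Lambda>"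
proof
  assume "regular_inclusion \<A> \<B>\<^sub>\<iota> \<and> spectral_condition r m s n \<Lambda>"
  then obtain d where reg: "regular_inclusion \<A> \<B>\<^sub>\<iota>" and d: "\<And>j. j < r \<Longrightarrow> weight j = d * m j"
    unfolding spectral_condition_iff by blast
  interpret homogeneous_inclusion r s m n \<iota> \<Lambda> U \<A> \<B> E d
  proof unfold_locales
    fix i j k assume ijk: "i < s" "j < r" "k < r" "0 < a i j" "0 < a i k"
    show "m j = m k"
      by (rule regular_imp_homogeneous(1)[OF reg ijk])
    show "a l j = a l k" if "l < s" for l
      by (rule regular_imp_homogeneous(2)[OF reg ijk that])
  qed (rule d)
  show "has_unitary_orthonormal_basis_in_normalizer \<A> \<B>\<^sub>\<iota> E"
    by (rule has_basis)
qed (use basis_imp_regular basis_imp_spectral in blast)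

end

theorem theoremB:
  fixes r s :: nat
    and m n :: "nat \<Rightarrow> nat"
    and \<A> \<B> :: "(complex, nat \<Rightarrow> complex mat) star_algebra"
    and \<iota> :: "(nat \<Rightarrow> complex mat) \<Rightarrow> (nat \<Rightarrow> complex mat)"
    and \<Lambda> :: "nat mat"
    and E :: "(nat \<Rightarrow> complex mat) \<Rightarrow> (nat \<Rightarrow> complex mat)"
  defines "\<B> \<equiv> multimatrix_algebra r m"
    and "\<A> \<equiv> multimatrix_algebra s n"
  assumes "0 < r" and "0 < s"
    and "\<And>j. j < r \<Longrightarrow> 0 < m j" and "\<And>i. i < s \<Longrightarrow> 0 < n i"
    and "unital_star_embedding \<B> \<A> \<iota>"
    and "is_inclusion_matrix r m s n \<iota> \<Lambda>"
    and "conditional_expectation \<A> (\<iota> ` carrier \<B>) E"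
    and "\<And>X. X \<in> carrier \<A> \<Longrightarrow> tracial_state s n (E X) = tracial_state s n X"
  shows "(has_unitary_orthonormal_basis_in_normalizer \<A> (\<iota> ` carrier \<B>) E \<longleftrightarrow>
            regular_inclusion \<A> (\<iota> ` carrier \<B>) \<and> spectral_condition r m s n \<Lambda>) \<and>
         (r = 1 \<or> s = 1 \<longrightarrow>
            (regular_inclusion \<A> (\<iota> ` carrier \<B>) \<longleftrightarrow>
             has_unitary_orthonormal_basis_in_normalizer \<A> (\<iota> ` carrier \<B>) E))"
proof -
  obtain U where U: "U \<in> unitary_elements \<A>" "\<And>X. X \<in> carrier \<B> \<Longrightarrow>
      \<iota> X = U \<otimes>\<^bsub>\<A>\<^esub> standard_inclusion r s \<Lambda> X \<otimes>\<^bsub>\<A>\<^esub> U\<^sup>\<star>\<^bsub>\<A>\<^esub>"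
    and \<Lambda>: "\<Lambda> \<in> carrier_mat s r" "vec s n = \<Lambda> *\<^sub>v vec r m"
    using assms(8) unfolding is_inclusion_matrix_def Let_def \<A>_def \<B>_def by blast
  interpret multimatrix_expectation r s m n \<iota> \<Lambda> U \<A> \<B> E
    using assms U \<Lambda> by unfold_locales (auto simp: \<A>_def \<B>_def)
  show ?thesis
    using basis_iff_regular_spectral spectral_condition_of_matrix_algebra[OF _ _ \<open>0 < r\<close>] by blast
qed

end
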